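(* For all $\gamma\in(0,\gamma_0]$ such that $\kappa_\gamma>0$, $$\mathcal W_\rho(\nu_\gamma,\nu_* )\leqslant\sqrt\gamma\,\kappa_\gamma^{-1}C_6,$$ where $\nu_*$ is the unique quasi-stationary distribution of the killed diffusion $(Z,T)$ and $\nu_\gamma$ is the unique quasi-stationary distribution of the killed Euler chain $(\tilde Z,\tilde T)$ with time step $\gamma$.
   Context: $\mathbb T^d=\mathbb R^d/\mathbb Z^d$ is the flat torus with Euclidean distance $|x-y|$; $b\in\mathcal C^1(\mathbb T^d)$ is an $\mathbb R^d$-valued drift; $\lambda:\mathbb T^d\to[0,\infty)$ is Lipschitz with constant $L_\lambda$ (standing assumption). $\mathcal P(F)$ is the set of Borel probability measures on $F$; $\mathcal W_\rho(\mu,\nu)=\inf\{\mathbb E(\rho(X,Y)):X\sim\mu,\ Y\sim\nu\}$ for a distance $\rho$, and $\mathcal W_1$ is the case of the Euclidean distance. $\mathbb N=\{0,1,\dots\}$. Killed diffusion: $dZ_t=b(Z_t)dt+dB_t$ on $\mathbb T^d$ ($B$ a $d$-dimensional Brownian motion) and $T=\inf\{t\geqslant0:E\leqslant\int_0^t\lambda(Z_s)ds\}$ with $E$ an exponential variable of parameter 1 independent of $Z$; $\overline\eta_t=\mathcal{L}aw(Z_t\mid T>t)$ with $Z_0\sim\overline\eta_0$. $\nu_*$ is the unique $\nu\in\mathcal P(\mathbb T^d)$ such that $Z_0\sim\nu$ implies $\mathcal{L}aw(Z_t\mid T>t)=\nu$ for all $t\geqslant0$. Discrete system: for $\gamma>0$,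 $K$ is the Markov kernel on $\mathbb T^d$ given by $Kf(x)=(2\pi)^{-d/2}\int_{\mathbb R^d}f(x+\gamma b(x)+\sqrt\gamma y)e^{-|y|^2/2}dy$, and $p(z)=1-e^{-\gamma\lambda(z)}$. For $\mu\in\mathcal P(\mathbb T^d)$, $Q_\mu(x,\cdot)$ is the law of $X_H$, where $(X_k,U_k)_{k\in\mathbb N}$ are independent random variables with, for every $k$, $X_k$ and $U_k$ independent, $U_k$ uniform on $[0,1]$, $X_0\sim K(x,\cdot)$, $X_k\sim\mu K$ for $k\geqslant1$, and $H=\inf\{k\in\mathbb N:U_k\geqslant p(X_k)\}$. For $x\in\mathbb T^{dN}$, $\pi(x)=\frac1N\sum_{i=1}^N\delta_{x_i}$ and $R_{N,\gamma}(x,\cdot)=Q_{\pi(x)}(x_1,\cdot)\otimes\cdots\otimes Q_{\pi(x)}(x_N,\cdot)$. Given $\eta_0\in\mathcal P(\mathbb T^d)$ and $\gamma$, $(\eta_n)_{n\in\mathbb N}$ is defined by $\eta_{n+1}=\eta_nQ_{\eta_n}$. Killed Euler chain: $\tilde Z$ is the Markov chain with kernel $K$, and $\tilde T=\inf\{n\gamma:n\geqslant1,\ E\leqslant\gamma\sum_{k=1}^n\lambda(\tilde Z_k)\}$ with $E$ an independent exponential variable of parameter 1; one has $\eta_n=\mathcal{L}aw(\tilde Z_n\mid\tilde T>n\gamma)$ if $\tilde Z_0\sim\eta_0$. When $\kappa_\gamma>0$, $\eta_n$ converges as $n\to\infty$ to a limit independent of $\eta_0$, which is the unique quasi-stationary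 distribution $\nu_\gamma$ of this chain (the unique $\nu$ with $\mathcal{L}aw(\tilde Z_n\mid\tilde T>n\gamma)=\nu$ for all $n$ when $\tilde Z_0\sim\nu$). Constants (fixed throughout, such constants exist): $c_1,a,\gamma_0>0$ depend only on $b$ and $d$ and are such that, with the metric $\rho(x,y)=(1-e^{-a|x-y|})/a$ on $\mathbb T^d$, $\mathcal W_\rho(\mu K,\nu K)\leqslant(1-c_1\gamma)\mathcal W_\rho(\mu,\nu)$ for all $\gamma\in(0,\gamma_0]$ and $\mu,\nu\in\mathcal P(\mathbb T^d)$; $c_2>0$ depends only on $b$ and $d$ and is such that, with $\kappa_\gamma=c_1-c_2L_\lambda e^{\gamma\|\lambda\|_\infty}$ and $\rho_N(x,y)=\sum_{i=1}^N\rho(x_i,y_i)$, one has $\mathcal W_{\rho_N}(\mu R_{N,\gamma},\nu R_{N,\gamma})\leqslant(1-\gamma\kappa_\gamma)\mathcal W_{\rho_N}(\mu,\nu)$ for all $\gamma\in(0,\gamma_0]$, $N\geqslant1$ and $\mu,\nu\in\mathcal P(\mathbb T^{dN})$. $C_6>0$ is a constant (such a constant exists) such that for all $\gamma\in(0,\gamma_0]$ and $\eta_0=\overline\eta_0\in\mathcal P(\mathbb T^d)$: $\mathcal W_1(\eta_1,\overline\eta_\gamma)\leqslant C_6\gamma^{3/2}$ and, for all $m\geqslant1$, $\mathcal W_\rho(\eta_m,\overline\eta_{m\gamma})\leqslant\sqrt\gamma C_6\gamma\sum_{s=1}^m(1-\gamma\kappa_\gamma)^{s-1}$. *)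

theory Defs
  imports "HOL-Probability.Probability"
begin

section \<open>The flat torus\<close>

definition lattice_cong :: "real ^ 'd::finite \<Rightarrow> real ^ 'd \<Rightarrow> bool" where
  "lattice_cong u v \<longleftrightarrow> (\<forall>i. u $ i - v $ i \<in> \<int>)"

quotient_type 'd torus = "real ^ 'd::finite" / lattice_cong
  morphisms torus_rep to_torus
proof (rule equivpI)
  show "reflp (lattice_cong :: real ^ 'd \<Rightarrow> _)"
    by (simp add: reflp_def lattice_cong_def)
  show "symp (lattice_cong :: real ^ 'd \<Rightarrow> _)"
    unfolding symp_def lattice_cong_def by (metis Ints_minus minus_diff_eq)
  show "transp (lattice_cong :: real ^ 'd \<Rightarrow> _)"
  proof (rule transpI)
    fix u v w :: "real ^ 'd"
    assume uv: "lattice_cong u v" and vw: "lattice_cong v w"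
    have "(u $ i - v $ i) + (v $ i - w $ i) \<in> \<int>" for i
      using uv vw by (intro Ints_add) (simp_all add: lattice_cong_def)
    then show "lattice_cong u w"
      by (simp add: lattice_cong_def)
  qed
qed

lemma to_torus_eq_iff: "to_torus u = to_torus v \<longleftrightarrow> (\<forall>i. u $ i - v $ i \<in> \<int>)"
  by (simp add: torus.abs_eq_iff lattice_cong_def)

lemma to_torus_surj: obtains u where "x = to_torus u"
  by (metis Quotient_abs_rep Quotient_torus)

instantiation torus :: (finite) ab_group_add
begin

lift_definition zero_torus :: "'a torus" is 0 .

lift_definition plus_torus :: "'a torus \<Rightarrow> 'a torus \<Rightarrow> 'a torus" is "(+)"
  unfolding lattice_cong_def
  by (metis (no_types, lifting) Ints_add add_diff_add vector_add_component)

lift_definition uminus_torus :: "'a torus \<Rightarrow> 'a torus" is uminus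
  unfolding lattice_cong_def
  by (metis Ints_minus minus_diff_minus vector_uminus_component)

definition minus_torus :: "'a torus \<Rightarrow> 'a torus \<Rightarrow> 'a torus" where
  "minus_torus x y = x + - y"

instance
proof
  fix x y z :: "'a torus"
  show "x + y + z = x + (y + z)"
    by transfer (simp add: lattice_cong_def algebra_simps)
  show "x + y = y + x"
    by transfer (simp add: lattice_cong_def algebra_simps)
  show "0 + x = x"
    by transfer (simp add: lattice_cong_def)
  show "- x + x = 0"
    by transfer (simp add: lattice_cong_def)
  show "x - y = x + - y"
    by (rule minus_torus_def)
qed

end

instantiation torus :: (finite) metric_space
begin

definition dist_torus :: "'a torus \<Rightarrow> 'a torus \<Rightarrow> real" where
  "dist_torus x y = Inf {norm (u - v) | u v. to_torus u = x \<and> to_torus v = y}"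

definition uniformity_torus :: "('a torus \<times> 'a torus) filter" where
  "uniformity_torus = (INF e\<in>{0 <..}. principal {(x, y). dist x y < e})"

definition open_torus :: "'a torus set \<Rightarrow> bool" where
  "open_torus U \<longleftrightarrow> (\<forall>x\<in>U. eventually (\<lambda>(x', y). x' = x \<longrightarrow> y \<in> U) uniformity)"

instance
proof
  let ?D = "\<lambda>x y :: 'a torus. {norm (u - v) | u v. to_torus u = x \<and> to_torus v = y}"
  have ne: "?D x y \<noteq> {}" for x y
    by (metis (mono_tags, lifting) to_torus_surj empty_iff mem_Collect_eq)
  have bdd: "bdd_below (?D x y)" for x y
    by (rule bdd_belowI[of _ 0]) auto
  have lower: "dist x y \<le> norm (u - v)" if "to_torus u = x" "to_torus v = y" for x y :: "'a torus" and u v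
    unfolding dist_torus_def by (rule cInf_lower) (use that bdd in auto)
  have near: "\<exists>u v. to_torus u = x \<and> to_torus v = y \<and> norm (u - v) < dist x y + e"
    if "e > 0" for x y :: "'a torus" and e
  proof -
    have "Inf (?D x y) < dist x y + e"
      using that by (simp add: dist_torus_def)
    then show ?thesis
      using cInf_lessD[OF ne, of x y "dist x y + e"] by blast
  qed
  have nonneg: "0 \<le> dist x y" for x y :: "'a torus"
    unfolding dist_torus_def by (rule cInf_greatest[OF ne]) auto
  fix x y z :: "'a torus"
  show "dist x y = 0 \<longleftrightarrow> x = y"
  proof
    assume "dist x y = 0"
    then obtain u v where uv: "to_torus u = x" "to_torus v = y" "norm (u - v) < 1 / 2"
      using near[of "1/2" x y] by auto
    define m where "m = Min (insert (1/2) {\<bar>(u - v) $ i\<bar> | i. (u - v) $ i \<noteq> 0})"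
    have "m > 0"
      unfolding m_def by (subst Min_gr_iff) auto
    then obtain u' v' where uv': "to_torus u' = x" "to_torus v' = y" and small: "norm (u' - v') < m"
      using near[of m x y] \<open>dist x y = 0\<close> by auto
    have "(u - v) $ i = 0" for i
    proof (rule ccontr)
      assume nz: "(u - v) $ i \<noteq> 0"
      have "norm (u' - v') < \<bar>(u - v) $ i\<bar>"
        using small nz unfolding m_def by (subst (asm) Min_gr_iff) auto
      moreover have c': "\<bar>(u' - v') $ i\<bar> \<le> norm (u' - v')"
        by (rule component_le_norm_cart)
      moreover have c: "\<bar>(u - v) $ i\<bar> < 1 / 2"
        using component_le_norm_cart[of "u - v" i] uv(3) by linarith
      moreover have "(u' - v') $ i - (u - v) $ i \<in> \<int>"
      proof -
        have "u' $ i - u $ i \<in> \<int>" "v' $ i - v $ i \<in> \<int>"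
          using uv uv' to_torus_eq_iff by metis+
        then have "(u' $ i - u $ i) - (v' $ i - v $ i) \<in> \<int>"
          by (rule Ints_diff)
        then show ?thesis
          by (simp add: algebra_simps)
      qed
      moreover from calculation have "(u' - v') $ i - (u - v) $ i = 0"
        by (intro Ints_nonzero_abs_less1) linarith+
      ultimately show False
        by linarith
    qed
    then have "u = v"
      by (simp add: vec_eq_iff)
    then show "x = y"
      using uv by simp
  next
    assume "x = y"
    moreover obtain u where "x = to_torus u"
      by (rule to_torus_surj)
    ultimately have "dist x y \<le> norm (u - u)"
      by (intro lower) auto
    then show "dist x y = 0"
      using nonneg[of x y] by simp
  qed
  show "dist x y \<le> dist x z + dist y z"
  proof (rule field_le_epsilon)
    fix e :: real assume "e > 0"
    then obtain u w v w' where
      1: "to_torus u = x" "to_torus w = z" "norm (u - w) < dist x z + e / 2" and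
      2: "to_torus v = y" "to_torus w' = z" "norm (v - w') < dist y z + e / 2"
      using near[of "e / 2" x z] near[of "e / 2" y z] by auto
    have "to_torus (v + (w - w')) = y"
    proof -
      have "to_torus (v + (w - w')) = to_torus v"
        using 1(2) 2(2) by (simp add: to_torus_eq_iff) (metis to_torus_eq_iff)
      then show ?thesis
        using 2(1) by simp
    qed
    then have "dist x y \<le> norm (u - (v + (w - w')))"
      using 1(1) by (intro lower)
    also have "u - (v + (w - w')) = (u - w) - (v - w')"
      by simp
    also have "norm \<dots> \<le> norm (u - w) + norm (v - w')"
      by (rule norm_triangle_ineq4)
    finally show "dist x y \<le> dist x z + dist y z + e"
      using 1(3) 2(3) by simp
  qed
qed (simp_all add: uniformity_torus_def open_torus_def)

end

definition C1_torus :: "('d::finite torus \<Rightarrow> real ^ 'd) \<Rightarrow> bool" where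
  "C1_torus f \<longleftrightarrow> (\<exists>f' :: real ^ 'd \<Rightarrow> (real ^ 'd) \<Rightarrow>\<^sub>L (real ^ 'd).
     continuous_on UNIV f' \<and>
     (\<forall>u. ((\<lambda>v. f (to_torus v)) has_derivative blinfun_apply (f' u)) (at u)))"


section \<open>Wasserstein distances\<close>

definition couplings :: "'s measure \<Rightarrow> 't measure \<Rightarrow> ('s \<times> 't) measure set" where
  "couplings \<mu> \<nu> = {P \<in> space (prob_algebra (\<mu> \<Otimes>\<^sub>M \<nu>)). distr P \<mu> fst = \<mu> \<and> distr P \<nu> snd = \<nu>}"

definition wasserstein :: "('s \<Rightarrow> 's \<Rightarrow> real) \<Rightarrow> 's measure \<Rightarrow> 's measure \<Rightarrow> real" where
  "wasserstein \<rho> \<mu> \<nu> = (INF P\<in>couplings \<mu> \<nu>. \<integral>z. \<rho> (fst z) (snd z) \<partial>P)"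

definition rho :: "real \<Rightarrow> 's::metric_space \<Rightarrow> 's \<Rightarrow> real" where
  "rho a x y = (1 - exp (- a * dist x y)) / a"

definition rho_N :: "real \<Rightarrow> nat \<Rightarrow> (nat \<Rightarrow> 's::metric_space) \<Rightarrow> (nat \<Rightarrow> 's) \<Rightarrow> real" where
  "rho_N a N x y = (\<Sum>i<N. rho a (x i) (y i))"


section \<open>Random variables\<close>

text \<open>The library's \<^term>\<open>prob_space.indep_var\<close> requires both variables to take values in the
  same type.\<close>

definition independent_rvs ::
    "'w measure \<Rightarrow> 's measure \<Rightarrow> ('w \<Rightarrow> 's) \<Rightarrow> 't measure \<Rightarrow> ('w \<Rightarrow> 't) \<Rightarrow> bool" where
  "independent_rvs M S X S' Y \<longleftrightarrow> X \<in> M \<rightarrow>\<^sub>M S \<and> Y \<in> M \<rightarrow>\<^sub>M S' \<and>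
     prob_space.indep_set M {X -` A \<inter> space M | A. A \<in> sets S} {Y -` A \<inter> space M | A. A \<in> sets S'}"

definition conditional_law :: "'w measure \<Rightarrow> ('w \<Rightarrow> 's::topological_space) \<Rightarrow> 'w set \<Rightarrow> 's measure" where
  "conditional_law M X A = distr (uniform_measure M A) borel X"

definition std_gaussian :: "(real ^ 'd::finite) measure" where
  "std_gaussian = density lborel
     (\<lambda>y. ennreal ((2 * pi) powr (- real CARD('d) / 2) * exp (- (norm y)\<^sup>2 / 2)))"


section \<open>The killed diffusion\<close>

definition brownian_motion :: "'w measure \<Rightarrow> (real \<Rightarrow> 'w \<Rightarrow> real ^ 'd::finite) \<Rightarrow> bool" where
  "brownian_motion M B \<longleftrightarrow>
     prob_space M \<and>
     (\<forall>t\<ge>0. B t \<in> borel_measurable M) \<and>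
     (\<forall>\<omega>\<in>space M. B 0 \<omega> = 0 \<and> continuous_on {0..} (\<lambda>t. B t \<omega>)) \<and>
     (\<forall>s t. 0 \<le> s \<and> s < t \<longrightarrow>
        distr M borel (\<lambda>\<omega>. B t \<omega> - B s \<omega>) = distr std_gaussian borel (\<lambda>y. sqrt (t - s) *\<^sub>R y) \<and>
        independent_rvs M borel (\<lambda>\<omega>. B t \<omega> - B s \<omega>)
          (PiM {0..s} (\<lambda>_. borel)) (\<lambda>\<omega>. \<lambda>r\<in>{0..s}. B r \<omega>))"

text \<open>As the noise is additive, \<open>dZ = b(Z) dt + dB\<close> is a pathwise integral equation.\<close>

definition diffusion ::
    "('d::finite torus \<Rightarrow> real ^ 'd) \<Rightarrow> 'w measure \<Rightarrow> (real \<Rightarrow> 'w \<Rightarrow> 'd torus) \<Rightarrow>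
     (real \<Rightarrow> 'w \<Rightarrow> real ^ 'd) \<Rightarrow> bool" where
  "diffusion b M Z B \<longleftrightarrow>
     brownian_motion M B \<and>
     (\<forall>t\<ge>0. Z t \<in> borel_measurable M) \<and>
     independent_rvs M borel (Z 0) (PiM {0..} (\<lambda>_. borel)) (\<lambda>\<omega>. \<lambda>t\<in>{0..}. B t \<omega>) \<and>
     (\<forall>\<omega>\<in>space M. continuous_on {0..} (\<lambda>t. Z t \<omega>) \<and>
        (\<forall>t\<ge>0. Z t \<omega> = Z 0 \<omega> + to_torus (integral {0..t} (\<lambda>s. b (Z s \<omega>)) + B t \<omega>)))"

definition killing_time ::
    "('d::finite torus \<Rightarrow> real) \<Rightarrow> (real \<Rightarrow> 'w \<Rightarrow> 'd torus) \<Rightarrow> ('w \<Rightarrow> real) \<Rightarrow> 'w \<Rightarrow> ereal" where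
  "killing_time lam Z E \<omega> =
     Inf (ereal ` {t. 0 \<le> t \<and> E \<omega> \<le> integral {0..t} (\<lambda>s. lam (Z s \<omega>))})"

definition killed_diffusion ::
    "('d::finite torus \<Rightarrow> real ^ 'd) \<Rightarrow> 'w measure \<Rightarrow> (real \<Rightarrow> 'w \<Rightarrow> 'd torus) \<Rightarrow>
     (real \<Rightarrow> 'w \<Rightarrow> real ^ 'd) \<Rightarrow> ('w \<Rightarrow> real) \<Rightarrow> bool" where
  "killed_diffusion b M Z B E \<longleftrightarrow>
     diffusion b M Z B \<and>
     distributed M lborel E (exponential_density 1) \<and>
     independent_rvs M borel E (PiM {0..} (\<lambda>_. borel)) (\<lambda>\<omega>. \<lambda>t\<in>{0..}. Z t \<omega>)"

text \<open>The law of \<open>Z\<^sub>t\<close> given \<open>T > t\<close> when \<open>Z\<^sub>0\<close> has law \<open>\<mu>\<close>; by uniqueness in law it does not depend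
  on the probability space. The sample type holds an initial point, a Brownian path and the
  exponential variable, which is enough for a solution to exist.\<close>

definition killed_diffusion_law ::
    "('d::finite torus \<Rightarrow> real ^ 'd) \<Rightarrow> ('d torus \<Rightarrow> real) \<Rightarrow> 'd torus measure \<Rightarrow> real \<Rightarrow> 'd torus measure" where
  "killed_diffusion_law b lam \<mu> t =
     (THE \<nu>. \<exists>(M :: ('d torus \<times> (real \<Rightarrow> real ^ 'd) \<times> real) measure) Z B E.
        killed_diffusion b M Z B E \<and> distr M borel (Z 0) = \<mu> \<and>
        \<nu> = conditional_law M (Z t) {\<omega> \<in> space M. ereal t < killing_time lam Z E \<omega>})"

definition diffusion_qsd ::
    "('d::finite torus \<Rightarrow> real ^ 'd) \<Rightarrow> ('d torus \<Rightarrow> real) \<Rightarrow> 'd torus measure \<Rightarrow> bool" where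
  "diffusion_qsd b lam \<nu> \<longleftrightarrow>
     \<nu> \<in> space (prob_algebra borel) \<and> (\<forall>t\<ge>0. killed_diffusion_law b lam \<nu> t = \<nu>)"


section \<open>The Euler kernel, the particle system and its mean-field limit\<close>

definition euler_kernel ::
    "('d::finite torus \<Rightarrow> real ^ 'd) \<Rightarrow> real \<Rightarrow> 'd torus \<Rightarrow> 'd torus measure" where
  "euler_kernel b \<gamma> x =
     distr std_gaussian borel (\<lambda>y. x + to_torus (\<gamma> *\<^sub>R b x + sqrt \<gamma> *\<^sub>R y))"

definition kill_prob :: "('s \<Rightarrow> real) \<Rightarrow> real \<Rightarrow> 's \<Rightarrow> real" where
  "kill_prob lam \<gamma> z = 1 - exp (- \<gamma> * lam z)"

text \<open>The law of \<open>X\<^sub>H\<close>, with \<open>\<omega> k = (X\<^sub>k, U\<^sub>k)\<close>; almost surely \<open>H < \<infinity>\<close>.\<close>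

definition Q_kernel ::
    "('d::finite torus \<Rightarrow> real ^ 'd) \<Rightarrow> ('d torus \<Rightarrow> real) \<Rightarrow> real \<Rightarrow> 'd torus measure \<Rightarrow>
     'd torus \<Rightarrow> 'd torus measure" where
  "Q_kernel b lam \<gamma> \<mu> x =
     distr
       (PiM UNIV (\<lambda>k::nat. (if k = 0 then euler_kernel b \<gamma> x else \<mu> \<bind> euler_kernel b \<gamma>)
          \<Otimes>\<^sub>M uniform_measure lborel {0..1}))
       borel
       (\<lambda>\<omega>. fst (\<omega> (Inf {k. snd (\<omega> k) \<ge> kill_prob lam \<gamma> (fst (\<omega> k))})))"

text \<open>\<open>(1/N) \<Sum>\<^sub>i \<delta>\<^bsub>x i\<^esub>\<close>, as the law of \<open>x\<close> at a uniform random index.\<close>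

definition empirical_measure :: "nat \<Rightarrow> (nat \<Rightarrow> 's::topological_space) \<Rightarrow> 's measure" where
  "empirical_measure N x = distr (uniform_count_measure {..<N}) borel x"

definition particle_kernel ::
    "('d::finite torus \<Rightarrow> real ^ 'd) \<Rightarrow> ('d torus \<Rightarrow> real) \<Rightarrow> real \<Rightarrow> nat \<Rightarrow>
     (nat \<Rightarrow> 'd torus) \<Rightarrow> (nat \<Rightarrow> 'd torus) measure" where
  "particle_kernel b lam \<gamma> N x =
     PiM {..<N} (\<lambda>i. Q_kernel b lam \<gamma> (empirical_measure N x) (x i))"

primrec mean_field_law ::
    "('d::finite torus \<Rightarrow> real ^ 'd) \<Rightarrow> ('d torus \<Rightarrow> real) \<Rightarrow> real \<Rightarrow> 'd torus measure \<Rightarrow>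
     nat \<Rightarrow> 'd torus measure" where
  "mean_field_law b lam \<gamma> \<eta>0 0 = \<eta>0"
| "mean_field_law b lam \<gamma> \<eta>0 (Suc n) =
     mean_field_law b lam \<gamma> \<eta>0 n \<bind> Q_kernel b lam \<gamma> (mean_field_law b lam \<gamma> \<eta>0 n)"

definition kappa ::
    "('s \<Rightarrow> real) \<Rightarrow> real \<Rightarrow> real \<Rightarrow> real \<Rightarrow> real \<Rightarrow> real" where
  "kappa lam L c1 c2 \<gamma> = c1 - c2 * L * exp (\<gamma> * (SUP x. \<bar>lam x\<bar>))"


section \<open>The killed Euler chain\<close>

definition markov_chain ::
    "('s::topological_space \<Rightarrow> 's measure) \<Rightarrow> 'w measure \<Rightarrow> (nat \<Rightarrow> 'w \<Rightarrow> 's) \<Rightarrow> bool" where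
  "markov_chain K M Z \<longleftrightarrow>
     prob_space M \<and>
     (\<forall>n. Z n \<in> borel_measurable M) \<and>
     (\<forall>n. \<forall>D\<in>sets (PiM {..n} (\<lambda>_. borel)). \<forall>A\<in>sets borel.
        measure M {\<omega> \<in> space M. (\<lambda>i\<in>{..n}. Z i \<omega>) \<in> D \<and> Z (Suc n) \<omega> \<in> A} =
        (LINT \<omega>:{\<omega> \<in> space M. (\<lambda>i\<in>{..n}. Z i \<omega>) \<in> D}|M. measure (K (Z n \<omega>)) A))"

definition chain_killing_time ::
    "('s \<Rightarrow> real) \<Rightarrow> real \<Rightarrow> (nat \<Rightarrow> 'w \<Rightarrow> 's) \<Rightarrow> ('w \<Rightarrow> real) \<Rightarrow> 'w \<Rightarrow> ereal" where
  "chain_killing_time lam \<gamma> Z E \<omega> =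
     Inf {ereal (real n * \<gamma>) | n. n \<ge> 1 \<and> E \<omega> \<le> \<gamma> * (\<Sum>k=1..n. lam (Z k \<omega>))}"

definition killed_euler_chain ::
    "('d::finite torus \<Rightarrow> real ^ 'd) \<Rightarrow> real \<Rightarrow> 'w measure \<Rightarrow> (nat \<Rightarrow> 'w \<Rightarrow> 'd torus) \<Rightarrow>
     ('w \<Rightarrow> real) \<Rightarrow> bool" where
  "killed_euler_chain b \<gamma> M Z E \<longleftrightarrow>
     markov_chain (euler_kernel b \<gamma>) M Z \<and>
     distributed M lborel E (exponential_density 1) \<and>
     independent_rvs M borel E (PiM UNIV (\<lambda>_. borel)) (\<lambda>\<omega> n. Z n \<omega>)"

definition killed_euler_law ::
    "('d::finite torus \<Rightarrow> real ^ 'd) \<Rightarrow> ('d torus \<Rightarrow> real) \<Rightarrow> real \<Rightarrow> 'd torus measure \<Rightarrow>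
     nat \<Rightarrow> 'd torus measure" where
  "killed_euler_law b lam \<gamma> \<mu> n =
     (THE \<nu>. \<exists>(M :: ((nat \<Rightarrow> 'd torus) \<times> real) measure) Z E.
        killed_euler_chain b \<gamma> M Z E \<and> distr M borel (Z 0) = \<mu> \<and>
        \<nu> = conditional_law M (Z n)
              {\<omega> \<in> space M. ereal (real n * \<gamma>) < chain_killing_time lam \<gamma> Z E \<omega>})"

definition euler_qsd ::
    "('d::finite torus \<Rightarrow> real ^ 'd) \<Rightarrow> ('d torus \<Rightarrow> real) \<Rightarrow> real \<Rightarrow> 'd torus measure \<Rightarrow> bool" where
  "euler_qsd b lam \<gamma> \<nu> \<longleftrightarrow>
     \<nu> \<in> space (prob_algebra borel) \<and> (\<forall>n. killed_euler_law b lam \<gamma> \<nu> n = \<nu>)"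

end

theory Submission
  imports Defs
begin

text \<open>One step of the mean-field recursion is the normalised map \<open>\<eta> \<mapsto> \<eta>P / \<eta>P(1)\<close> with
  \<open>P(x, dz) = exp (- \<gamma> \<lambda>(z)) K(x, dz)\<close>, and a quasi-stationary distribution \<open>\<nu>\<^sub>\<gamma>\<close> of the killed Euler chain
  is a fixed point of this map. On the compact torus \<open>\<alpha> m \<le> P(x, \<cdot>) \<le> \<beta> m\<close> for a reference measure \<open>m\<close>
  and \<open>0 < \<alpha> \<le> \<beta>\<close>, so the best constants in \<open>l \<nu>\<^sub>\<gamma> \<le> \<eta>\<^sub>n \<le> u \<nu>\<^sub>\<gamma>\<close> satisfy \<open>u / l \<rightarrow> 1\<close> geometrically, from any
  initial law. Hence the mean-field laws started at \<open>\<nu>\<^sub>*\<close> converge to \<open>\<nu>\<^sub>\<gamma>\<close>, while the discretization error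
  keeps them within the claimed distance of \<open>\<nu>\<^sub>*\<close>, the diffusion being stationary there.\<close>

section \<open>The topology of the torus\<close>

text \<open>The hypotheses compare the mean-field laws with the diffusion; their convergence to a
  given quasi-stationary law of the chain has to be established here. Normalisation makes the
  recursion nonlinear, so contraction cannot be read off from a linear kernel. Two-sided
  multiplicative bounds suit it: dividing by the total mass rescales both constants and leaves their
  ratio alone, while each step refreshes a fixed fraction of the mass with a law that does not
  remember the starting point. The final constant comes from summing the one-step errors:
  \<open>sqrt \<gamma> * C6 * \<gamma>\<close> times a geometric sum of ratio
  \<open>1 - \<gamma> * \<kappa>\<close> is at most \<open>sqrt \<gamma> * C6 / \<kappa>\<close>.
  Passing to the limit in the first argument of the Wasserstein distance only takes the one-sided
  domination of \<open>\<eta>\<^sub>n\<close> by \<open>1 + \<delta>\<^sub>n\<close> times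
  \<open>\<nu>\<^sub>\<gamma>\<close>. \<open>killed_euler_law\<close> is a definite description. To
  know that \<open>\<nu>\<^sub>\<gamma>\<close> is a fixed point one must therefore construct a
  killed chain on the prescribed sample type and show that all such chains have the same conditional
  law.\<close>

lemma dist_to_torus_le: "dist (to_torus u) (to_torus v) \<le> norm (u - v)"
  unfolding dist_torus_def
  by (rule cInf_lower) (auto intro!: bdd_belowI[of _ 0])

text \<open>The infimum ranges over representatives of both points, yet that of the first can be
  prescribed: translating a near-optimal pair by one lattice vector keeps the difference.\<close>

lemma dist_torus_lessE:
  assumes "dist (to_torus u) y < e"
  obtains v where "to_torus v = y" "norm (u - v) < e"
proof -
  let ?D = "{norm (u' - v) | u' v. to_torus u' = to_torus u \<and> to_torus v = y}"
  have "?D \<noteq> {}"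
    by (metis (mono_tags, lifting) to_torus_surj empty_iff mem_Collect_eq)
  then obtain u' v where *: "to_torus u' = to_torus u" "to_torus v = y" "norm (u' - v) < e"
    using cInf_lessD[of ?D e] assms unfolding dist_torus_def by blast
  have "to_torus (v + (u - u')) = to_torus v"
    using *(1)[symmetric] by (simp add: to_torus_eq_iff)
  moreover have "u - (v + (u - u')) = u' - v"
    by simp
  ultimately show thesis
    using *(2,3) by (intro that[of "v + (u - u')"]) simp_all
qed

lemma to_torus_add: "to_torus (u + v) = to_torus u + to_torus v"
  by (simp add: plus_torus.abs_eq)

lemma continuous_to_torus: "continuous_on UNIV to_torus"
proof (rule continuous_onI)
  fix u :: "real ^ 'd" and e :: real
  assume "0 < e"
  then show "\<exists>d>0. \<forall>u'\<in>UNIV. dist u' u < d \<longrightarrow> dist (to_torus u') (to_torus u) \<le> e"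
    by (intro exI[of _ e]) (auto intro: order_trans[OF dist_to_torus_le] simp: dist_norm)
qed

text \<open>A ball around \<open>to_torus u\<close> lifts to a ball around \<open>u\<close>.
  Openness of the quotient map carries bases and continuity of periodic functions down to the
  torus.\<close>

lemma open_to_torus_image:
  assumes "open U"
  shows "open (to_torus ` U)"
  unfolding open_dist
proof
  fix x assume "x \<in> to_torus ` U"
  then obtain u where u: "u \<in> U" "x = to_torus u"
    by auto
  obtain e where e: "e > 0" "\<And>v. dist v u < e \<Longrightarrow> v \<in> U"
    using assms u(1) unfolding open_dist by auto
  have "y \<in> to_torus ` U" if "dist y x < e" for y
  proof -
    from that obtain v where "to_torus v = y" "norm (u - v) < e"
      using dist_torus_lessE[of u y e] u(2) by (auto simp: dist_commute)
    then show ?thesis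
      using e(2)[of v] by (auto simp: dist_norm norm_minus_commute)
  qed
  then show "\<exists>e>0. \<forall>y. dist y x < e \<longrightarrow> y \<in> to_torus ` U"
    using e(1) by blast
qed

text \<open>An open continuous surjection maps a countable base to a countable base. Second
  countability is what turns continuity of addition into joint Borel measurability.\<close>

instance torus :: (finite) second_countable_topology
proof
  obtain B :: "(real ^ 'a) set set" where B: "countable B" "topological_basis B"
    using ex_countable_basis by auto
  have "topological_basis ((`) to_torus ` B :: 'a torus set set)"
  proof (rule topological_basisI)
    show "open b" if "b \<in> (`) to_torus ` B" for b :: "'a torus set"
      using that topological_basis_open[OF B(2)] open_to_torus_image by auto
    fix O' :: "'a torus set" and x
    assume O': "open O'" "x \<in> O'"
    obtain u where u: "x = to_torus u"
      by (rule to_torus_surj)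
    have "open (to_torus -` O')"
      using O'(1) continuous_to_torus by (rule open_vimage)
    moreover have "u \<in> to_torus -` O'"
      using O'(2) u by simp
    ultimately obtain b where "b \<in> B" "u \<in> b" "b \<subseteq> to_torus -` O'"
      by (rule topological_basisE[OF B(2)])
    then show "\<exists>B'\<in>(`) to_torus ` B. x \<in> B' \<and> B' \<subseteq> O'"
      using u by (intro bexI[of _ "to_torus ` b"]) auto
  qed
  then show "\<exists>B :: 'a torus set set. countable B \<and> open = generate_topology B"
    using B(1) topological_basis_imp_subbasis by blast
qed

lemma to_torus_unit_cube:
  obtains u where "u \<in> cbox 0 1" "x = to_torus u"
proof -
  obtain v where v: "x = to_torus v"
    by (rule to_torus_surj)
  have "to_torus (\<chi> i. frac (v $ i)) = to_torus v"
    by (simp add: to_torus_eq_iff frac_def)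
  moreover have "(\<chi> i. frac (v $ i)) \<in> cbox 0 1"
    by (auto simp: mem_box_cart less_imp_le[OF frac_lt_1])
  ultimately show thesis
    using that v by auto
qed

lemma compact_UNIV_torus: "compact (UNIV :: 'd::finite torus set)"
proof -
  have "compact (to_torus ` cbox (0 :: real ^ 'd) 1)"
    by (intro compact_continuous_image continuous_on_subset[OF continuous_to_torus]) auto
  also have "to_torus ` cbox (0 :: real ^ 'd) 1 = UNIV"
    using to_torus_unit_cube by blast
  finally show ?thesis .
qed

lemma dist_torus_add_le:
  fixes x y :: "'d::finite torus"
  shows "dist (x + x') (y + y') \<le> dist x y + dist x' y'"
proof (rule field_le_epsilon)
  fix e :: real assume "e > 0"
  obtain u where u1: "x = to_torus u"
    by (rule to_torus_surj)
  obtain u' where u2: "x' = to_torus u'"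
    by (rule to_torus_surj)
  note u = u1 u2
  obtain v where v: "to_torus v = y" "norm (u - v) < dist x y + e / 2"
    using dist_torus_lessE[of u y "dist x y + e / 2"] u \<open>e > 0\<close> by auto
  obtain v' where v': "to_torus v' = y'" "norm (u' - v') < dist x' y' + e / 2"
    using dist_torus_lessE[of u' y' "dist x' y' + e / 2"] u \<open>e > 0\<close> by auto
  have "dist (x + x') (y + y') \<le> norm ((u + u') - (v + v'))"
    unfolding u v(1)[symmetric] v'(1)[symmetric] to_torus_add[symmetric] by (rule dist_to_torus_le)
  also have "\<dots> \<le> norm (u - v) + norm (u' - v')"
    by (metis add_diff_add norm_triangle_ineq)
  finally show "dist (x + x') (y + y') \<le> dist x y + dist x' y' + e"
    using v(2) v'(2) by simp
qed

lemma tendsto_add_torus: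
  fixes f g :: "'a \<Rightarrow> 'd::finite torus"
  assumes "(f \<longlongrightarrow> x) F" "(g \<longlongrightarrow> y) F"
  shows "((\<lambda>z. f z + g z) \<longlongrightarrow> x + y) F"
proof -
  have "((\<lambda>z. dist (f z) x + dist (g z) y) \<longlongrightarrow> 0 + 0) F"
    using assms by (intro tendsto_add tendsto_dist_iff[THEN iffD1])
  then show ?thesis
    unfolding tendsto_dist_iff[of _ "x + y"]
    by (intro Lim_null_comparison[of "\<lambda>z. dist (f z + g z) (x + y)"])
       (auto simp: dist_torus_add_le)
qed

lemma continuous_on_add_torus:
  fixes f g :: "'a::topological_space \<Rightarrow> 'd::finite torus"
  assumes "continuous_on S f" "continuous_on S g"
  shows "continuous_on S (\<lambda>x. f x + g x)"
  using assms unfolding continuous_on_def by (auto intro: tendsto_add_torus)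

text \<open>The definition speaks of the periodic lift. A preimage under \<open>b\<close> is the
  projection of the preimage under the lift, hence open since the projection is an open map.\<close>

lemma C1_torus_continuous:
  fixes b :: "'d::finite torus \<Rightarrow> real ^ 'd"
  assumes "C1_torus b"
  shows "continuous_on UNIV b"
proof -
  obtain f' :: "real ^ 'd \<Rightarrow> (real ^ 'd) \<Rightarrow>\<^sub>L (real ^ 'd)" where
    f': "\<And>u. ((\<lambda>v. b (to_torus v)) has_derivative blinfun_apply (f' u)) (at u)"
    using assms unfolding C1_torus_def by auto
  have *: "continuous_on UNIV (\<lambda>v. b (to_torus v))"
    by (rule continuous_at_imp_continuous_on) (use has_derivative_continuous[OF f'] in simp)
  have "open (b -` W)" if "open W" for W
  proof -
    have "b -` W = to_torus ` ((\<lambda>v. b (to_torus v)) -` W)"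
    proof (intro equalityI subsetI)
      fix x assume "x \<in> b -` W"
      moreover obtain v where "x = to_torus v"
        by (rule to_torus_surj)
      ultimately show "x \<in> to_torus ` ((\<lambda>v. b (to_torus v)) -` W)"
        by auto
    qed auto
    then show ?thesis
      using open_to_torus_image[OF open_vimage[OF that *]] by simp
  qed
  then have "\<forall>W. open W \<longrightarrow> open (b -` W \<inter> UNIV)"
    by simp
  with continuous_on_open_vimage[OF open_UNIV, of b] show ?thesis
    by (rule iffD2)
qed

lemma bounded_range_torus:
  fixes f :: "'d::finite torus \<Rightarrow> 'b::metric_space"
  assumes "continuous_on UNIV f"
  shows "bounded (range f)"
  using compact_continuous_image[OF assms compact_UNIV_torus] by (rule compact_imp_bounded)

section \<open>Two-sided bounds for the Euler kernel\<close>

definition gauss_density :: "real ^ 'd::finite \<Rightarrow> real" where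
  "gauss_density y = (2 * pi) powr (- real CARD('d) / 2) * exp (- (norm y)\<^sup>2 / 2)"

lemma gauss_density_nonneg: "0 \<le> gauss_density y"
  by (simp add: gauss_density_def)

lemma gauss_density_measurable [measurable]: "gauss_density \<in> borel_measurable borel"
  unfolding gauss_density_def by measurable

lemma std_gaussian_eq: "std_gaussian = density lborel (\<lambda>y. ennreal (gauss_density y))"
  by (simp add: std_gaussian_def gauss_density_def)

lemma sets_std_gaussian [measurable_cong, simp]: "sets std_gaussian = sets borel"
  and space_std_gaussian [simp]: "space std_gaussian = UNIV"
  by (simp_all add: std_gaussian_def)

text \<open>Reduces the normalisation in dimension \<open>d\<close> to that of the one-dimensional
  normal density.\<close>

lemma gauss_density_eq_prod:
  "gauss_density (y :: real ^ 'd::finite) = (\<Prod>b\<in>Basis. std_normal_density (y \<bullet> b))"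
proof -
  have "(norm y)\<^sup>2 = (\<Sum>b\<in>Basis. (y \<bullet> b)\<^sup>2)"
    unfolding power2_norm_eq_inner by (subst euclidean_inner) (simp add: power2_eq_square)
  then have "exp (- (norm y)\<^sup>2 / 2) = (\<Prod>b\<in>Basis. exp (- (y \<bullet> b)\<^sup>2 / 2))"
    by (simp add: exp_sum[symmetric] sum_negf sum_divide_distrib)
  moreover have "(2 * pi) powr (- real CARD('d) / 2) = (1 / sqrt (2 * pi)) ^ CARD('d)"
  proof -
    have "1 / sqrt (2 * pi) = (2 * pi) powr (- 1 / 2)"
      by (simp add: powr_minus powr_half_sqrt inverse_eq_divide)
    then show ?thesis
      by (simp add: powr_realpow[symmetric] powr_powr)
  qed
  ultimately show ?thesis
    by (simp add: gauss_density_def std_normal_density_def prod_dividef power_one_over)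
qed

lemma nn_integral_gauss_density:
  "(\<integral>\<^sup>+y. ennreal (gauss_density (y :: real ^ 'd::finite)) \<partial>lborel) = 1"
proof -
  have "(\<integral>\<^sup>+x. ennreal (std_normal_density x) \<partial>lborel) = 1"
    using prob_space.emeasure_space_1[OF prob_space_normal_density[of 1 0]]
    by (simp add: emeasure_density)
  then show ?thesis
    unfolding gauss_density_eq_prod
    using nn_integral_lborel_prod[of "\<lambda>(_ :: real ^ 'd) x. ennreal (std_normal_density x)"]
    by (simp add: prod_ennreal[symmetric] normal_density_nonneg)
qed

lemma prob_space_std_gaussian: "prob_space std_gaussian"
  by (rule prob_spaceI) (simp add: std_gaussian_eq emeasure_density nn_integral_gauss_density)

section \<open>The Euler kernel as an integral against Lebesgue measure\<close>

lemma nn_integral_lborel_affine: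
  fixes t :: "'a::euclidean_space"
  assumes [measurable]: "f \<in> borel_measurable borel" and "c \<noteq> 0"
  shows "(\<integral>\<^sup>+u. f u \<partial>lborel) = ennreal (\<bar>c\<bar> ^ DIM('a)) * (\<integral>\<^sup>+y. f (t + c *\<^sub>R y) \<partial>lborel)"
  by (subst lborel_affine[OF assms(2), of t])
     (simp add: nn_integral_density nn_integral_distr nn_integral_cmult)

lemma nn_integral_std_gaussian_affine:
  fixes w :: "real ^ 'd::finite"
  assumes [measurable]: "F \<in> borel_measurable borel" and c: "0 < c"
  shows "(\<integral>\<^sup>+y. F (w + c *\<^sub>R y) \<partial>std_gaussian)
    = ennreal (inverse (c ^ CARD('d))) * (\<integral>\<^sup>+u. F u * ennreal (gauss_density ((1 / c) *\<^sub>R (u - w))) \<partial>lborel)"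
proof -
  have "(\<integral>\<^sup>+u. F u * ennreal (gauss_density ((1 / c) *\<^sub>R (u - w))) \<partial>lborel)
      = ennreal (c ^ CARD('d)) * (\<integral>\<^sup>+y. F (w + c *\<^sub>R y) * ennreal (gauss_density y) \<partial>lborel)"
    using c by (subst nn_integral_lborel_affine[of _ c w]) simp_all
  moreover have "(\<integral>\<^sup>+y. F (w + c *\<^sub>R y) \<partial>std_gaussian)
      = (\<integral>\<^sup>+y. F (w + c *\<^sub>R y) * ennreal (gauss_density y) \<partial>lborel)"
    unfolding std_gaussian_eq by (subst nn_integral_density) (simp_all add: mult.commute)
  moreover have "ennreal (inverse (c ^ CARD('d))) * ennreal (c ^ CARD('d)) = 1"
    using c by (simp add: ennreal_mult[symmetric])
  ultimately show ?thesis
    by (simp add: mult.assoc[symmetric])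
qed

lemma measurable_to_torus [measurable]: "to_torus \<in> borel_measurable borel"
  by (rule borel_measurable_continuous_onI[OF continuous_to_torus])

lemma measurable_add_torus [measurable (raw)]:
  fixes f g :: "'a \<Rightarrow> 'd::finite torus"
  assumes "f \<in> borel_measurable M" "g \<in> borel_measurable M"
  shows "(\<lambda>x. f x + g x) \<in> borel_measurable M"
  by (rule borel_measurable_continuous_Pair[OF assms])
     (intro continuous_on_add_torus continuous_on_fst continuous_on_snd continuous_on_id)

lemma sets_euler_kernel [simp]: "sets (euler_kernel b \<gamma> x) = sets borel"
  by (simp add: euler_kernel_def)

lemma euler_kernel_measurable [measurable]:
  fixes b :: "'d::finite torus \<Rightarrow> real ^ 'd"
  assumes [measurable]: "b \<in> borel_measurable borel"
  shows "euler_kernel b \<gamma> \<in> borel \<rightarrow>\<^sub>M prob_algebra borel"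
proof -
  have "(\<lambda>_. std_gaussian) \<in> (borel :: 'd torus measure) \<rightarrow>\<^sub>M prob_algebra (borel :: (real ^ 'd) measure)"
    by (rule measurable_const) (simp add: space_prob_algebra prob_space_std_gaussian)
  then show ?thesis
    unfolding euler_kernel_def by (rule measurable_distr_prob_space2) measurable
qed

text \<open>The reference measure \<open>m\<close>, equal to \<open>2 ^ d\<close> times Haar
  probability. The side length 2 leaves room for every difference of two points of the unit
  cube.\<close>

definition cube_measure :: "'d::finite torus measure" where
  "cube_measure = distr (density lborel (indicator (cbox (- 1) (1 :: real ^ 'd)))) borel to_torus"

lemma sets_cube_measure [simp, measurable_cong]: "sets cube_measure = sets borel"
  by (simp add: cube_measure_def)

lemma nn_integral_cube_measure:
  assumes [measurable]: "F \<in> borel_measurable borel"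
  shows "(\<integral>\<^sup>+z. F z \<partial>cube_measure)
    = (\<integral>\<^sup>+u. indicator (cbox (- 1) (1 :: real ^ 'd)) u * F (to_torus u) \<partial>lborel)"
  unfolding cube_measure_def by (subst nn_integral_distr) (simp_all add: nn_integral_density)

lemma emeasure_cube_measure:
  assumes [measurable]: "A \<in> sets borel"
  shows "emeasure cube_measure A
    = (\<integral>\<^sup>+u. indicator (cbox (- 1) (1 :: real ^ 'd)) u * indicator A (to_torus u) \<partial>lborel)"
  using nn_integral_cube_measure[of "indicator A"] by simp

lemma finite_cube_measure: "finite_measure (cube_measure :: 'd::finite torus measure)"
proof
  show "emeasure (cube_measure :: 'd torus measure) (space cube_measure) \<noteq> \<infinity>"
    using emeasure_lborel_cbox_finite[of "- 1 :: real ^ 'd" 1]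
    by (simp add: cube_measure_def emeasure_distr emeasure_density)
qed

lemma emeasure_euler_kernel:
  fixes b :: "'d::finite torus \<Rightarrow> real ^ 'd"
  assumes [measurable]: "A \<in> sets borel" and \<gamma>: "0 < \<gamma>"
  shows "emeasure (euler_kernel b \<gamma> (to_torus v)) A = ennreal (inverse (sqrt \<gamma> ^ CARD('d))) *
    (\<integral>\<^sup>+u. indicator A (to_torus u) *
       ennreal (gauss_density ((1 / sqrt \<gamma>) *\<^sub>R (u - (v + \<gamma> *\<^sub>R b (to_torus v))))) \<partial>lborel)"
proof -
  have "emeasure (euler_kernel b \<gamma> (to_torus v)) A
      = (\<integral>\<^sup>+z. indicator A z \<partial>euler_kernel b \<gamma> (to_torus v))"
    by simp
  also have "\<dots> = (\<integral>\<^sup>+y. indicator A (to_torus ((v + \<gamma> *\<^sub>R b (to_torus v)) + sqrt \<gamma> *\<^sub>R y)) \<partial>std_gaussian)"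
    unfolding euler_kernel_def
    by (subst nn_integral_distr) (simp_all add: to_torus_add[symmetric] add.assoc)
  also have "\<dots> = ennreal (inverse (sqrt \<gamma> ^ CARD('d))) *
    (\<integral>\<^sup>+u. indicator A (to_torus u) *
       ennreal (gauss_density ((1 / sqrt \<gamma>) *\<^sub>R (u - (v + \<gamma> *\<^sub>R b (to_torus v))))) \<partial>lborel)"
    using \<gamma> by (subst nn_integral_std_gaussian_affine[of "\<lambda>u. indicator A (to_torus u)"]) simp_all
  finally show ?thesis .
qed

text \<open>Compactness in concrete form: with representatives in fixed cubes, the Gaussian mean
  stays within a uniform distance of the target.\<close>

lemma euler_mean_bounded:
  fixes b :: "'d::finite torus \<Rightarrow> real ^ 'd"
  assumes "bounded (range b)"
  obtains R where "0 \<le> R" "\<And>u v x. u \<in> cbox (- 1) 1 \<Longrightarrow> v \<in> cbox 0 1 \<Longrightarrow> norm (u - (v + \<gamma> *\<^sub>R b x)) \<le> R"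
proof -
  obtain B where B: "\<And>x. norm (b x) \<le> B"
    using assms by (auto simp: bounded_iff)
  obtain R1 where R1: "\<And>u. u \<in> cbox (- 1 :: real ^ 'd) 1 \<Longrightarrow> norm u \<le> R1"
    using bounded_cbox[of "- 1 :: real ^ 'd" 1] by (auto simp: bounded_iff)
  have "norm (u - (v + \<gamma> *\<^sub>R b x)) \<le> R1 + (R1 + \<bar>\<gamma>\<bar> * B)" if "u \<in> cbox (- 1) 1" "v \<in> cbox 0 1" for u v x
  proof -
    have "v \<in> cbox (- 1) 1"
      using that(2) by (auto simp: mem_box_cart intro: order_trans[of _ 0])
    then have "norm (v + \<gamma> *\<^sub>R b x) \<le> R1 + \<bar>\<gamma>\<bar> * B"
      by (intro norm_triangle_mono R1) (auto intro: mult_left_mono B)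
    then show ?thesis
      using R1[OF that(1)] norm_triangle_ineq4[of u "v + \<gamma> *\<^sub>R b x"] by linarith
  qed
  then show thesis
    by (intro that[of "max 0 (R1 + (R1 + \<bar>\<gamma>\<bar> * B))"]) (auto simp: max.coboundedI2)
qed

text \<open>Of all the lifts of a target, only those in the cube \<open>[-1,1]^d\<close> are kept.
  There the Gaussian density is at least its value \<open>k\<close> at radius
  \<open>R / sqrt \<gamma>\<close>; \<open>c\<close> is the Jacobian of the scaling.\<close>

lemma euler_kernel_lower_bound:
  fixes b :: "'d::finite torus \<Rightarrow> real ^ 'd"
  assumes b: "bounded (range b)" and \<gamma>: "0 < \<gamma>"
  obtains \<alpha> where "0 < \<alpha>"
    "\<And>x A. A \<in> sets borel \<Longrightarrow> ennreal \<alpha> * emeasure cube_measure A \<le> emeasure (euler_kernel b \<gamma> x) A"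
proof -
  obtain R where R: "0 \<le> R" "\<And>u v x. u \<in> cbox (- 1) 1 \<Longrightarrow> v \<in> cbox 0 1 \<Longrightarrow> norm (u - (v + \<gamma> *\<^sub>R b x)) \<le> R"
    using euler_mean_bounded[OF b, of \<gamma>] by auto
  define k where "k = (2 * pi) powr (- real CARD('d) / 2) * exp (- (R / sqrt \<gamma>)\<^sup>2 / 2)"
  have k: "0 < k"
    by (simp add: k_def)
  define c where "c = inverse (sqrt \<gamma> ^ CARD('d))"
  have c: "0 < c"
    using \<gamma> by (simp add: c_def)
  have "ennreal (c * k) * emeasure cube_measure A \<le> emeasure (euler_kernel b \<gamma> x) A"
    if A[measurable]: "A \<in> sets borel" for x A
  proof -
    obtain v where v: "v \<in> cbox 0 1" "x = to_torus v"
      by (rule to_torus_unit_cube)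
    have "k \<le> gauss_density ((1 / sqrt \<gamma>) *\<^sub>R (u - (v + \<gamma> *\<^sub>R b (to_torus v))))"
      if "u \<in> cbox (- 1) 1" for u
    proof -
      have "norm ((1 / sqrt \<gamma>) *\<^sub>R (u - (v + \<gamma> *\<^sub>R b (to_torus v)))) \<le> R / sqrt \<gamma>"
        using R(2)[OF that v(1)] \<gamma> by (simp add: divide_right_mono)
      then show ?thesis
        unfolding k_def gauss_density_def
        by (intro mult_left_mono) (auto intro!: power_mono divide_right_mono)
    qed
    then have "ennreal k * emeasure cube_measure A \<le> (\<integral>\<^sup>+u. indicator A (to_torus u) *
        ennreal (gauss_density ((1 / sqrt \<gamma>) *\<^sub>R (u - (v + \<gamma> *\<^sub>R b (to_torus v))))) \<partial>lborel)"
      unfolding emeasure_cube_measure[OF A]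
      by (subst nn_integral_cmult[symmetric])
         (auto intro!: nn_integral_mono ennreal_leI split: split_indicator)
    then have "ennreal c * (ennreal k * emeasure cube_measure A) \<le> emeasure (euler_kernel b \<gamma> x) A"
      unfolding v(2) emeasure_euler_kernel[OF A \<gamma>] c_def by (rule mult_left_mono) simp
    then show ?thesis
      using c k by (simp add: ennreal_mult mult.assoc)
  qed
  then show thesis
    using c k by (intro that[of "c * k"]) auto
qed

text \<open>The integrand depends on \<open>v\<close> only modulo the lattice, so \<open>v\<close>
  may be taken in the unit cube; then \<open>v - s\<close> remains in \<open>[-1,1]^d\<close>. The
  bound is thus uniform in \<open>v\<close>.\<close>

lemma nn_integral_shifted_cube_le:
  fixes F :: "'d::finite torus \<Rightarrow> ennreal"
  assumes [measurable]: "F \<in> borel_measurable borel"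
  shows "(\<integral>\<^sup>+s. indicator (cbox 0 1) s * F (to_torus (v - s)) \<partial>lborel) \<le> (\<integral>\<^sup>+z. F z \<partial>cube_measure)"
proof -
  obtain v' where v': "v' \<in> cbox 0 1" "to_torus v = to_torus v'"
    by (rule to_torus_unit_cube)
  have eq: "to_torus (v - s) = to_torus (v' - s)" for s
    using v'(2) by (simp add: to_torus_eq_iff)
  have "(\<integral>\<^sup>+s. indicator (cbox 0 1) s * F (to_torus (v - s)) \<partial>lborel)
      = (\<integral>\<^sup>+u. indicator (cbox 0 1) (v' - u) * F (to_torus u) \<partial>lborel)"
    unfolding eq by (subst nn_integral_lborel_affine[of _ "- 1" v']) simp_all
  also have "\<dots> \<le> (\<integral>\<^sup>+u. indicator (cbox (- 1) (1 :: real ^ 'd)) u * F (to_torus u) \<partial>lborel)"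
  proof (intro nn_integral_mono mult_right_mono)
    fix u :: "real ^ 'd"
    have "u \<in> cbox (- 1) 1" if "v' - u \<in> cbox 0 1"
      using that v'(1) by (auto simp: mem_box_cart) (smt (verit))+
    then show "(indicator (cbox 0 1) (v' - u) :: ennreal) \<le> indicator (cbox (- 1) 1) u"
      by (auto split: split_indicator)
  qed simp
  also have "\<dots> = (\<integral>\<^sup>+z. F z \<partial>cube_measure)"
    by (simp add: nn_integral_cube_measure)
  finally show ?thesis .
qed


text \<open>The Gaussian density at \<open>u\<close> is dominated by a wider centred Gaussian at \<open>u + s\<close>, for every \<open>s\<close>
  in the unit cube. Averaging over \<open>s\<close> and exchanging the integrals leaves the integral of \<open>F\<close> over
  shifted cubes, which by periodicity is bounded by the reference measure: no lattice sum occurs.\<close>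

lemma euler_kernel_upper_bound:
  fixes b :: "'d::finite torus \<Rightarrow> real ^ 'd"
  assumes b: "bounded (range b)" and \<gamma>: "0 < \<gamma>"
  obtains \<beta> where "0 \<le> \<beta>"
    "\<And>x A. A \<in> sets borel \<Longrightarrow> emeasure (euler_kernel b \<gamma> x) A \<le> ennreal \<beta> * emeasure cube_measure A"
proof -
  obtain R where R: "0 \<le> R" "\<And>u v x. u \<in> cbox (- 1) 1 \<Longrightarrow> v \<in> cbox 0 1 \<Longrightarrow> norm (u - (v + \<gamma> *\<^sub>R b x)) \<le> R"
    using euler_mean_bounded[OF b, of \<gamma>] by auto
  \<comment> \<open>Doubling the variance pays for the factor 2 in
    \<open>|u + s|^2 \<le> 2 |u - w|^2 + 2 |s + w|^2\<close>; \<open>k\<close> pays for the last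
    term, where \<open>|s + w| \<le> R\<close>.\<close>
  define g where "g = (\<lambda>u :: real ^ 'd. gauss_density ((1 / sqrt (2 * \<gamma>)) *\<^sub>R u))"
  define k where "k = exp (R\<^sup>2 / (2 * \<gamma>))"
  have [measurable]: "g \<in> borel_measurable borel"
    unfolding g_def by measurable
  have g_nonneg: "0 \<le> g u" for u
    by (simp add: g_def gauss_density_nonneg)
  define I where "I = (\<integral>\<^sup>+u. ennreal (g u) \<partial>lborel)"
  have "I = ennreal (sqrt (2 * \<gamma>) ^ CARD('d))"
    unfolding I_def using \<gamma>
    by (subst nn_integral_lborel_affine[of _ "sqrt (2 * \<gamma>)" 0]) (simp_all add: g_def nn_integral_gauss_density)
  then have I: "I < \<infinity>"
    by simp
  define c where "c = inverse (sqrt \<gamma> ^ CARD('d))"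
  have c: "0 < c"
    using \<gamma> by (simp add: c_def)
  have "emeasure (euler_kernel b \<gamma> x) A \<le> ennreal (c * (k * enn2real I)) * emeasure cube_measure A"
    if A[measurable]: "A \<in> sets borel" for x A
  proof -
    obtain v where v: "v \<in> cbox 0 1" "x = to_torus v"
      by (rule to_torus_unit_cube)
    define w where "w = v + \<gamma> *\<^sub>R b (to_torus v)"
    have dens: "gauss_density ((1 / sqrt \<gamma>) *\<^sub>R (u - w)) \<le> k * g (u + s)" if "s \<in> cbox 0 1" for u s
    proof -
      \<comment> \<open>The radius bound is applied at the point \<open>- s\<close>, which lies in
        \<open>[-1,1]^d\<close>.\<close>
      have "norm (- s - w) \<le> R"
        unfolding w_def using that v(1) by (intro R(2)) (auto simp: mem_box_cart intro: order_trans[of _ 0])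
      then have "(norm (s + w))\<^sup>2 \<le> R\<^sup>2"
        by (intro power_mono) (simp_all add: norm_minus_commute add.commute)
      moreover have "(norm (u + s))\<^sup>2 \<le> 2 * (norm (u - w))\<^sup>2 + 2 * (norm (s + w))\<^sup>2"
      proof -
        have "norm (u + s) \<le> norm (u - w) + norm (s + w)"
          using norm_triangle_ineq[of "u - w" "s + w"] by (simp add: algebra_simps)
        then have "(norm (u + s))\<^sup>2 \<le> (norm (u - w) + norm (s + w))\<^sup>2"
          by (intro power_mono) simp_all
        also have "\<dots> \<le> 2 * (norm (u - w))\<^sup>2 + 2 * (norm (s + w))\<^sup>2"
          using zero_le_power2[of "norm (u - w) - norm (s + w)"]
          by (simp add: power2_eq_square algebra_simps)
        finally show ?thesis .
      qed
      ultimately have "(norm (u + s))\<^sup>2 \<le> 2 * (norm (u - w))\<^sup>2 + 2 * R\<^sup>2"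
        by linarith
      then have "- (norm (u - w))\<^sup>2 / (2 * \<gamma>) \<le> R\<^sup>2 / (2 * \<gamma>) - (norm (u + s))\<^sup>2 / (4 * \<gamma>)"
        using \<gamma> by (simp add: field_simps)
      then have "exp (- (norm (u - w))\<^sup>2 / (2 * \<gamma>)) \<le> k * exp (- (norm (u + s))\<^sup>2 / (4 * \<gamma>))"
        unfolding k_def by (simp add: exp_add[symmetric])
      moreover have "(norm ((1 / sqrt \<gamma>) *\<^sub>R (u - w)))\<^sup>2 / 2 = (norm (u - w))\<^sup>2 / (2 * \<gamma>)"
        using \<gamma> by (simp add: power_divide)
      moreover have "(norm ((1 / sqrt (2 * \<gamma>)) *\<^sub>R (u + s)))\<^sup>2 / 2 = (norm (u + s))\<^sup>2 / (4 * \<gamma>)"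
        using \<gamma> by (simp add: power_divide)
      ultimately show ?thesis
        unfolding g_def gauss_density_def by (simp add: mult.left_commute[of k] mult.commute[of \<gamma> 2])
    qed
    define F :: "'d torus \<Rightarrow> ennreal" where "F = indicator A"
    have [measurable]: "F \<in> borel_measurable borel"
      unfolding F_def by measurable
    let ?D = "\<lambda>u. ennreal (gauss_density ((1 / sqrt \<gamma>) *\<^sub>R (u - w)))"
    \<comment> \<open>The unit cube has volume 1, so averaging a constant over \<open>s\<close>
      leaves it unchanged.\<close>
    have vol: "emeasure lborel (cbox (0 :: real ^ 'd) 1) = 1"
    proof -
      have "(1 :: real ^ 'd) \<bullet> i = 1" if "i \<in> Basis" for i
        using that by (auto simp: Basis_vec_def inner_axis)
      then show ?thesis
        by (subst emeasure_lborel_cbox) simp_all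
    qed
    have "(\<integral>\<^sup>+u. F (to_torus u) * ?D u \<partial>lborel)
        = (\<integral>\<^sup>+s. indicator (cbox 0 1) s * (\<integral>\<^sup>+u. F (to_torus u) * ?D u \<partial>lborel) \<partial>(lborel :: (real ^ 'd) measure))"
      by (subst nn_integral_multc) (simp_all add: vol)
    also have "\<dots> \<le> (\<integral>\<^sup>+s. indicator (cbox 0 1) s *
        (\<integral>\<^sup>+u. F (to_torus u) * ennreal (k * g (u + s)) \<partial>lborel) \<partial>(lborel :: (real ^ 'd) measure))"
      by (intro nn_integral_mono)
         (auto intro!: nn_integral_mono mult_left_mono ennreal_leI dens split: split_indicator)
    also have "\<dots> = (\<integral>\<^sup>+s. indicator (cbox 0 1) s *
        (\<integral>\<^sup>+v. F (to_torus (v - s)) * ennreal (k * g v) \<partial>lborel) \<partial>(lborel :: (real ^ 'd) measure))"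
    proof (rule nn_integral_cong)
      fix s :: "real ^ 'd"
      have "(\<integral>\<^sup>+v. F (to_torus (v - s)) * ennreal (k * g v) \<partial>lborel)
          = (\<integral>\<^sup>+u. F (to_torus u) * ennreal (k * g (u + s)) \<partial>lborel)"
        by (subst nn_integral_lborel_affine[of _ 1 s]) (simp_all add: add.commute)
      then show "indicator (cbox 0 1) s * (\<integral>\<^sup>+u. F (to_torus u) * ennreal (k * g (u + s)) \<partial>lborel)
          = indicator (cbox 0 1) s * (\<integral>\<^sup>+v. F (to_torus (v - s)) * ennreal (k * g v) \<partial>lborel)"
        by simp
    qed
    also have "\<dots> = (\<integral>\<^sup>+s. (\<integral>\<^sup>+v. indicator (cbox 0 1) s * (F (to_torus (v - s)) * ennreal (k * g v)) \<partial>lborel)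
        \<partial>(lborel :: (real ^ 'd) measure))"
      by (subst nn_integral_cmult) simp_all
    also have "\<dots> = (\<integral>\<^sup>+v. (\<integral>\<^sup>+s. indicator (cbox 0 1) s * (F (to_torus (v - s)) * ennreal (k * g v))
        \<partial>(lborel :: (real ^ 'd) measure)) \<partial>lborel)"
      by (rule lborel_pair.Fubini') measurable
    also have "\<dots> = (\<integral>\<^sup>+v. ennreal (k * g v) * (\<integral>\<^sup>+s. indicator (cbox 0 1) s * F (to_torus (v - s))
        \<partial>(lborel :: (real ^ 'd) measure)) \<partial>lborel)"
      by (subst nn_integral_cmult[symmetric]) (simp_all add: ac_simps)
    also have "\<dots> \<le> (\<integral>\<^sup>+v. ennreal (k * g v) * (\<integral>\<^sup>+z. F z \<partial>cube_measure) \<partial>(lborel :: (real ^ 'd) measure))"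
      by (intro nn_integral_mono mult_left_mono nn_integral_shifted_cube_le) simp_all
    also have "\<dots> = ennreal k * I * emeasure cube_measure A"
      unfolding I_def
      by (simp add: nn_integral_multc F_def k_def ennreal_mult g_nonneg nn_integral_cmult)
    finally have "(\<integral>\<^sup>+u. F (to_torus u) * ?D u \<partial>lborel) \<le> ennreal k * I * emeasure cube_measure A" .
    then have "emeasure (euler_kernel b \<gamma> x) A \<le> ennreal c * (ennreal k * I * emeasure cube_measure A)"
      unfolding v(2) emeasure_euler_kernel[OF A \<gamma>] c_def F_def w_def by (rule mult_left_mono) simp
    also have "I = ennreal (enn2real I)"
      using I by simp
    finally show ?thesis
      using c by (simp add: k_def ennreal_mult mult.assoc del: ennreal_enn2real)
  qed
  then show thesis
    using c by (intro that[of "c * (k * enn2real I)"]) (auto simp: k_def)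
qed

section \<open>Rejection sampling\<close>

text \<open>With \<open>g\<close> the survival probability and \<open>N\<close> the law after an
  Euler move, this is the unnormalised law of the survivors, \<open>\<eta>P\<close> in the
  overview.\<close>

definition weighted_mass :: "('s \<Rightarrow> real) \<Rightarrow> 's measure \<Rightarrow> 's set \<Rightarrow> real" where
  "weighted_mass g N A = (\<integral>z. indicator A z * g z \<partial>N)"

definition accept :: "('s \<Rightarrow> real) \<Rightarrow> 's set \<Rightarrow> ('s \<times> real) set" where
  "accept g A = {z. fst z \<in> A \<and> 1 - g (fst z) \<le> snd z}"

definition reject :: "('s \<Rightarrow> real) \<Rightarrow> ('s \<times> real) set" where
  "reject g = {z. snd z < 1 - g (fst z)}"

lemma weighted_mass_nonneg: "(\<And>z. 0 \<le> g z) \<Longrightarrow> 0 \<le> weighted_mass g N A"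
  unfolding weighted_mass_def by (rule Bochner_Integration.integral_nonneg) simp

locale rejection =
  fixes g :: "'s::topological_space \<Rightarrow> real"
  assumes g_measurable [measurable]: "g \<in> borel_measurable borel"
    and g_pos: "\<And>z. 0 < g z" and g_le_1: "\<And>z. g z \<le> 1"
begin

lemma weighted_integrable:
  assumes "N \<in> space (prob_algebra borel)" and [measurable]: "A \<in> sets borel"
  shows "integrable N (\<lambda>z. indicator A z * g z)"
proof -
  interpret N: prob_space N
    using assms(1) by (simp add: space_prob_algebra)
  have [measurable_cong]: "sets N = sets borel"
    using assms(1) by (simp add: space_prob_algebra)
  show ?thesis
    by (rule N.integrable_const_bound[where B = 1])
       (auto simp: g_le_1 less_imp_le[OF g_pos] abs_of_pos[OF g_pos] split: split_indicator)
qed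

lemma weighted_mass_UNIV_pos:
  assumes N: "N \<in> space (prob_algebra borel)"
  shows "0 < weighted_mass g N UNIV"
proof -
  interpret N: prob_space N
    using N by (simp add: space_prob_algebra)
  have "0 < (\<integral>z. g z \<partial>N)"
    using weighted_integrable[OF N, of UNIV] by (intro N.expectation_greater) (auto simp: g_pos)
  then show ?thesis
    by (simp add: weighted_mass_def)
qed

lemma weighted_mass_compl:
  assumes N: "N \<in> space (prob_algebra borel)" and A: "A \<in> sets borel"
  shows "weighted_mass g N A + weighted_mass g N (- A) = weighted_mass g N UNIV"
proof -
  have "weighted_mass g N A + weighted_mass g N (- A)
      = (\<integral>z. indicator A z * g z + indicator (- A) z * g z \<partial>N)"
    unfolding weighted_mass_def
    by (rule Bochner_Integration.integral_add[symmetric])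
       (use N A in \<open>auto intro!: weighted_integrable\<close>)
  also have "\<dots> = weighted_mass g N UNIV"
    unfolding weighted_mass_def by (intro Bochner_Integration.integral_cong) (auto split: split_indicator)
  finally show ?thesis .
qed

lemma prob_space_U: "prob_space (uniform_measure lborel {0..1::real})"
  by (rule prob_space_uniform_measure) auto

context
  fixes N :: "'s measure"
  assumes N: "N \<in> space (prob_algebra borel)"
begin

interpretation N: prob_space N
  using N by (simp add: space_prob_algebra)

lemma sets_N [measurable_cong]: "sets N = sets borel"
  using N by (simp add: space_prob_algebra)

abbreviation (input) "U \<equiv> uniform_measure lborel {0..1::real}"

interpretation U: prob_space U
  by (rule prob_space_U)

interpretation NU: pair_prob_space N U ..

lemma sets_accept [measurable]:
  assumes [measurable]: "A \<in> sets borel"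
  shows "accept g A \<in> sets (N \<Otimes>\<^sub>M U)"
proof -
  have "accept g A = {z \<in> space (N \<Otimes>\<^sub>M U). fst z \<in> A \<and> 1 - g (fst z) \<le> snd z}"
    using sets_eq_imp_space_eq[OF sets_N] by (auto simp: accept_def space_pair_measure)
  also have "\<dots> \<in> sets (N \<Otimes>\<^sub>M U)"
    by measurable
  finally show ?thesis .
qed

lemma reject_eq: "reject g = space (N \<Otimes>\<^sub>M U) - accept g UNIV"
  using sets_eq_imp_space_eq[OF sets_N] by (auto simp: reject_def accept_def space_pair_measure)

lemma sets_reject [measurable]: "reject g \<in> sets (N \<Otimes>\<^sub>M U)"
  unfolding reject_eq by measurable

lemma measure_accept:
  assumes [measurable]: "A \<in> sets borel"
  shows "measure (N \<Otimes>\<^sub>M U) (accept g A) = weighted_mass g N A"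
proof -
  have *: "emeasure U (Pair x -` accept g A) = ennreal (indicator A x * g x)" for x
  proof (cases "x \<in> A")
    case True
    then have "Pair x -` accept g A = {1 - g x..}"
      by (auto simp: accept_def)
    moreover have "{0..1} \<inter> {1 - g x..} = {1 - g x..1}"
      using g_le_1[of x] by auto
    ultimately show ?thesis
      using True g_pos[of x] divide_ennreal[of "g x" 1] by simp
  qed (simp add: accept_def)
  have "emeasure (N \<Otimes>\<^sub>M U) (accept g A) = (\<integral>\<^sup>+x. ennreal (indicator A x * g x) \<partial>N)"
    by (subst U.emeasure_pair_measure_alt[OF sets_accept[OF assms]]) (simp_all add: * del: emeasure_uniform_measure)
  also have "\<dots> = ennreal (weighted_mass g N A)"
    unfolding weighted_mass_def
    by (rule nn_integral_eq_integral) (auto intro!: weighted_integrable N mult_nonneg_nonneg less_imp_le[OF g_pos])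
  finally show ?thesis
    by (simp add: measure_def weighted_mass_nonneg less_imp_le[OF g_pos])
qed

lemma measure_reject: "measure (N \<Otimes>\<^sub>M U) (reject g) = 1 - weighted_mass g N UNIV"
proof -
  have UNIV: "(UNIV :: 's set) \<in> sets borel"
    by simp
  show ?thesis
    unfolding reject_eq NU.prob_compl[OF sets_accept[OF UNIV]] measure_accept[OF UNIV] ..
qed

end

lemma prob_space_trial: "N \<in> space (prob_algebra borel) \<Longrightarrow> prob_space (N \<Otimes>\<^sub>M uniform_measure lborel {0..1::real})"
proof -
  assume "N \<in> space (prob_algebra borel)"
  then interpret N: prob_space N
    by (simp add: space_prob_algebra)
  interpret U: prob_space "uniform_measure lborel {0..1::real}"
    by (rule prob_space_U)
  interpret NU: pair_prob_space N "uniform_measure lborel {0..1::real}" ..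
  show ?thesis
    by (rule NU.P.prob_space_axioms)
qed

section \<open>Independent trials up to the first acceptance, with a special law for trial 0\<close>

context
  fixes N :: "nat \<Rightarrow> 's measure"
  assumes N: "\<And>k. N k \<in> space (prob_algebra borel)"
    and N_Suc: "\<And>k. N (Suc k) = N 1"
begin

abbreviation (input) "trial k \<equiv> N k \<Otimes>\<^sub>M uniform_measure lborel {0..1::real}"

abbreviation (input) "sample \<equiv> \<lambda>\<omega>. fst (\<omega> (Inf {k. snd (\<omega> k) \<ge> 1 - g (fst (\<omega> k))})) :: 's"

interpretation T: product_prob_space trial UNIV
  by (rule product_prob_spaceI) (rule prob_space_trial[OF N])

lemma space_trial: "space (trial k) = UNIV"
  using sets_eq_imp_space_eq[OF sets_N[OF N[of k]]] by (simp add: space_pair_measure)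

lemma measurable_sample [measurable]: "sample \<in> borel_measurable (PiM UNIV trial)"
proof -
  have 1: "(\<lambda>\<omega>. fst (\<omega> k)) \<in> borel_measurable (PiM UNIV trial)" for k
    by (rule measurable_compose[OF measurable_component_singleton[OF UNIV_I]])
       (simp add: measurable_cong_sets[OF sets_pair_measure_cong[OF sets_N[OF N] refl] refl])
  have "snd \<in> trial k \<rightarrow>\<^sub>M borel" for k
    using measurable_snd[of "N k" "uniform_measure lborel {0..1::real}"]
    by (subst measurable_cong_sets[OF refl, of borel "uniform_measure lborel {0..1::real}"]) simp_all
  then have 2: "(\<lambda>\<omega>. snd (\<omega> k)) \<in> borel_measurable (PiM UNIV trial)" for k
    by (rule measurable_compose[OF measurable_component_singleton[OF UNIV_I]])
  have "(\<lambda>\<omega>. LEAST k. snd (\<omega> k) \<ge> 1 - g (fst (\<omega> k))) \<in> PiM UNIV trial \<rightarrow>\<^sub>M count_space UNIV"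
    by (intro measurable_Least, unfold pred_def,
        intro borel_measurable_le borel_measurable_diff borel_measurable_const
          measurable_compose[OF 1 g_measurable] 2)
  then show ?thesis
    unfolding Inf_nat_def mem_Collect_eq
    by (rule measurable_compose_countable[OF 1])
qed

text \<open>The first acceptance occurs at trial \<open>n\<close>, with a value in \<open>A\<close>.
  Written as a cylinder set so that its probability is a finite product.\<close>

definition first_accept :: "nat \<Rightarrow> 's set \<Rightarrow> (nat \<Rightarrow> 's \<times> real) set" where
  "first_accept n A = prod_emb UNIV trial {..n} (PiE {..n} (\<lambda>k. if k < n then reject g else accept g A))"

lemma first_accept_iff:
  "\<omega> \<in> first_accept n A \<longleftrightarrow> (\<forall>k<n. \<omega> k \<in> reject g) \<and> \<omega> n \<in> accept g A"
proof -
  have "\<omega> \<in> first_accept n A \<longleftrightarrow> (\<forall>k\<le>n. \<omega> k \<in> (if k < n then reject g else accept g A))"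
    unfolding first_accept_def prod_emb_iff space_trial PiE_iff by (simp add: Ball_def)
  then show ?thesis
    by (auto simp: le_less split: if_splits)
qed

lemma measure_first_accept:
  assumes A: "A \<in> sets borel"
  shows "measure (PiM UNIV trial) (first_accept n A) = (\<Prod>k\<le>n. measure (trial k) (if k < n then reject g else accept g A))"
  unfolding first_accept_def
proof (rule T.measure_PiM_emb)
  show "(if k < n then reject g else accept g A) \<in> sets (trial k)" for k
    using sets_reject[OF N[of k]] sets_accept[OF N[of k] A] by presburger
qed (rule subset_UNIV finite_atMost)+

lemma sets_first_accept:
  assumes A: "A \<in> sets borel"
  shows "first_accept n A \<in> sets (PiM UNIV trial)"
  unfolding first_accept_def
proof (rule sets_PiM_I)
  show "\<forall>k\<in>{..n}. (if k < n then reject g else accept g A) \<in> sets (trial k)"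
    using sets_reject[OF N] sets_accept[OF N A] by presburger
qed (rule finite_atMost, rule subset_UNIV)

lemma measure_first_accept_eq:
  assumes A: "A \<in> sets borel"
  shows "measure (PiM UNIV trial) (first_accept n A)
    = (\<Prod>k<n. 1 - weighted_mass g (N k) UNIV) * weighted_mass g (N n) A"
proof -
  have *: "(\<Prod>k\<le>n. h k (if k < n then x else y)) = (\<Prod>k<n. h k x) * h n y"
    for h :: "nat \<Rightarrow> ('s \<times> real) set \<Rightarrow> real" and x y
    by (simp add: lessThan_Suc_atMost[symmetric])
  show ?thesis
    unfolding measure_first_accept[OF A] *[of "\<lambda>k. measure (trial k)"] measure_reject[OF N] measure_accept[OF N A] ..
qed

lemma measure_first_accept_Suc:
  assumes A: "A \<in> sets borel"
  shows "measure (PiM UNIV trial) (first_accept (Suc n) A)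
    = (1 - weighted_mass g (N 0) UNIV) * (1 - weighted_mass g (N 1) UNIV) ^ n * weighted_mass g (N 1) A"
  unfolding measure_first_accept_eq[OF A] N_Suc prod.lessThan_Suc_shift prod_constant card_lessThan ..

lemma sample_eq:
  assumes "\<omega> \<in> first_accept n A"
  shows "sample \<omega> \<in> A"
proof -
  have "(LEAST k. snd (\<omega> k) \<ge> 1 - g (fst (\<omega> k))) = n"
    using assms unfolding first_accept_iff accept_def reject_def
    by (intro Least_equality) (auto simp: not_less[symmetric])
  then show ?thesis
    using assms unfolding first_accept_iff accept_def by (simp add: Inf_nat_def)
qed

lemma disjoint_first_accept: "disjoint_family (\<lambda>n. first_accept n A)"
  unfolding disjoint_family_on_def
proof (intro ballI impI equals0I)
  fix m n \<omega> assume "m \<noteq> n" "\<omega> \<in> first_accept m A \<inter> first_accept n A"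
  then have "\<omega> m \<in> accept g A" "\<omega> n \<in> accept g A" "m < n \<and> \<omega> m \<in> reject g \<or> n < m \<and> \<omega> n \<in> reject g"
    by (auto simp: first_accept_iff nat_neq_iff)
  then show False
    by (auto simp: accept_def reject_def)
qed

text \<open>Summing over the trial that accepts gives a geometric series whose ratio, the rejection
  probability of a resampling trial, is below 1. If no trial accepts, the sample has an arbitrary
  default value, so the sum is a priori only a lower bound. It is one for \<open>A\<close> and for
  its complement, and the two bounds add up to 1; hence both are equalities.\<close>

lemma measure_rejection_sample:
  assumes A: "A \<in> sets borel"
  shows "measure (distr (PiM UNIV trial) borel sample) A
    = weighted_mass g (N 0) A + (1 - weighted_mass g (N 0) UNIV) * (weighted_mass g (N 1) A / weighted_mass g (N 1) UNIV)"
    (is "_ = ?S A")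
proof -
  let ?V = "\<lambda>A. sample -` A \<inter> space (PiM UNIV trial)"
  have c1: "0 < weighted_mass g (N 1) UNIV" "weighted_mass g (N 1) UNIV \<le> 1"
    using weighted_mass_UNIV_pos[OF N[of 1]] measure_reject[OF N[of 1], symmetric] measure_nonneg[of "N 1 \<Otimes>\<^sub>M uniform_measure lborel {0..1::real}" "reject g"]
    by linarith+
  have le: "?S B \<le> measure (PiM UNIV trial) (?V B)" if B: "B \<in> sets borel" for B
  proof -
    let ?q = "1 - weighted_mass g (N 1) UNIV"
    have "(\<lambda>n. ?q ^ n) sums (1 / (1 - ?q))"
      using c1 by (intro geometric_sums) auto
    from sums_mult[OF this, of "(1 - weighted_mass g (N 0) UNIV) * weighted_mass g (N 1) B"]
    have "(\<lambda>n. measure (PiM UNIV trial) (first_accept (Suc n) B))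
        sums ((1 - weighted_mass g (N 0) UNIV) * (weighted_mass g (N 1) B / weighted_mass g (N 1) UNIV))"
      unfolding measure_first_accept_Suc[OF B] by (simp add: mult_ac)
    then have "(\<lambda>n. measure (PiM UNIV trial) (first_accept n B)) sums ?S B"
      using measure_first_accept_eq[OF B, of 0] by (subst (asm) sums_Suc_iff) (simp add: algebra_simps)
    moreover have "(\<lambda>n. measure (PiM UNIV trial) (first_accept n B))
        sums measure (PiM UNIV trial) (\<Union>n. first_accept n B)"
      using sets_first_accept[OF B] disjoint_first_accept by (intro T.finite_measure_UNION) auto
    ultimately have "?S B = measure (PiM UNIV trial) (\<Union>n. first_accept n B)"
      by (rule sums_unique2)
    also have "\<dots> \<le> measure (PiM UNIV trial) (?V B)"
      using sets_first_accept[OF B, THEN sets.sets_into_space] sample_eq B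
      by (intro T.finite_measure_mono measurable_sets[OF measurable_sample]) blast+
    finally show ?thesis .
  qed
  have "?S A + ?S (- A) = (weighted_mass g (N 0) A + weighted_mass g (N 0) (- A))
      + (1 - weighted_mass g (N 0) UNIV)
        * ((weighted_mass g (N 1) A + weighted_mass g (N 1) (- A)) / weighted_mass g (N 1) UNIV)"
    by (simp only: add_divide_distrib distrib_left add_ac)
  also have "\<dots> = 1"
    unfolding weighted_mass_compl[OF N[of 0] A] weighted_mass_compl[OF N[of 1] A] using c1 by simp
  finally have "?S A + ?S (- A) = 1" .
  moreover have "measure (PiM UNIV trial) (?V A) + measure (PiM UNIV trial) (?V (- A)) = 1"
  proof -
    have "?V (- A) = space (PiM UNIV trial) - ?V A"
      by auto
    then show ?thesis
      using T.prob_compl[OF measurable_sets[OF measurable_sample A]] by simp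
  qed
  moreover have "- A \<in> sets borel"
    using A by (simp add: borel_comp)
  ultimately have "measure (PiM UNIV trial) (?V A) = ?S A"
    using le[OF A] le[of "- A"] by linarith
  then show ?thesis
    using A by (simp add: measure_distr measurable_sample)
qed

lemma prob_space_rejection_sample: "prob_space (distr (PiM UNIV trial) borel sample)"
  by (rule T.prob_space_distr) (rule measurable_sample)

end

end

section \<open>The mean-field step\<close>

lemma prob_algebra_bind:
  assumes "N \<in> space (prob_algebra M)" "K \<in> M \<rightarrow>\<^sub>M prob_algebra R"
  shows "N \<bind> K \<in> space (prob_algebra R)"
proof -
  \<comment> \<open>A kernel on the one-point space encodes a single measure, so measurability of
    composed kernels yields membership.\<close>
  have "(\<lambda>_ :: unit. N \<bind> K) \<in> count_space UNIV \<rightarrow>\<^sub>M prob_algebra R"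
    using assms by (intro measurable_bind_prob_space) simp_all
  from measurable_space[OF this, of "()"] show ?thesis
    by simp
qed

context rejection
begin

lemma weighted_mass_le_1:
  assumes "N \<in> space (prob_algebra borel)" "A \<in> sets borel"
  shows "weighted_mass g N A \<le> 1"
  unfolding weighted_mass_def
  using assms weighted_integrable[OF assms]
  by (intro prob_space.integral_le_const)
     (auto simp: space_prob_algebra g_le_1 less_imp_le[OF g_pos] split: split_indicator)

lemma weighted_mass_bind:
  assumes N: "N \<in> space (prob_algebra borel)" and K: "K \<in> borel \<rightarrow>\<^sub>M prob_algebra borel"
    and [measurable]: "A \<in> sets borel"
  shows "weighted_mass g (N \<bind> K) A = (\<integral>x. weighted_mass g (K x) A \<partial>N)"
  unfolding weighted_mass_def
proof (rule integral_bind[where K = borel and B = 1 and B' = 1])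
  have N': "sets N = sets borel" "prob_space N"
    using N by (simp_all add: space_prob_algebra)
  show "K \<in> N \<rightarrow>\<^sub>M subprob_algebra borel"
    using measurable_prob_algebraD[OF K] by (simp cong: measurable_cong_sets add: N'(1))
  show "finite_measure N"
    using N'(2) by (rule prob_space.finite_measure)
  show "AE x in N. emeasure (K x) (space (K x)) \<le> ennreal 1"
    using measurable_space[OF K] by (simp add: space_prob_algebra prob_space.emeasure_space_1)
qed (auto simp: g_le_1 abs_of_pos[OF g_pos] split: split_indicator)

lemma weighted_mass_measurable:
  assumes K: "K \<in> borel \<rightarrow>\<^sub>M prob_algebra borel" and [measurable]: "A \<in> sets borel"
  shows "(\<lambda>x. weighted_mass g (K x) A) \<in> borel_measurable borel"
  unfolding weighted_mass_def
  by (rule measurable_compose[OF measurable_prob_algebraD[OF K] integral_measurable_subprob_algebra]) measurable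

end

locale killed_euler =
  fixes b :: "'d::finite torus \<Rightarrow> real ^ 'd" and lam :: "'d torus \<Rightarrow> real" and \<gamma> :: real
  assumes b_cont: "continuous_on UNIV b" and lam_cont: "continuous_on UNIV lam"
    and lam_nonneg: "\<And>z. 0 \<le> lam z" and \<gamma>_pos: "0 < \<gamma>"
begin

definition survival :: "'d torus \<Rightarrow> real" where
  "survival z = exp (- \<gamma> * lam z)"

abbreviation (input) "K \<equiv> euler_kernel b \<gamma>"
abbreviation (input) "surv \<equiv> weighted_mass survival"

lemma kernel_measurable [measurable]: "K \<in> borel \<rightarrow>\<^sub>M prob_algebra borel"
  using b_cont by (intro euler_kernel_measurable borel_measurable_continuous_onI)

lemma lam_measurable [measurable]: "lam \<in> borel_measurable borel"
  using lam_cont by (rule borel_measurable_continuous_onI)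

sublocale rejection survival
proof
  show "survival \<in> borel_measurable borel"
    unfolding survival_def by measurable
qed (use lam_nonneg \<gamma>_pos in \<open>auto simp: survival_def\<close>)

lemma kernel_prob: "K x \<in> space (prob_algebra borel)"
  using measurable_space[OF kernel_measurable, of x] by simp

lemma bind_kernel_prob: "\<mu> \<in> space (prob_algebra borel) \<Longrightarrow> \<mu> \<bind> K \<in> space (prob_algebra borel)"
  by (rule prob_algebra_bind) measurable

context
  fixes \<mu> :: "'d torus measure"
  assumes \<mu>: "\<mu> \<in> space (prob_algebra borel)"
begin

lemma Q_kernel_eq:
  "Q_kernel b lam \<gamma> \<mu> x = distr (PiM UNIV (\<lambda>k::nat. (if k = 0 then K x else \<mu> \<bind> K) \<Otimes>\<^sub>M uniform_measure lborel {0..1}))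
     borel (\<lambda>\<omega>. fst (\<omega> (Inf {k. snd (\<omega> k) \<ge> 1 - survival (fst (\<omega> k))})))"
  by (simp add: Q_kernel_def kill_prob_def survival_def)

lemma sets_Q_kernel: "sets (Q_kernel b lam \<gamma> \<mu> x) = sets borel"
  by (simp add: Q_kernel_def)

lemma Q_kernel_prob: "prob_space (Q_kernel b lam \<gamma> \<mu> x)"
  unfolding Q_kernel_eq
  by (rule prob_space_rejection_sample[where N = "\<lambda>k. if k = 0 then K x else \<mu> \<bind> K"])
     (auto simp: kernel_prob bind_kernel_prob \<mu>)

text \<open>Either the Euler move from \<open>x\<close> survives, or the particle is reborn
  according to the normalised surviving law of \<open>\<mu>\<close>.\<close>

lemma measure_Q_kernel:
  assumes A: "A \<in> sets borel"
  shows "measure (Q_kernel b lam \<gamma> \<mu> x) A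
    = surv (K x) A + (1 - surv (K x) UNIV) * (surv (\<mu> \<bind> K) A / surv (\<mu> \<bind> K) UNIV)"
proof -
  have "measure (Q_kernel b lam \<gamma> \<mu> x) A = weighted_mass survival (if (0 :: nat) = 0 then K x else \<mu> \<bind> K) A
      + (1 - weighted_mass survival (if (0 :: nat) = 0 then K x else \<mu> \<bind> K) UNIV)
        * (weighted_mass survival (if (1 :: nat) = 0 then K x else \<mu> \<bind> K) A
            / weighted_mass survival (if (1 :: nat) = 0 then K x else \<mu> \<bind> K) UNIV)"
    unfolding Q_kernel_eq
    by (rule measure_rejection_sample[where N = "\<lambda>k. if k = 0 then K x else \<mu> \<bind> K", OF _ _ A])
       (auto simp: kernel_prob bind_kernel_prob \<mu>)
  then show ?thesis
    by simp
qed

lemma Q_kernel_measurable [measurable]: "Q_kernel b lam \<gamma> \<mu> \<in> borel \<rightarrow>\<^sub>M prob_algebra borel"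
proof (intro measurable_prob_algebraI measurable_subprob_algebra)
  fix A :: "'d torus set" assume A: "A \<in> sets borel"
  note [measurable] = weighted_mass_measurable[OF kernel_measurable A]
    weighted_mass_measurable[OF kernel_measurable, of UNIV, simplified]
  have "emeasure (Q_kernel b lam \<gamma> \<mu> x) A = ennreal (surv (K x) A
      + (1 - surv (K x) UNIV) * (surv (\<mu> \<bind> K) A / surv (\<mu> \<bind> K) UNIV))" for x
    unfolding measure_Q_kernel[OF A, symmetric]
    by (rule finite_measure.emeasure_eq_measure) (intro prob_space.finite_measure Q_kernel_prob)
  then show "(\<lambda>x. emeasure (Q_kernel b lam \<gamma> \<mu> x) A) \<in> borel_measurable borel"
    by simp
qed (auto intro: Q_kernel_prob prob_space_imp_subprob_space simp: sets_Q_kernel)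

lemma mean_field_step_prob: "\<mu> \<bind> Q_kernel b lam \<gamma> \<mu> \<in> space (prob_algebra borel)"
  using \<mu> Q_kernel_measurable by (rule prob_algebra_bind)

lemma surv_kernel_integrable:
  assumes A: "A \<in> sets borel" and N: "N \<in> space (prob_algebra borel)"
  shows "integrable N (\<lambda>x. surv (K x) A)"
proof -
  have *: "sets N = sets borel" "prob_space N"
    using N by (simp_all add: space_prob_algebra)
  then interpret prob_space N
    by simp
  have "(\<lambda>x. surv (K x) A) \<in> borel_measurable N"
    using weighted_mass_measurable[OF kernel_measurable A] by (simp cong: measurable_cong_sets add: *(1))
  then show ?thesis
    using weighted_mass_le_1[OF kernel_prob A]
    by (intro integrable_const_bound[where B = 1])
       (auto simp: weighted_mass_nonneg less_imp_le[OF g_pos])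
qed

text \<open>Averaged over \<open>\<mu>\<close>, the killed mass is handed back in proportion to the
  surviving mass: with \<open>C\<close> the surviving law and \<open>s\<close> its total mass,
  \<open>C A + (1 - s) * (C A / s) = C A / s\<close>. Rebirth therefore coincides with conditioning
  on survival.\<close>

lemma measure_mean_field_step:
  assumes A: "A \<in> sets borel"
  shows "measure (\<mu> \<bind> Q_kernel b lam \<gamma> \<mu>) A = surv (\<mu> \<bind> K) A / surv (\<mu> \<bind> K) UNIV"
proof -
  have sets: "sets \<mu> = sets borel" and "prob_space \<mu>"
    using \<mu> by (simp_all add: space_prob_algebra)
  then interpret prob_space \<mu>
    by simp
  let ?C = "surv (\<mu> \<bind> K)"
  have "Q_kernel b lam \<gamma> \<mu> \<in> \<mu> \<rightarrow>\<^sub>M subprob_algebra borel"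
    using measurable_prob_algebraD[OF Q_kernel_measurable] by (simp cong: measurable_cong_sets add: sets)
  then have "measure (\<mu> \<bind> Q_kernel b lam \<gamma> \<mu>) A = (\<integral>x. measure (Q_kernel b lam \<gamma> \<mu> x) A \<partial>\<mu>)"
    using A by (rule measure_bind)
  also have "\<dots> = (\<integral>x. surv (K x) A + (1 - surv (K x) UNIV) * (?C A / ?C UNIV) \<partial>\<mu>)"
    unfolding measure_Q_kernel[OF A] ..
  also have "\<dots> = (\<integral>x. surv (K x) A \<partial>\<mu>) + (1 - (\<integral>x. surv (K x) UNIV \<partial>\<mu>)) * (?C A / ?C UNIV)"
    using surv_kernel_integrable[OF A \<mu>] surv_kernel_integrable[OF _ \<mu>, of UNIV]
    by (simp add: prob_space)
  also have "\<dots> = ?C A + (1 - ?C UNIV) * (?C A / ?C UNIV)"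
    using weighted_mass_bind[OF \<mu> kernel_measurable A] weighted_mass_bind[OF \<mu> kernel_measurable, of UNIV]
    by simp
  also have "\<dots> = ?C A / ?C UNIV"
    using weighted_mass_UNIV_pos[OF bind_kernel_prob[OF \<mu>]] by (simp add: field_simps)
  finally show ?thesis .
qed

end

lemma mean_field_law_prob:
  "\<eta> \<in> space (prob_algebra borel) \<Longrightarrow> mean_field_law b lam \<gamma> \<eta> n \<in> space (prob_algebra borel)"
  by (induction n) (simp_all add: mean_field_step_prob)

text \<open>On the compact torus \<open>lam\<close> is bounded, so \<open>survival\<close> lies
  between a positive constant and 1 and the two-sided bounds of the Euler kernel pass to the killed
  kernel.\<close>

lemma surv_kernel_bounds:
  obtains \<alpha> \<beta> where "0 < \<alpha>" "\<alpha> \<le> \<beta>"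
    "\<And>x A. A \<in> sets borel \<Longrightarrow> \<alpha> * measure cube_measure A \<le> surv (K x) A"
    "\<And>x A. A \<in> sets borel \<Longrightarrow> surv (K x) A \<le> \<beta> * measure cube_measure A"
proof -
  interpret m: finite_measure "cube_measure :: 'd torus measure"
    by (rule finite_cube_measure)
  obtain \<alpha> where \<alpha>: "0 < \<alpha>"
    "\<And>x A. A \<in> sets borel \<Longrightarrow> ennreal \<alpha> * emeasure cube_measure A \<le> emeasure (K x) A"
    using euler_kernel_lower_bound[OF bounded_range_torus[OF b_cont] \<gamma>_pos] by blast
  obtain \<beta> where \<beta>: "0 \<le> \<beta>"
    "\<And>x A. A \<in> sets borel \<Longrightarrow> emeasure (K x) A \<le> ennreal \<beta> * emeasure cube_measure A"
    using euler_kernel_upper_bound[OF bounded_range_torus[OF b_cont] \<gamma>_pos] by blast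
  have emK: "emeasure (K x) A = ennreal (measure (K x) A)" for x A
    using kernel_prob[of x]
    by (intro finite_measure.emeasure_eq_measure prob_space.finite_measure) (simp add: space_prob_algebra)
  obtain B where B: "\<And>z. lam z \<le> B"
    using bounded_range_torus[OF lam_cont] by (auto simp: bounded_iff) (metis abs_le_D1)
  define s where "s = exp (- \<gamma> * B)"
  have s: "0 < s" "\<And>z. s \<le> survival z"
    using B \<gamma>_pos by (auto simp: s_def survival_def)
  have low: "s * measure (K x) A \<le> surv (K x) A" and upp: "surv (K x) A \<le> measure (K x) A"
    if A[measurable]: "A \<in> sets borel" for x A
  proof -
    interpret prob_space "K x"
      using kernel_prob[of x] by (simp add: space_prob_algebra)
    have eq: "measure (K x) A = (\<integral>z. indicator A z \<partial>K x)"
      by simp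
    have int: "integrable (K x) (indicat_real A)"
      by (simp add: integrable_indicator_iff emeasure_eq_measure)
    show "s * measure (K x) A \<le> surv (K x) A"
      unfolding eq weighted_mass_def using s(2) int weighted_integrable[OF kernel_prob A]
      by (subst Bochner_Integration.integral_mult_right_zero[symmetric], intro integral_mono)
         (auto split: split_indicator)
    show "surv (K x) A \<le> measure (K x) A"
      unfolding eq weighted_mass_def using int weighted_integrable[OF kernel_prob A]
      by (intro integral_mono) (auto simp: g_le_1 split: split_indicator)
  qed
  have "\<alpha> * measure cube_measure A \<le> measure (K x) A" "measure (K x) A \<le> \<beta> * measure cube_measure A"
    if A: "A \<in> sets borel" for x A
    using \<alpha>(2)[OF A, of x] \<beta>(2)[OF A, of x] \<alpha>(1) \<beta>(1)
    by (simp_all add: emK m.emeasure_eq_measure ennreal_mult[symmetric])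
  note * = this
  show thesis
  \<comment> \<open>The maximum enforces \<open>\<alpha> \<le> \<beta>\<close> without comparing the
    two constants.\<close>
  proof (rule that[of "s * \<alpha>" "max (s * \<alpha>) \<beta>"])
    fix x :: "'d torus" and A :: "'d torus set" assume A: "A \<in> sets borel"
    show "s * \<alpha> * measure cube_measure A \<le> surv (K x) A"
      using mult_left_mono[OF *(1)[OF A, of x] less_imp_le[OF s(1)]] low[OF A, of x] by linarith
    have "surv (K x) A \<le> \<beta> * measure cube_measure A"
      using upp[OF A, of x] *(2)[OF A, of x] by linarith
    also have "\<dots> \<le> max (s * \<alpha>) \<beta> * measure cube_measure A"
      by (intro mult_right_mono) simp_all
    finally show "surv (K x) A \<le> max (s * \<alpha>) \<beta> * measure cube_measure A" .
  qed (use s(1) \<alpha>(1) in auto)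
qed

end

section \<open>Contraction towards a quasi-stationary distribution\<close>

text \<open>For \<open>\<delta> \<ge> 0\<close> this says that the Hilbert projective distance of
  \<open>\<nu>\<close> and \<open>\<eta>\<close> is at most \<open>ln (1 + \<delta>)\<close>. The
  factor \<open>l\<close> is left free because normalisation changes it at each step, while
  \<open>\<delta> = u / l - 1\<close> is unaffected.\<close>

definition comparable :: "'s measure \<Rightarrow> 's measure \<Rightarrow> real \<Rightarrow> bool" where
  "comparable \<nu> \<eta> \<delta> \<longleftrightarrow> (\<exists>l>0. \<forall>A\<in>sets \<nu>. l * measure \<nu> A \<le> measure \<eta> A \<and> measure \<eta> A \<le> l * (1 + \<delta>) * measure \<nu> A)"

text \<open>A setwise inequality between scaled measures is an inequality in the order of measures,
  which passes to integrals of nonnegative functions.\<close>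

lemma integral_mono_measure:
  fixes f :: "'s \<Rightarrow> real"
  assumes "prob_space \<mu>" "prob_space \<nu>" and sets: "sets \<mu> = sets \<nu>"
    and le: "\<And>A. A \<in> sets \<nu> \<Longrightarrow> r * measure \<mu> A \<le> s * measure \<nu> A"
    and rs: "0 \<le> r" "0 \<le> s"
    and f: "integrable \<mu> f" "integrable \<nu> f" "\<And>x. 0 \<le> f x"
  shows "r * (\<integral>x. f x \<partial>\<mu>) \<le> s * (\<integral>x. f x \<partial>\<nu>)"
proof -
  interpret \<mu>: prob_space \<mu> by fact
  interpret \<nu>: prob_space \<nu> by fact
  have "scale_measure (ennreal r) \<mu> \<le> scale_measure (ennreal s) \<nu>"
    using le rs sets
    by (subst le_measure) (auto simp: \<mu>.emeasure_eq_measure \<nu>.emeasure_eq_measure ennreal_mult[symmetric])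
  then have "(\<integral>\<^sup>+x. ennreal (f x) \<partial>scale_measure (ennreal r) \<mu>) \<le> (\<integral>\<^sup>+x. ennreal (f x) \<partial>scale_measure (ennreal s) \<nu>)"
    using sets by (intro nn_integral_mono_measure) simp_all
  then have "ennreal r * ennreal (\<integral>x. f x \<partial>\<mu>) \<le> ennreal s * ennreal (\<integral>x. f x \<partial>\<nu>)"
    using f by (simp add: nn_integral_scale_measure nn_integral_eq_integral)
  then show ?thesis
    using rs f(3) by (simp add: ennreal_mult[symmetric] Bochner_Integration.integral_nonneg)
qed

locale doeblin_fixed_point =
  fixes P :: "'s \<Rightarrow> 's set \<Rightarrow> real" and m \<nu> :: "'s measure" and \<alpha> \<beta> :: real
  assumes \<alpha>: "0 < \<alpha>" "\<alpha> \<le> \<beta>"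
    and P_lower: "\<And>x A. A \<in> sets \<nu> \<Longrightarrow> \<alpha> * measure m A \<le> P x A"
    and P_upper: "\<And>x A. A \<in> sets \<nu> \<Longrightarrow> P x A \<le> \<beta> * measure m A"
    and P_measurable: "\<And>A. A \<in> sets \<nu> \<Longrightarrow> (\<lambda>x. P x A) \<in> borel_measurable \<nu>"
    and prob_\<nu>: "prob_space \<nu>"
    and \<nu>_mass: "0 < (\<integral>x. P x (space \<nu>) \<partial>\<nu>)"
    and \<nu>_fixed: "\<And>A. A \<in> sets \<nu> \<Longrightarrow> measure \<nu> A = (\<integral>x. P x A \<partial>\<nu>) / (\<integral>x. P x (space \<nu>) \<partial>\<nu>)"
begin

text \<open>The eigenvalue in \<open>\<nu>P = \<theta> \<nu>\<close>, that is, the one-step survival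
  probability under \<open>\<nu>\<close>.\<close>

definition \<theta> :: real where "\<theta> = (\<integral>x. P x (space \<nu>) \<partial>\<nu>)"

definition \<epsilon> :: real where "\<epsilon> = \<alpha> / \<beta>"

lemma \<theta>_pos: "0 < \<theta>"
  using \<nu>_mass by (simp add: \<theta>_def)

lemma \<epsilon>: "0 < \<epsilon>" "\<epsilon> \<le> 1"
  using \<alpha> by (simp_all add: \<epsilon>_def)

lemma P_integrable:
  assumes \<eta>: "prob_space \<eta>" "sets \<eta> = sets \<nu>" and A: "A \<in> sets \<nu>"
  shows "integrable \<eta> (\<lambda>x. P x A)"
proof -
  interpret prob_space \<eta> by fact
  have "(\<lambda>x. P x A) \<in> borel_measurable \<eta>"
    using P_measurable[OF A] by (simp cong: measurable_cong_sets add: \<eta>(2))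
  moreover have "\<bar>P x A\<bar> \<le> \<beta> * measure m A" for x
  proof -
    have "0 \<le> \<alpha> * measure m A"
      using \<alpha> by simp
    then show ?thesis
      using P_lower[OF A, of x] P_upper[OF A, of x] by linarith
  qed
  ultimately show ?thesis
    by (intro integrable_const_bound[where B = "\<beta> * measure m A"]) auto
qed

lemma P_integral_bounds:
  assumes \<eta>: "prob_space \<eta>" "sets \<eta> = sets \<nu>" and A: "A \<in> sets \<nu>"
  shows "\<alpha> * measure m A \<le> (\<integral>x. P x A \<partial>\<eta>)" "(\<integral>x. P x A \<partial>\<eta>) \<le> \<beta> * measure m A"
  using P_integrable[OF assms] P_lower[OF A] P_upper[OF A] \<eta>(1)
  by (auto intro!: prob_space.integral_ge_const prob_space.integral_le_const)

lemma fixed_point: "A \<in> sets \<nu> \<Longrightarrow> (\<integral>x. P x A \<partial>\<nu>) = \<theta> * measure \<nu> A"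
  using \<nu>_fixed \<theta>_pos by (simp add: \<theta>_def)

text \<open>Since \<open>\<theta> \<nu> = \<nu>P \<le> \<beta> m\<close>, the common part
  \<open>\<alpha> m\<close> of all \<open>P x\<close> dominates
  \<open>\<epsilon> \<theta> \<nu>\<close>: a Doeblin minorisation by the fixed point
  itself.\<close>

lemma minorant:
  assumes "A \<in> sets \<nu>"
  shows "\<epsilon> * \<theta> * measure \<nu> A \<le> \<alpha> * measure m A"
proof -
  have "\<theta> * measure \<nu> A \<le> \<beta> * measure m A"
    using P_integral_bounds(2)[OF prob_\<nu> refl assms] fixed_point[OF assms] by simp
  from mult_left_mono[OF this, of \<epsilon>] \<epsilon>(1) show ?thesis
    using \<alpha> by (simp add: \<epsilon>_def mult.assoc)
qed

context
  fixes \<eta> \<eta>' :: "'s measure"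
  assumes \<eta>: "prob_space \<eta>" "sets \<eta> = sets \<nu>"
    and \<eta>': "prob_space \<eta>'" "sets \<eta>' = sets \<nu>"
    and step: "\<And>A. A \<in> sets \<nu> \<Longrightarrow> measure \<eta>' A = (\<integral>x. P x A \<partial>\<eta>) / (\<integral>x. P x (space \<nu>) \<partial>\<eta>)"
begin

lemma step_mass_pos: "0 < (\<integral>x. P x (space \<nu>) \<partial>\<eta>)"
proof -
  have "0 < \<epsilon> * \<theta> * measure \<nu> (space \<nu>)"
    using \<epsilon> \<theta>_pos prob_space.prob_space[OF prob_\<nu>] by simp
  also have "\<dots> \<le> (\<integral>x. P x (space \<nu>) \<partial>\<eta>)"
    using minorant[of "space \<nu>"] P_integral_bounds(1)[OF \<eta>, of "space \<nu>"] by simp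
  finally show ?thesis .
qed

text \<open>For any initial law,
  \<open>\<epsilon> \<theta> \<nu> \<le> \<alpha> m \<le> \<eta>P\<close>, and
  \<open>\<epsilon> \<eta>P \<le> \<alpha> m \<le> \<theta> \<nu>\<close>. The two constants
  \<open>\<epsilon>\<close> and \<open>1 / \<epsilon>\<close> have ratio
  \<open>(1 / \<epsilon>)^2\<close>.\<close>

lemma comparable_first_step: "comparable \<nu> \<eta>' ((1 / \<epsilon>)\<^sup>2 - 1)"
proof -
  let ?s = "\<integral>x. P x (space \<nu>) \<partial>\<eta>"
  have "\<epsilon> * \<theta> / ?s * measure \<nu> A \<le> measure \<eta>' A"
    "measure \<eta>' A \<le> \<epsilon> * \<theta> / ?s * (1 + ((1 / \<epsilon>)\<^sup>2 - 1)) * measure \<nu> A" if A: "A \<in> sets \<nu>" for A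
  proof -
    have "\<epsilon> * \<theta> * measure \<nu> A \<le> (\<integral>x. P x A \<partial>\<eta>)"
      using minorant[OF A] P_integral_bounds(1)[OF \<eta> A] by linarith
    then show "\<epsilon> * \<theta> / ?s * measure \<nu> A \<le> measure \<eta>' A"
      using step_mass_pos by (simp add: step[OF A] divide_right_mono)
    have "\<epsilon> * (\<integral>x. P x A \<partial>\<eta>) \<le> \<epsilon> * (\<beta> * measure m A)"
      using P_integral_bounds(2)[OF \<eta> A] \<epsilon> by (intro mult_left_mono) auto
    also have "\<dots> = \<alpha> * measure m A"
      using \<alpha> by (simp add: \<epsilon>_def)
    also have "\<dots> \<le> \<theta> * measure \<nu> A"
      using P_integral_bounds(1)[OF prob_\<nu> refl A] fixed_point[OF A] by simp
    finally have "(\<integral>x. P x A \<partial>\<eta>) \<le> \<theta> * measure \<nu> A / \<epsilon>"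
      using \<epsilon> by (simp add: field_simps)
    then have "(\<integral>x. P x A \<partial>\<eta>) / ?s \<le> \<theta> * measure \<nu> A / \<epsilon> / ?s"
      using step_mass_pos by (intro divide_right_mono) auto
    also have "\<dots> = \<epsilon> * \<theta> / ?s * (1 + ((1 / \<epsilon>)\<^sup>2 - 1)) * measure \<nu> A"
      using \<epsilon> by (simp add: field_simps power2_eq_square)
    finally show "measure \<eta>' A \<le> \<epsilon> * \<theta> / ?s * (1 + ((1 / \<epsilon>)\<^sup>2 - 1)) * measure \<nu> A"
      by (simp add: step[OF A])
  qed
  moreover have "0 < \<epsilon> * \<theta> / ?s"
    using \<epsilon> \<theta>_pos step_mass_pos by simp
  ultimately show ?thesis
    unfolding comparable_def by blast
qed

text \<open>The part \<open>\<alpha> m\<close> of \<open>P x\<close> does not depend on \<open>x\<close>, so its contribution only depends on the total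
  masses of \<open>\<eta>\<close> and of the two multiples of \<open>\<nu>\<close> enclosing it; it pulls these multiples together.\<close>

lemma comparable_step:
  assumes "comparable \<nu> \<eta> \<delta>" and \<delta>: "0 \<le> \<delta>"
  shows "comparable \<nu> \<eta>' ((1 - \<epsilon>) * \<delta>)"
proof -
  interpret \<nu>: prob_space \<nu> by (rule prob_\<nu>)
  interpret \<eta>: prob_space \<eta> by (rule \<eta>(1))
  obtain l where l: "0 < l"
    and le: "\<And>A. A \<in> sets \<nu> \<Longrightarrow> l * measure \<nu> A \<le> measure \<eta> A"
      "\<And>A. A \<in> sets \<nu> \<Longrightarrow> measure \<eta> A \<le> l * (1 + \<delta>) * measure \<nu> A"
    using assms(1) unfolding comparable_def by blast
  define u where "u = l * (1 + \<delta>)"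
  have \<eta>1: "measure \<eta> (space \<nu>) = 1"
    using \<eta>.prob_space sets_eq_imp_space_eq[OF \<eta>(2)] by simp
  have l1: "l \<le> 1" and u1: "1 \<le> u"
    using le[of "space \<nu>"] \<nu>.prob_space by (simp_all add: \<eta>1 u_def)
  \<comment> \<open>From \<open>l \<nu> \<le> \<eta>\<close> one gets
    \<open>\<eta>P \<ge> l \<nu>P + (1 - l) \<alpha> m\<close>, because
    \<open>\<eta> - l \<nu>\<close> has mass \<open>1 - l\<close>; the minorant then turns
    \<open>\<alpha> m\<close> into \<open>\<epsilon> \<theta> \<nu>\<close>. Symmetrically,
    \<open>u \<nu> - \<eta>\<close> has mass \<open>u - 1\<close>.\<close>
  define l' where "l' = l + \<epsilon> * (1 - l)"
  define u' where "u' = u - \<epsilon> * (u - 1)"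
  let ?s = "\<integral>x. P x (space \<nu>) \<partial>\<eta>"
  have l': "l \<le> l'" "0 < l'"
    using l l1 \<epsilon> by (simp_all add: l'_def add_pos_nonneg)
  \<comment> \<open>The gap shrinks by \<open>1 - \<epsilon>\<close>; as the lower constant does not
    decrease, so does the gap relative to it.\<close>
  have "u' - l' = (1 - \<epsilon>) * (u - l)"
    by (simp add: u'_def l'_def algebra_simps)
  also have "\<dots> = (1 - \<epsilon>) * \<delta> * l"
    by (simp add: u_def algebra_simps)
  also have "\<dots> \<le> (1 - \<epsilon>) * \<delta> * l'"
    using l' \<epsilon> \<delta> by (intro mult_left_mono) auto
  finally have u': "u' \<le> l' * (1 + (1 - \<epsilon>) * \<delta>)"
    by (simp add: algebra_simps)
  have "l' * \<theta> / ?s * measure \<nu> A \<le> measure \<eta>' A"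
    "measure \<eta>' A \<le> l' * \<theta> / ?s * (1 + (1 - \<epsilon>) * \<delta>) * measure \<nu> A" if A: "A \<in> sets \<nu>" for A
  proof -
    \<comment> \<open>The part of \<open>P x\<close> that depends on \<open>x\<close>. It is
      nonnegative, so the bounds on \<open>\<eta>\<close> may be integrated against it.\<close>
    let ?f = "\<lambda>x. P x A - \<alpha> * measure m A"
    have int: "integrable \<eta> ?f" "integrable \<nu> ?f"
      using P_integrable[OF \<eta> A] P_integrable[OF prob_\<nu> refl A] by simp_all
    have f: "0 \<le> ?f x" for x
      using P_lower[OF A] by simp
    have f\<eta>: "(\<integral>x. ?f x \<partial>\<eta>) = (\<integral>x. P x A \<partial>\<eta>) - \<alpha> * measure m A"
      using P_integrable[OF \<eta> A] by (simp add: \<eta>.prob_space)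
    have f\<nu>: "(\<integral>x. ?f x \<partial>\<nu>) = \<theta> * measure \<nu> A - \<alpha> * measure m A"
      using P_integrable[OF prob_\<nu> refl A] by (simp add: \<nu>.prob_space fixed_point[OF A])
    have "l * (\<integral>x. ?f x \<partial>\<nu>) \<le> 1 * (\<integral>x. ?f x \<partial>\<eta>)"
      using le(1) l f int \<eta> prob_\<nu> by (intro integral_mono_measure) auto
    then have "l * \<theta> * measure \<nu> A + (1 - l) * (\<alpha> * measure m A) \<le> (\<integral>x. P x A \<partial>\<eta>)"
      unfolding f\<eta> f\<nu> by (simp add: algebra_simps)
    moreover have "(1 - l) * (\<epsilon> * \<theta> * measure \<nu> A) \<le> (1 - l) * (\<alpha> * measure m A)"
      using minorant[OF A] l1 by (intro mult_left_mono) auto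
    ultimately have lower: "l' * \<theta> * measure \<nu> A \<le> (\<integral>x. P x A \<partial>\<eta>)"
      by (simp add: l'_def algebra_simps)
    then show "l' * \<theta> / ?s * measure \<nu> A \<le> measure \<eta>' A"
      using step_mass_pos by (simp add: step[OF A] divide_right_mono)
    have "1 * (\<integral>x. ?f x \<partial>\<eta>) \<le> u * (\<integral>x. ?f x \<partial>\<nu>)"
      using le(2) u1 f int \<eta> prob_\<nu> by (intro integral_mono_measure) (auto simp: u_def)
    then have "(\<integral>x. P x A \<partial>\<eta>) \<le> u * \<theta> * measure \<nu> A - (u - 1) * (\<alpha> * measure m A)"
      unfolding f\<eta> f\<nu> by (simp add: algebra_simps)
    moreover have "(u - 1) * (\<epsilon> * \<theta> * measure \<nu> A) \<le> (u - 1) * (\<alpha> * measure m A)"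
      using minorant[OF A] u1 by (intro mult_left_mono) auto
    ultimately have "(\<integral>x. P x A \<partial>\<eta>) \<le> u' * (\<theta> * measure \<nu> A)"
      by (simp add: u'_def algebra_simps)
    also have "\<dots> \<le> l' * (1 + (1 - \<epsilon>) * \<delta>) * (\<theta> * measure \<nu> A)"
      using u' \<theta>_pos by (intro mult_right_mono) auto
    finally have "(\<integral>x. P x A \<partial>\<eta>) / ?s \<le> l' * (1 + (1 - \<epsilon>) * \<delta>) * (\<theta> * measure \<nu> A) / ?s"
      using step_mass_pos by (intro divide_right_mono) auto
    then show "measure \<eta>' A \<le> l' * \<theta> / ?s * (1 + (1 - \<epsilon>) * \<delta>) * measure \<nu> A"
      by (simp add: step[OF A] mult_ac)
  qed
  moreover have "0 < l' * \<theta> / ?s"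
    using l' \<theta>_pos step_mass_pos by simp
  ultimately show ?thesis
    unfolding comparable_def by blast
qed

end

text \<open>The first step creates comparability from an arbitrary law and each later one contracts
  it, hence the exponent \<open>n\<close> at time \<open>Suc n\<close>.\<close>

lemma comparable_iterate:
  assumes \<eta>: "\<And>n. prob_space (\<eta> n)" "\<And>n. sets (\<eta> n) = sets \<nu>"
    and step: "\<And>n A. A \<in> sets \<nu> \<Longrightarrow>
      measure (\<eta> (Suc n)) A = (\<integral>x. P x A \<partial>\<eta> n) / (\<integral>x. P x (space \<nu>) \<partial>\<eta> n)"
  shows "comparable \<nu> (\<eta> (Suc n)) ((1 - \<epsilon>) ^ n * ((1 / \<epsilon>)\<^sup>2 - 1))"
proof (induction n)
  case 0
  then show ?case
    using comparable_first_step[OF \<eta>[of 0] \<eta>[of "Suc 0"] step[of _ 0]] by simp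
next
  case (Suc n)
  have "1 \<le> (1 / \<epsilon>)\<^sup>2"
    using \<epsilon> by (intro one_le_power) simp
  then have "0 \<le> (1 - \<epsilon>) ^ n * ((1 / \<epsilon>)\<^sup>2 - 1)"
    using \<epsilon> by simp
  from comparable_step[OF \<eta>[of "Suc n"] \<eta>[of "Suc (Suc n)"] step[of _ "Suc n"] Suc.IH this] show ?case
    by (simp add: mult.assoc)
qed

end

text \<open>Equality of the total masses forces \<open>l \<le> 1\<close>, which removes the unknown
  factor from the upper bound.\<close>

lemma comparable_imp_le:
  assumes "comparable \<nu> \<eta> \<delta>" "prob_space \<nu>" "prob_space \<eta>" "sets \<eta> = sets \<nu>" "0 \<le> \<delta>" "A \<in> sets \<nu>"
  shows "measure \<eta> A \<le> (1 + \<delta>) * measure \<nu> A"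
proof -
  obtain l where l: "0 < l" "\<forall>A\<in>sets \<nu>. l * measure \<nu> A \<le> measure \<eta> A \<and> measure \<eta> A \<le> l * (1 + \<delta>) * measure \<nu> A"
    using assms(1) unfolding comparable_def by blast
  then have "l * measure \<nu> (space \<nu>) \<le> measure \<eta> (space \<nu>)"
    by blast
  then have "l \<le> 1"
    using prob_space.prob_space[OF assms(2)] prob_space.prob_space[OF assms(3)] sets_eq_imp_space_eq[OF assms(4)]
    by simp
  then have "l * ((1 + \<delta>) * measure \<nu> A) \<le> 1 * ((1 + \<delta>) * measure \<nu> A)"
    using assms(5) by (intro mult_right_mono) auto
  then show ?thesis
    using l(2) assms(6) by (fastforce simp: mult.assoc)
qed

section \<open>The killed Euler chain\<close>

definition exp_measure :: "real measure" where
  "exp_measure = density lborel (exponential_density 1)"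

lemma prob_space_exp_measure: "prob_space exp_measure"
  unfolding exp_measure_def by (rule prob_space_exponential_density) simp

lemma sets_exp_measure [simp, measurable_cong]: "sets exp_measure = sets borel"
  by (simp add: exp_measure_def)

lemma space_exp_measure [simp]: "space exp_measure = UNIV"
  by (simp add: exp_measure_def)

lemma measure_exp_measure_gt:
  assumes "0 \<le> a"
  shows "measure exp_measure {a<..} = exp (- a)"
proof -
  interpret prob_space exp_measure
    by (rule prob_space_exp_measure)
  have "distributed exp_measure lborel (\<lambda>x. x) (exponential_density 1)"
    by (simp add: distributed_def exp_measure_def distr_id2)
  from exponential_distributedD_gt[OF this assms] show ?thesis
    by (simp add: greaterThan_def)
qed

text \<open>The projective limit of Ionescu-Tulcea; the Markov property in the integrated form of
  \<open>markov_chain\<close> is checked on finite-dimensional marginals.\<close>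

lemma exists_markov_chain:
  fixes \<mu> :: "'s::topological_space measure"
  assumes \<mu>: "\<mu> \<in> space (prob_algebra borel)" and K: "K \<in> borel \<rightarrow>\<^sub>M prob_algebra borel"
  obtains M :: "(nat \<Rightarrow> 's) measure" where
    "sets M = sets (PiM UNIV (\<lambda>_. borel))" "markov_chain K M (\<lambda>n \<omega>. \<omega> n)" "distr M borel (\<lambda>\<omega>. \<omega> 0) = \<mu>"
proof -
  \<comment> \<open>Coordinate 0 is drawn from \<open>\<mu>\<close>; coordinate \<open>n\<close>
    depends on the past only through coordinate \<open>n - 1\<close>.\<close>
  define P where "P n \<omega> = (if n = 0 then \<mu> else K (\<omega> (n - 1)))" for n :: nat and \<omega> :: "nat \<Rightarrow> 's"
  have P: "P n \<in> PiM {0..<n} (\<lambda>_. borel) \<rightarrow>\<^sub>M prob_algebra borel" for n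
  proof (cases n)
    case 0
    then have "P n = (\<lambda>_. \<mu>)"
      by (simp add: P_def fun_eq_iff)
    then show ?thesis
      using \<mu> by simp
  next
    case (Suc k)
    have "(\<lambda>\<omega>. K (\<omega> k)) \<in> PiM {0..<Suc k} (\<lambda>_. borel) \<rightarrow>\<^sub>M prob_algebra borel"
      by (rule measurable_compose[OF _ K]) (simp add: measurable_component_singleton)
    moreover have "P n = (\<lambda>\<omega>. K (\<omega> k))"
      using Suc by (simp add: P_def fun_eq_iff)
    ultimately show ?thesis
      using Suc by simp
  qed
  interpret IT: Ionescu_Tulcea P "\<lambda>_. borel"
  proof (rule Ionescu_Tulcea.intro)
    show "P i \<in> PiM {0..<i} (\<lambda>_. borel) \<rightarrow>\<^sub>M subprob_algebra borel" for i
      by (rule measurable_prob_algebraD[OF P])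
    show "prob_space (P i x)" if "x \<in> space (PiM {0..<i} (\<lambda>_. borel))" for i x
      using measurable_space[OF P that] by (simp add: space_prob_algebra)
  qed
  define M where "M = IT.PF.lim"
  \<comment> \<open>The law of the first \<open>n\<close> coordinates, started from the empty
    history.\<close>
  define C where "C n = IT.C 0 n (\<lambda>_. undefined)" for n
  have sets_M: "sets M = sets (PiM UNIV (\<lambda>_. borel))"
    by (simp add: M_def)
  have empty: "(\<lambda>_. undefined) \<in> space (PiM {0..<0::nat} (\<lambda>_. borel :: 's measure))"
    by (simp add: space_PiM)
  have sets_C: "sets (C n) = sets (PiM {0..<n} (\<lambda>_. borel))" for n
    using IT.sets_C[OF empty, of n] by (simp add: C_def)
  have space_C: "space (C n) = space (PiM {0..<n} (\<lambda>_. borel))" for n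
    using sets_C by (rule sets_eq_imp_space_eq)
  have prob_C: "prob_space (C n)" for n
    using IT.prob_space_C[OF empty, of n] by (simp add: C_def)
  have distr_C: "distr M (PiM {0..<n} (\<lambda>_. borel)) (\<lambda>\<omega>. restrict \<omega> {0..<n}) = C n" for n
  proof (rule measure_eqI)
    fix A assume "A \<in> sets (distr M (PiM {0..<n} (\<lambda>_. borel)) (\<lambda>\<omega>. restrict \<omega> {0..<n}))"
    then have A: "A \<in> sets (PiM {0..<n} (\<lambda>_. borel :: 's measure))"
      by simp
    have "emeasure (distr M (PiM {0..<n} (\<lambda>_. borel)) (\<lambda>\<omega>. restrict \<omega> {0..<n})) A = emeasure (IT.CI {0..<n}) A"
      unfolding M_def by (subst IT.distr_lim) simp_all
    also have "\<dots> = emeasure (C n) A"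
      using IT.emeasure_CI[OF order_refl A] sets.sets_into_space[OF A]
      by (simp add: C_def prod_emb_id space_PiM)
    finally show "emeasure (distr M (PiM {0..<n} (\<lambda>_. borel)) (\<lambda>\<omega>. restrict \<omega> {0..<n})) A = emeasure (C n) A" .
  qed (simp add: sets_C)
  have restr: "(\<lambda>\<omega>. restrict \<omega> {0..<n}) \<in> M \<rightarrow>\<^sub>M PiM {0..<n} (\<lambda>_. borel)" for n
    using measurable_restrict_subset[of "{0..<n}" UNIV "\<lambda>_. borel :: 's measure"]
    by (simp cong: measurable_cong_sets add: sets_M)
  have prob_M: "prob_space M"
    using restr[of 0] prob_C[of 0] distr_C[of 0] by (metis prob_space_distrD)
  have meas: "(\<lambda>\<omega>. \<omega> n) \<in> borel_measurable M" for n
    using measurable_component_singleton[of n UNIV "\<lambda>_. borel :: 's measure"]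
    by (simp cong: measurable_cong_sets add: sets_M)
  \<comment> \<open>Integrates out the last coordinate; this single rule yields both the Markov
    property and the initial law.\<close>
  have C_Suc: "(\<integral>\<^sup>+\<omega>. f \<omega> \<partial>C (Suc n)) = (\<integral>\<^sup>+\<omega>. (\<integral>\<^sup>+x. f (fun_upd \<omega> n x) \<partial>P n \<omega>) \<partial>C n)"
    if f: "f \<in> borel_measurable (PiM {0..<Suc n} (\<lambda>_. borel))" for f n
  proof -
    have eP: "IT.eP n \<in> C n \<rightarrow>\<^sub>M subprob_algebra (PiM {0..<Suc n} (\<lambda>_. borel))"
      using IT.measurable_eP[of n] by (simp cong: measurable_cong_sets add: sets_C)
    have "C (Suc n) = C n \<bind> IT.eP n"
      by (simp add: C_def)
    then have "(\<integral>\<^sup>+\<omega>. f \<omega> \<partial>C (Suc n)) = (\<integral>\<^sup>+\<omega>. (\<integral>\<^sup>+x. f x \<partial>IT.eP n \<omega>) \<partial>C n)"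
      using nn_integral_bind[OF f eP] by simp
    also have "\<dots> = (\<integral>\<^sup>+\<omega>. (\<integral>\<^sup>+x. f (fun_upd \<omega> n x) \<partial>P n \<omega>) \<partial>C n)"
      by (intro nn_integral_cong IT.nn_integral_eP f) (simp add: space_C)
    finally show ?thesis .
  qed
  have markov: "emeasure M {\<omega> \<in> space M. (\<lambda>i\<in>{..n}. \<omega> i) \<in> D \<and> \<omega> (Suc n) \<in> A}
      = (\<integral>\<^sup>+\<omega>. indicator {\<omega> \<in> space M. (\<lambda>i\<in>{..n}. \<omega> i) \<in> D} \<omega> * emeasure (K (\<omega> n)) A \<partial>M)"
    if D: "D \<in> sets (PiM {..n} (\<lambda>_. borel))" and A[measurable]: "A \<in> sets borel" for n D A
  proof -
    have eq: "{..n} = {0..<Suc n}"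
      by auto
    have D'[measurable]: "D \<in> sets (PiM {0..<Suc n} (\<lambda>_. borel))"
      using D by (simp add: eq)
    \<comment> \<open>The event involves the coordinates 0 to \<open>n + 1\<close>, so it is
      evaluated under \<open>C (Suc (Suc n))\<close>, whose last coordinate is then integrated
      out.\<close>
    define F where "F \<omega> = indicator D (restrict \<omega> {0..<Suc n}) * (indicator A (\<omega> (Suc n)) :: ennreal)" for \<omega> :: "nat \<Rightarrow> 's"
    have [measurable]: "(\<lambda>\<omega>. restrict \<omega> {0..<Suc n}) \<in> PiM {0..<Suc (Suc n)} (\<lambda>_. borel :: 's measure) \<rightarrow>\<^sub>M PiM {0..<Suc n} (\<lambda>_. borel)"
      by (rule measurable_restrict_subset) auto
    have [measurable]: "(\<lambda>\<omega>. \<omega> k) \<in> PiM {0..<m} (\<lambda>_. borel :: 's measure) \<rightarrow>\<^sub>M borel" if "k < m" for k m :: nat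
      using that by (intro measurable_component_singleton) simp
    have F: "F \<in> borel_measurable (PiM {0..<Suc (Suc n)} (\<lambda>_. borel))"
      unfolding F_def by measurable
    have eKA: "(\<lambda>\<omega>. indicator D \<omega> * emeasure (K (\<omega> n)) A) \<in> borel_measurable (PiM {0..<Suc n} (\<lambda>_. borel :: 's measure))"
      using measurable_prob_algebraD[OF K] by measurable
    have "emeasure M {\<omega> \<in> space M. (\<lambda>i\<in>{..n}. \<omega> i) \<in> D \<and> \<omega> (Suc n) \<in> A}
        = (\<integral>\<^sup>+\<omega>. indicator {\<omega> \<in> space M. (\<lambda>i\<in>{..n}. \<omega> i) \<in> D \<and> \<omega> (Suc n) \<in> A} \<omega> \<partial>M)"
    proof (rule nn_integral_indicator[symmetric])
      have "(\<lambda>\<omega>. restrict \<omega> {..n}) \<in> M \<rightarrow>\<^sub>M PiM {..n} (\<lambda>_. borel)"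
        using restr[of "Suc n"] by (simp add: eq)
      then show "{\<omega> \<in> space M. (\<lambda>i\<in>{..n}. \<omega> i) \<in> D \<and> \<omega> (Suc n) \<in> A} \<in> sets M"
        using meas D by measurable
    qed
    also have "\<dots> = (\<integral>\<^sup>+\<omega>. F (restrict \<omega> {0..<Suc (Suc n)}) \<partial>M)"
      by (intro nn_integral_cong) (auto simp: F_def eq Int_absorb1 split: split_indicator)
    also have "\<dots> = (\<integral>\<^sup>+\<omega>. F \<omega> \<partial>C (Suc (Suc n)))"
      unfolding distr_C[symmetric] by (subst nn_integral_distr[OF restr]) (simp_all add: F)
    also have "\<dots> = (\<integral>\<^sup>+\<omega>. (\<integral>\<^sup>+x. F (fun_upd \<omega> (Suc n) x) \<partial>K (\<omega> n)) \<partial>C (Suc n))"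
      using C_Suc[OF F] by (simp add: P_def)
    also have "\<dots> = (\<integral>\<^sup>+\<omega>. indicator D \<omega> * emeasure (K (\<omega> n)) A \<partial>C (Suc n))"
    proof (rule nn_integral_cong)
      fix \<omega> assume "\<omega> \<in> space (C (Suc n))"
      then have "restrict (fun_upd \<omega> (Suc n) x) {0..<Suc n} = \<omega>" for x
        unfolding space_C by (auto simp: space_PiM PiE_iff extensional_def)
      moreover have "sets (K (\<omega> n)) = sets borel"
        using measurable_space[OF K, of "\<omega> n"] by (simp add: space_prob_algebra)
      ultimately show "(\<integral>\<^sup>+x. F (fun_upd \<omega> (Suc n) x) \<partial>K (\<omega> n)) = indicator D \<omega> * emeasure (K (\<omega> n)) A"
        using A by (simp add: F_def nn_integral_cmult_indicator)
    qed
    also have "\<dots> = (\<integral>\<^sup>+\<omega>. indicator D (restrict \<omega> {0..<Suc n}) * emeasure (K (restrict \<omega> {0..<Suc n} n)) A \<partial>M)"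
      unfolding distr_C[symmetric] by (subst nn_integral_distr[OF restr]) (simp_all add: eKA)
    also have "\<dots> = (\<integral>\<^sup>+\<omega>. indicator {\<omega> \<in> space M. (\<lambda>i\<in>{..n}. \<omega> i) \<in> D} \<omega> * emeasure (K (\<omega> n)) A \<partial>M)"
      by (intro nn_integral_cong) (auto simp: eq split: split_indicator)
    finally show ?thesis .
  qed
  have "markov_chain K M (\<lambda>n \<omega>. \<omega> n)"
    unfolding markov_chain_def
  proof (intro conjI allI ballI prob_M meas)
    fix n :: nat and D A assume D: "D \<in> sets (PiM {..n} (\<lambda>_. borel :: 's measure))" and A: "A \<in> sets (borel :: 's measure)"
    let ?S = "{\<omega> \<in> space M. (\<lambda>i\<in>{..n}. \<omega> i) \<in> D}"
    have KA: "prob_space (K x)" for x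
      using measurable_space[OF K, of x] by (simp add: space_prob_algebra)
    have "(\<lambda>\<omega>. restrict \<omega> {..n}) \<in> M \<rightarrow>\<^sub>M PiM {..n} (\<lambda>_. borel)"
      using restr[of "Suc n"] by (simp add: atLeast0LessThan lessThan_Suc_atMost)
    then have S[measurable]: "?S \<in> sets M"
      using D by measurable
    have KA_meas[measurable]: "(\<lambda>\<omega>. measure (K (\<omega> n)) A) \<in> borel_measurable M"
      using measurable_compose[OF meas measurable_compose[OF K measurable_measure_prob_algebra[OF A]]] by simp
    have int: "integrable M (\<lambda>\<omega>. indicator ?S \<omega> * measure (K (\<omega> n)) A)"
      using prob_M KA by (intro finite_measure.integrable_const_bound[where B = 1])
        (auto simp: prob_space.finite_measure prob_space.prob_le_1 split: split_indicator)
    have "emeasure M {\<omega> \<in> space M. (\<lambda>i\<in>{..n}. \<omega> i) \<in> D \<and> \<omega> (Suc n) \<in> A}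
        = (\<integral>\<^sup>+\<omega>. ennreal (indicator ?S \<omega> * measure (K (\<omega> n)) A) \<partial>M)"
      unfolding markov[OF D A]
      by (intro nn_integral_cong)
         (simp add: finite_measure.emeasure_eq_measure[OF prob_space.finite_measure[OF KA]] split: split_indicator)
    also have "\<dots> = ennreal (\<integral>\<omega>. indicator ?S \<omega> * measure (K (\<omega> n)) A \<partial>M)"
      using int by (rule nn_integral_eq_integral) simp
    finally show "measure M {\<omega> \<in> space M. (\<lambda>i\<in>{..n}. \<omega> i) \<in> D \<and> \<omega> (Suc n) \<in> A}
        = (LINT \<omega>:?S|M. measure (K (\<omega> n)) A)"
      by (simp add: measure_def set_lebesgue_integral_def Bochner_Integration.integral_nonneg)
  qed
  moreover have "distr M borel (\<lambda>\<omega>. \<omega> 0) = \<mu>"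
  proof (rule measure_eqI)
    show sets: "sets (distr M borel (\<lambda>\<omega>. \<omega> 0)) = sets \<mu>"
      using \<mu> by (simp add: space_prob_algebra)
    fix A assume "A \<in> sets (distr M borel (\<lambda>\<omega>. \<omega> 0))"
    then have A[measurable]: "A \<in> sets borel"
      by simp
    have f: "(\<lambda>\<omega>. indicator A (\<omega> 0) :: ennreal) \<in> borel_measurable (PiM {0..<Suc 0} (\<lambda>_. borel :: 's measure))"
      using measurable_component_singleton[of 0 "{0..<Suc 0}" "\<lambda>_. borel :: 's measure"] by measurable
    have "emeasure (distr M borel (\<lambda>\<omega>. \<omega> 0)) A = (\<integral>\<^sup>+\<omega>. indicator A (restrict \<omega> {0..<Suc 0} 0) \<partial>M)"
      using meas[of 0] by (simp add: nn_integral_distr flip: nn_integral_indicator)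
    also have "\<dots> = (\<integral>\<^sup>+\<omega>. indicator A (\<omega> 0) \<partial>C (Suc 0))"
      unfolding distr_C[symmetric] by (subst nn_integral_distr[OF restr]) (simp_all add: f)
    also have "\<dots> = (\<integral>\<^sup>+\<omega>. emeasure \<mu> A \<partial>C 0)"
      using C_Suc[OF f] sets A by (simp add: P_def)
    also have "\<dots> = emeasure \<mu> A"
      using prob_space.emeasure_space_1[OF prob_C[of 0]] by simp
    finally show "emeasure (distr M borel (\<lambda>\<omega>. \<omega> 0)) A = emeasure \<mu> A" .
  qed
  ultimately show thesis
    using that sets_M by blast
qed

lemma conditional_law_measure:
  assumes "prob_space M" and X: "X \<in> borel_measurable M" and S: "S \<in> sets M" "0 < measure M S"
    and A: "A \<in> sets borel"
  shows "measure (conditional_law M X S) A = measure M {\<omega> \<in> S. X \<omega> \<in> A} / measure M S"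
proof -
  interpret prob_space M by fact
  have "emeasure M S \<noteq> 0"
    using S by (simp add: emeasure_eq_measure)
  have "measure (conditional_law M X S) A = measure (uniform_measure M S) (X -` A \<inter> space M)"
    unfolding conditional_law_def using X A by (subst measure_distr) simp_all
  also have "\<dots> = measure M (S \<inter> (X -` A \<inter> space M)) / measure M S"
    using S measurable_sets[OF X A] \<open>emeasure M S \<noteq> 0\<close> by (intro measure_uniform_measure) auto
  also have "S \<inter> (X -` A \<inter> space M) = {\<omega> \<in> S. X \<omega> \<in> A}"
    using sets.sets_into_space[OF S(1)] by auto
  finally show ?thesis .
qed

text \<open>Once the first step is survived, every index left in the infimum is at least 2, so the
  infimum is at least \<open>2 * \<gamma>\<close> (infinite if no index is left) and the inequality
  is strict.\<close>

lemma chain_killing_time_gt_1: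
  assumes "0 < \<gamma>"
  shows "ereal \<gamma> < chain_killing_time lam \<gamma> Z E \<omega> \<longleftrightarrow> \<gamma> * lam (Z 1 \<omega>) < E \<omega>"
proof
  assume *: "ereal \<gamma> < chain_killing_time lam \<gamma> Z E \<omega>"
  show "\<gamma> * lam (Z 1 \<omega>) < E \<omega>"
  proof (rule ccontr)
    assume "\<not> \<gamma> * lam (Z 1 \<omega>) < E \<omega>"
    then have "chain_killing_time lam \<gamma> Z E \<omega> \<le> ereal (real 1 * \<gamma>)"
      unfolding chain_killing_time_def by (intro Inf_lower) (auto intro!: exI[of _ 1])
    then show False
      using * by simp
  qed
next
  assume *: "\<gamma> * lam (Z 1 \<omega>) < E \<omega>"
  have "ereal (2 * \<gamma>) \<le> chain_killing_time lam \<gamma> Z E \<omega>"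
    unfolding chain_killing_time_def
  proof (rule Inf_greatest, clarify)
    fix n :: nat assume n: "1 \<le> n" "E \<omega> \<le> \<gamma> * (\<Sum>k = 1..n. lam (Z k \<omega>))"
    have "n \<noteq> 1"
      using * n(2) by auto
    then have "2 * \<gamma> \<le> real n * \<gamma>"
      using n(1) assms by (intro mult_right_mono) auto
    then show "ereal (2 * \<gamma>) \<le> ereal (real n * \<gamma>)"
      by simp
  qed
  moreover have "ereal \<gamma> < ereal (2 * \<gamma>)"
    using assms by simp
  ultimately show "ereal \<gamma> < chain_killing_time lam \<gamma> Z E \<omega>"
    by (rule less_le_trans[rotated])
qed

text \<open>Both sides of the Markov identity depend only on the law of the path. This carries a
  chain to a larger space that also holds the killing variable.\<close>

lemma markov_chain_distr:
  fixes Z :: "nat \<Rightarrow> 'n \<Rightarrow> 's::topological_space"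
  assumes M: "prob_space M" and f: "f \<in> M \<rightarrow>\<^sub>M N"
    and K: "K \<in> borel \<rightarrow>\<^sub>M prob_algebra borel"
    and chain: "markov_chain K (distr M N f) Z"
  shows "markov_chain K M (\<lambda>n \<omega>. Z n (f \<omega>))"
  unfolding markov_chain_def
proof (intro conjI allI ballI)
  have Z: "Z n \<in> borel_measurable N" for n
    using chain by (simp add: markov_chain_def)
  then show "(\<lambda>\<omega>. Z n (f \<omega>)) \<in> borel_measurable M" for n
    using f by measurable
  fix n :: nat and D A
  assume D: "D \<in> sets (PiM {..n} (\<lambda>_. borel :: 's measure))" and A: "A \<in> sets (borel :: 's measure)"
  let ?r = "\<lambda>\<omega>. \<lambda>i\<in>{..n}. Z i \<omega>"
  have r: "?r \<in> N \<rightarrow>\<^sub>M PiM {..n} (\<lambda>_. borel)"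
    using Z by (intro measurable_restrict)
  have S: "{\<omega> \<in> space N. ?r \<omega> \<in> D} \<in> sets N"
    using r D by measurable
  have T: "{\<omega> \<in> space N. ?r \<omega> \<in> D \<and> Z (Suc n) \<omega> \<in> A} \<in> sets N"
    using r D Z[of "Suc n"] A by measurable
  have KA: "(\<lambda>\<omega>. indicator {\<omega> \<in> space N. ?r \<omega> \<in> D} \<omega> * measure (K (Z n \<omega>)) A) \<in> borel_measurable N"
    using S measurable_compose[OF Z measurable_compose[OF K measurable_measure_prob_algebra[OF A]]]
    by measurable
  have "measure M {\<omega> \<in> space M. ?r (f \<omega>) \<in> D \<and> Z (Suc n) (f \<omega>) \<in> A}
      = measure (distr M N f) {\<omega> \<in> space N. ?r \<omega> \<in> D \<and> Z (Suc n) \<omega> \<in> A}"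
    using f T measurable_space[OF f] by (subst measure_distr) (auto intro!: arg_cong[where f = "measure M"])
  also have "\<dots> = (LINT \<omega>:{\<omega> \<in> space N. ?r \<omega> \<in> D}|distr M N f. measure (K (Z n \<omega>)) A)"
    using chain D A unfolding markov_chain_def by (simp del: restrict_apply)
  also have "\<dots> = (LINT \<omega>:{\<omega> \<in> space M. ?r (f \<omega>) \<in> D}|M. measure (K (Z n (f \<omega>))) A)"
    unfolding set_lebesgue_integral_def using f KA measurable_space[OF f]
    by (subst integral_distr) (auto intro!: Bochner_Integration.integral_cong split: split_indicator)
  finally show "measure M {\<omega> \<in> space M. ?r (f \<omega>) \<in> D \<and> Z (Suc n) (f \<omega>) \<in> A}
      = (LINT \<omega>:{\<omega> \<in> space M. ?r (f \<omega>) \<in> D}|M. measure (K (Z n (f \<omega>))) A)" .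
qed (rule M)

section \<open>The killed chain on a product space and its conditional law after one step\<close>

context killed_euler
begin

text \<open>The product of path space and an exponential variable, which is exactly the sample type
  fixed in \<open>killed_euler_law\<close>. It provides the existence half of the definite
  description.\<close>

lemma exists_killed_euler_chain:
  assumes \<mu>: "\<mu> \<in> space (prob_algebra borel)"
  obtains M :: "((nat \<Rightarrow> 'd torus) \<times> real) measure" and Z E where
    "killed_euler_chain b \<gamma> M Z E" "distr M borel (Z 0) = \<mu>"
proof -
  obtain N :: "(nat \<Rightarrow> 'd torus) measure" where
    sets_N: "sets N = sets (PiM UNIV (\<lambda>_. borel))" and N: "markov_chain K N (\<lambda>n \<omega>. \<omega> n)"
    and N0: "distr N borel (\<lambda>\<omega>. \<omega> 0) = \<mu>"
    using exists_markov_chain[OF \<mu> kernel_measurable] by blast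
  interpret N: prob_space N
    using N by (simp add: markov_chain_def)
  interpret E: prob_space exp_measure
    by (rule prob_space_exp_measure)
  interpret NE: pair_prob_space N exp_measure ..
  define M where "M = N \<Otimes>\<^sub>M exp_measure"
  define Z where "Z n \<omega> = fst \<omega> n" for n and \<omega> :: "(nat \<Rightarrow> 'd torus) \<times> real"
  have fst_law: "distr M N fst = N"
    unfolding M_def by (rule E.distr_pair_fst)
  have fst: "fst \<in> M \<rightarrow>\<^sub>M N" and snd: "snd \<in> M \<rightarrow>\<^sub>M exp_measure"
    by (simp_all add: M_def)
  have snd_borel: "snd \<in> borel_measurable M"
    using snd by (simp cong: measurable_cong_sets)
  have M: "prob_space M"
    unfolding M_def by (rule NE.P.prob_space_axioms)
  interpret M: prob_space M
    by (rule M)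
  have rect: "measure M (A \<times> B) = measure N A * measure exp_measure B" if "A \<in> sets N" "B \<in> sets borel" for A B
    unfolding M_def using that by (simp add: measure_def E.emeasure_pair_measure_Times enn2real_mult)
  have chain: "markov_chain K M Z"
    using markov_chain_distr[OF M fst kernel_measurable, of "\<lambda>n \<omega>. \<omega> n"] N
    by (simp add: fst_law Z_def[abs_def])
  have exp: "distributed M lborel snd (exponential_density 1)"
  proof -
    have "distr M lborel snd = density lborel (exponential_density 1)"
    proof (rule measure_eqI)
      fix A assume "A \<in> sets (distr M lborel snd)"
      then have A: "A \<in> sets borel"
        by simp
      have "emeasure (distr M lborel snd) A = emeasure M (space N \<times> A)"
        using snd_borel A by (subst emeasure_distr) (auto simp: M_def space_pair_measure intro!: arg_cong2[where f = emeasure])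
      also have "\<dots> = emeasure exp_measure A"
        unfolding M_def using A by (subst E.emeasure_pair_measure_Times) (simp_all add: N.emeasure_space_1)
      finally show "emeasure (distr M lborel snd) A = emeasure (density lborel (exponential_density 1)) A"
        by (simp add: exp_measure_def)
    qed simp
    then show ?thesis
      using snd_borel by (simp add: distributed_def)
  qed
  have indep: "independent_rvs M borel snd (PiM UNIV (\<lambda>_. borel)) (\<lambda>\<omega> n. Z n \<omega>)"
    unfolding independent_rvs_def
  proof (intro conjI snd_borel)
    show fst': "(\<lambda>\<omega> n. Z n \<omega>) \<in> M \<rightarrow>\<^sub>M PiM UNIV (\<lambda>_. borel)"
      using fst by (simp add: Z_def cong: measurable_cong_sets[OF refl sets_N])
    show "M.indep_set {snd -` A \<inter> space M | A. A \<in> sets borel}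
        {(\<lambda>\<omega> n. Z n \<omega>) -` A \<inter> space M | A. A \<in> sets (PiM UNIV (\<lambda>_. borel))}"
      unfolding M.indep_sets2_eq
    proof (intro conjI ballI)
      fix a c
      assume "a \<in> {snd -` A \<inter> space M | A. A \<in> sets borel}"
        "c \<in> {(\<lambda>\<omega> n. Z n \<omega>) -` A \<inter> space M | A. A \<in> sets (PiM UNIV (\<lambda>_. borel))}"
      then obtain A C where A: "A \<in> sets borel" "a = snd -` A \<inter> space M"
        and C: "C \<in> sets N" "c = fst -` C \<inter> space M"
        by (auto simp: Z_def sets_N)
      have a: "a = space N \<times> A" and c: "c = C \<times> UNIV" and ac: "a \<inter> c = C \<times> A"
        using A C sets.sets_into_space[OF C(1)] by (auto simp: M_def space_pair_measure)
      show "measure M (a \<inter> c) = measure M a * measure M c"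
        unfolding ac unfolding a c using A C E.prob_space by (simp add: rect N.prob_space)
    qed (use measurable_sets[OF snd_borel] measurable_sets[OF fst'] in auto)
  qed
  have "distr M borel (Z 0) = distr (distr M N fst) borel (\<lambda>\<omega>. \<omega> 0)"
  proof -
    have "(\<lambda>\<omega>. \<omega> 0) \<in> borel_measurable N"
      using N by (simp add: markov_chain_def)
    then show ?thesis
      using fst by (subst distr_distr) (simp_all add: comp_def Z_def[abs_def])
  qed
  then have "distr M borel (Z 0) = \<mu>"
    by (simp add: fst_law N0)
  moreover have "killed_euler_chain b \<gamma> M Z snd"
    using chain exp indep by (simp add: killed_euler_chain_def)
  ultimately show thesis
    by (rule that[rotated])
qed

text \<open>Given \<open>Z 1 = z\<close>, the independent exponential variable exceeds
  \<open>\<gamma> * lam z\<close> with probability \<open>survival z\<close>; integrating over the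
  law \<open>\<mu> \<bind> K\<close> of \<open>Z 1\<close> gives the weighted mass.\<close>

lemma killed_euler_first_step:
  assumes chain: "killed_euler_chain b \<gamma> M Z E" and Z0: "distr M borel (Z 0) = \<mu>"
    and A: "A \<in> sets borel"
  shows "measure M {\<omega> \<in> space M. Z 1 \<omega> \<in> A \<and> \<gamma> * lam (Z 1 \<omega>) < E \<omega>} = surv (\<mu> \<bind> K) A"
proof -
  have markov: "markov_chain K M Z" and exp: "distributed M lborel E (exponential_density 1)"
    and indep: "independent_rvs M borel E (PiM UNIV (\<lambda>_. borel)) (\<lambda>\<omega> n. Z n \<omega>)"
    using chain by (simp_all add: killed_euler_chain_def)
  interpret M: prob_space M
    using markov by (simp add: markov_chain_def)
  have Z: "Z n \<in> borel_measurable M" for n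
    using markov by (simp add: markov_chain_def)
  have E: "E \<in> borel_measurable M"
    using exp by (simp add: distributed_def)
  have \<mu>: "\<mu> \<in> space (prob_algebra borel)"
    unfolding Z0[symmetric] using M.prob_space_distr[OF Z] by (simp add: space_prob_algebra)
  note \<mu>K = bind_kernel_prob[OF \<mu>]
  interpret \<mu>K: prob_space "\<mu> \<bind> K"
    using \<mu>K by (simp add: space_prob_algebra)
  interpret X: prob_space exp_measure
    by (rule prob_space_exp_measure)
  have sets_\<mu>: "sets \<mu> = sets borel" and sets_\<mu>K: "sets (\<mu> \<bind> K) = sets borel"
    using \<mu> \<mu>K by (simp_all add: space_prob_algebra)
  have law_Z1: "measure M {\<omega> \<in> space M. Z 1 \<omega> \<in> C} = measure (\<mu> \<bind> K) C" if C: "C \<in> sets borel" for C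
  proof -
    \<comment> \<open>The Markov property with a trivial event for the history, that is, the plain
      law of \<open>Z 1\<close>.\<close>
    have "measure M {\<omega> \<in> space M. (\<lambda>i\<in>{..0}. Z i \<omega>) \<in> space (PiM {..0} (\<lambda>_. borel)) \<and> Z (Suc 0) \<omega> \<in> C}
      = (LINT \<omega>:{\<omega> \<in> space M. (\<lambda>i\<in>{..0}. Z i \<omega>) \<in> space (PiM {..0} (\<lambda>_. borel))}|M. measure (K (Z 0 \<omega>)) C)"
      using markov C unfolding markov_chain_def by blast
    also have "\<dots> = (\<integral>\<omega>. measure (K (Z 0 \<omega>)) C \<partial>M)"
      unfolding set_lebesgue_integral_def
      by (intro Bochner_Integration.integral_cong) (auto simp: space_PiM)
    also have "\<dots> = (\<integral>x. measure (K x) C \<partial>distr M borel (Z 0))"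
      using measurable_compose[OF kernel_measurable measurable_measure_prob_algebra[OF C]] Z[of 0]
      by (subst integral_distr) simp_all
    also have "\<dots> = measure (\<mu> \<bind> K) C"
      unfolding Z0
    proof (rule subprob_space.measure_bind[symmetric, OF _ _ C])
      show "subprob_space \<mu>"
        using \<mu> by (simp add: space_prob_algebra prob_space_imp_subprob_space)
      show "K \<in> \<mu> \<rightarrow>\<^sub>M subprob_algebra borel"
        using measurable_prob_algebraD[OF kernel_measurable] by (simp cong: measurable_cong_sets add: sets_\<mu>)
    qed
    finally show ?thesis
      by (simp add: space_PiM)
  qed
  \<comment> \<open>The joint law of \<open>Z 1\<close> and \<open>E\<close> is identified on
    rectangles by independence; only then can \<open>E\<close> be integrated out for a fixed
    position.\<close>
  have "(\<mu> \<bind> K) \<Otimes>\<^sub>M exp_measure = distr M (borel \<Otimes>\<^sub>M borel) (\<lambda>\<omega>. (Z 1 \<omega>, E \<omega>))"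
  proof (rule pair_measure_eqI)
    show "sigma_finite_measure (\<mu> \<bind> K)" "sigma_finite_measure exp_measure"
      by unfold_locales
    show "sets ((\<mu> \<bind> K) \<Otimes>\<^sub>M exp_measure) = sets (distr M (borel \<Otimes>\<^sub>M borel) (\<lambda>\<omega>. (Z 1 \<omega>, E \<omega>)))"
      unfolding sets_distr by (rule sets_pair_measure_cong) (simp_all add: sets_\<mu>K)
    fix C B assume "C \<in> sets (\<mu> \<bind> K)" "B \<in> sets exp_measure"
    then have C: "C \<in> sets borel" and B: "B \<in> sets borel"
      by (simp_all add: sets_\<mu>K)
    let ?c = "{\<omega> \<in> space M. Z 1 \<omega> \<in> C}" and ?e = "{\<omega> \<in> space M. E \<omega> \<in> B}"
    have "{x \<in> space (PiM UNIV (\<lambda>_. borel)). x (1 :: nat) \<in> C} \<in> sets (PiM UNIV (\<lambda>_. borel :: 'd torus measure))"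
      using C by measurable
    then have "?c \<in> {(\<lambda>\<omega> n. Z n \<omega>) -` A \<inter> space M | A. A \<in> sets (PiM UNIV (\<lambda>_. borel))}"
      by (intro CollectI exI[of _ "{x \<in> space (PiM UNIV (\<lambda>_. borel)). x (1 :: nat) \<in> C}"]) (auto simp: space_PiM)
    moreover have "?e \<in> {E -` A \<inter> space M | A. A \<in> sets borel}"
      using B by blast
    ultimately have "measure M (?e \<inter> ?c) = measure M ?e * measure M ?c"
      using indep unfolding independent_rvs_def M.indep_sets2_eq by blast
    moreover have "measure M ?e = measure exp_measure B"
    proof -
      have "exp_measure = distr M lborel E"
        using exp by (simp add: distributed_def exp_measure_def)
      then have "measure exp_measure B = measure (distr M lborel E) B"
        by (rule arg_cong)
      also have "\<dots> = measure M (E -` B \<inter> space M)"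
        using E B by (intro measure_distr) simp_all
      finally show ?thesis
        by (simp add: vimage_def Int_def conj_commute)
    qed
    ultimately have "measure M (?e \<inter> ?c) = measure exp_measure B * measure (\<mu> \<bind> K) C"
      unfolding law_Z1[OF C] by (simp only:)
    then have "measure M (?c \<inter> ?e) = measure (\<mu> \<bind> K) C * measure exp_measure B"
      by (simp only: Int_commute mult.commute)
    moreover have "emeasure (distr M (borel \<Otimes>\<^sub>M borel) (\<lambda>\<omega>. (Z 1 \<omega>, E \<omega>))) (C \<times> B) = emeasure M (?c \<inter> ?e)"
      using Z[of 1] E C B by (subst emeasure_distr) (auto intro!: arg_cong2[where f = emeasure])
    ultimately show "emeasure (\<mu> \<bind> K) C * emeasure exp_measure B
        = emeasure (distr M (borel \<Otimes>\<^sub>M borel) (\<lambda>\<omega>. (Z 1 \<omega>, E \<omega>))) (C \<times> B)"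
      by (simp add: M.emeasure_eq_measure \<mu>K.emeasure_eq_measure X.emeasure_eq_measure ennreal_mult)
  qed
  note joint = this
  let ?S = "{z :: 'd torus \<times> real. fst z \<in> A \<and> \<gamma> * lam (fst z) < snd z}"
  have S: "?S \<in> sets (borel \<Otimes>\<^sub>M borel)"
  proof -
    have "{z \<in> space (borel \<Otimes>\<^sub>M borel). fst z \<in> A \<and> \<gamma> * lam (fst z) < snd z} \<in> sets (borel \<Otimes>\<^sub>M borel)"
      using A by measurable
    then show ?thesis
      by (simp add: space_pair_measure)
  qed
  have S': "?S \<in> sets ((\<mu> \<bind> K) \<Otimes>\<^sub>M exp_measure)"
    using S unfolding joint by simp
  have "emeasure M {\<omega> \<in> space M. Z 1 \<omega> \<in> A \<and> \<gamma> * lam (Z 1 \<omega>) < E \<omega>}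
      = emeasure (distr M (borel \<Otimes>\<^sub>M borel) (\<lambda>\<omega>. (Z 1 \<omega>, E \<omega>))) ?S"
    using Z[of 1] E S by (subst emeasure_distr) (auto intro!: arg_cong2[where f = emeasure])
  also have "\<dots> = (\<integral>\<^sup>+z. emeasure exp_measure (Pair z -` ?S) \<partial>(\<mu> \<bind> K))"
    unfolding joint[symmetric] by (rule X.emeasure_pair_measure_alt[OF S'])
  also have "\<dots> = (\<integral>\<^sup>+z. ennreal (indicator A z * survival z) \<partial>(\<mu> \<bind> K))"
  proof (rule nn_integral_cong)
    fix z
    have "Pair z -` ?S = (if z \<in> A then {\<gamma> * lam z<..} else {})"
      by auto
    then show "emeasure exp_measure (Pair z -` ?S) = ennreal (indicator A z * survival z)"
      using measure_exp_measure_gt[of "\<gamma> * lam z"] lam_nonneg[of z] \<gamma>_pos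
      by (simp add: X.emeasure_eq_measure survival_def)
  qed
  also have "\<dots> = ennreal (surv (\<mu> \<bind> K) A)"
    unfolding weighted_mass_def
    by (rule nn_integral_eq_integral) (auto intro!: weighted_integrable \<mu>K A mult_nonneg_nonneg less_imp_le[OF g_pos])
  finally show ?thesis
    by (simp add: measure_def weighted_mass_nonneg less_imp_le[OF g_pos])
qed

lemma killed_euler_conditional_law:
  assumes chain: "killed_euler_chain b \<gamma> M Z E" and Z0: "distr M borel (Z 0) = \<mu>"
    and A: "A \<in> sets borel"
  shows "measure (conditional_law M (Z 1) {\<omega> \<in> space M. ereal (real 1 * \<gamma>) < chain_killing_time lam \<gamma> Z E \<omega>}) A
    = surv (\<mu> \<bind> K) A / surv (\<mu> \<bind> K) UNIV"
proof -
  have markov: "markov_chain K M Z" and E: "E \<in> borel_measurable M"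
    using chain by (simp_all add: killed_euler_chain_def distributed_def)
  interpret M: prob_space M
    using markov by (simp add: markov_chain_def)
  have Z: "Z n \<in> borel_measurable M" for n
    using markov by (simp add: markov_chain_def)
  let ?S = "{\<omega> \<in> space M. \<gamma> * lam (Z 1 \<omega>) < E \<omega>}"
  have S: "{\<omega> \<in> space M. ereal (real 1 * \<gamma>) < chain_killing_time lam \<gamma> Z E \<omega>} = ?S"
    by (simp add: chain_killing_time_gt_1[OF \<gamma>_pos])
  have "\<mu> \<in> space (prob_algebra borel)"
    unfolding Z0[symmetric] using M.prob_space_distr[OF Z] by (simp add: space_prob_algebra)
  then have "0 < surv (\<mu> \<bind> K) UNIV"
    by (intro weighted_mass_UNIV_pos bind_kernel_prob)
  moreover have "measure M ?S = surv (\<mu> \<bind> K) UNIV"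
    using killed_euler_first_step[OF chain Z0, of UNIV] by simp
  moreover have "?S \<in> sets M"
    using Z[of 1] E measurable_compose[OF Z[of 1] lam_measurable] by measurable
  moreover have "{\<omega> \<in> ?S. Z 1 \<omega> \<in> A} = {\<omega> \<in> space M. Z 1 \<omega> \<in> A \<and> \<gamma> * lam (Z 1 \<omega>) < E \<omega>}"
    by auto
  ultimately show ?thesis
    unfolding S using conditional_law_measure[OF M.prob_space_axioms Z[of 1] _ _ A, of ?S]
      killed_euler_first_step[OF chain Z0 A] by simp
qed

text \<open>The conditional law takes the same values on Borel sets for every chain with initial law
  \<open>\<mu>\<close>; with existence, the definite description denotes it.\<close>

lemma measure_killed_euler_law_1:
  assumes \<mu>: "\<mu> \<in> space (prob_algebra borel)" and A: "A \<in> sets borel"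
  shows "measure (killed_euler_law b lam \<gamma> \<mu> 1) A = surv (\<mu> \<bind> K) A / surv (\<mu> \<bind> K) UNIV"
proof -
  let ?P = "\<lambda>\<nu>. \<exists>(M :: ((nat \<Rightarrow> 'd torus) \<times> real) measure) Z E.
    killed_euler_chain b \<gamma> M Z E \<and> distr M borel (Z 0) = \<mu> \<and>
    \<nu> = conditional_law M (Z 1) {\<omega> \<in> space M. ereal (real 1 * \<gamma>) < chain_killing_time lam \<gamma> Z E \<omega>}"
  have val: "measure \<nu> C = surv (\<mu> \<bind> K) C / surv (\<mu> \<bind> K) UNIV" if "?P \<nu>" "C \<in> sets borel" for \<nu> C
    using that killed_euler_conditional_law by blast
  have fin: "sets \<nu> = sets borel \<and> finite_measure \<nu>" if P: "?P \<nu>" for \<nu>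
  proof -
    obtain M :: "((nat \<Rightarrow> 'd torus) \<times> real) measure" and Z E where *:
      "killed_euler_chain b \<gamma> M Z E"
      "\<nu> = conditional_law M (Z 1) {\<omega> \<in> space M. ereal (real 1 * \<gamma>) < chain_killing_time lam \<gamma> Z E \<omega>}"
      using P by blast
    have sets: "sets \<nu> = sets borel"
      by (simp add: * conditional_law_def)
    \<comment> \<open>An infinite total mass would make \<open>measure\<close> equal to 0, so the
      value 1 proves finiteness.\<close>
    have "measure \<nu> UNIV = 1"
      using val[OF P, of UNIV] weighted_mass_UNIV_pos[OF bind_kernel_prob[OF \<mu>]] by simp
    then have "emeasure \<nu> (space \<nu>) \<noteq> \<infinity>"
      using sets_eq_imp_space_eq[OF sets] by (auto simp: measure_def)
    then show ?thesis
      using sets by (simp add: finite_measureI)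
  qed
  have "\<exists>!\<nu>. ?P \<nu>"
  proof (rule ex_ex1I)
    show "\<exists>\<nu>. ?P \<nu>"
      using exists_killed_euler_chain[OF \<mu>] by metis
    fix \<nu> \<nu>' assume P: "?P \<nu>" "?P \<nu>'"
    show "\<nu> = \<nu>'"
    proof (rule measure_eqI)
      show "sets \<nu> = sets \<nu>'"
        using fin[OF P(1)] fin[OF P(2)] by simp
      fix C assume "C \<in> sets \<nu>"
      then have C: "C \<in> sets borel"
        using fin[OF P(1)] by simp
      show "emeasure \<nu> C = emeasure \<nu>' C"
        using fin[OF P(1)] fin[OF P(2)] val[OF P(1) C] val[OF P(2) C]
        by (simp add: finite_measure.emeasure_eq_measure)
    qed
  qed
  then have "?P (THE \<nu>. ?P \<nu>)"
    by (rule theI')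
  then show ?thesis
    unfolding killed_euler_law_def by (rule val[OF _ A])
qed

end

section \<open>Perturbing a coupling\<close>

lemma couplings_iff:
  assumes "P \<in> couplings \<mu> \<nu>"
  shows "prob_space P" "sets P = sets (\<mu> \<Otimes>\<^sub>M \<nu>)" "distr P \<mu> fst = \<mu>" "distr P \<nu> snd = \<nu>"
  using assms by (simp_all add: couplings_def space_prob_algebra)

lemma rho_bounds:
  assumes "0 < a"
  shows "0 \<le> rho a x y" "rho a x y \<le> 1 / a"
  using assms by (simp_all add: rho_def divide_right_mono)

lemma integral_rho_bounds:
  assumes "0 < a" "prob_space P"
  shows "0 \<le> (\<integral>z. rho a (fst z) (snd z) \<partial>P)" "(\<integral>z. rho a (fst z) (snd z) \<partial>P) \<le> 1 / a"
proof -
  interpret prob_space P by fact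
  show "0 \<le> (\<integral>z. rho a (fst z) (snd z) \<partial>P)"
    using rho_bounds[OF assms(1)] by (intro Bochner_Integration.integral_nonneg)
  show "(\<integral>z. rho a (fst z) (snd z) \<partial>P) \<le> 1 / a"
  proof (cases "integrable P (\<lambda>z. rho a (fst z) (snd z))")
    case True
    then show ?thesis
      by (intro integral_le_const AE_I2 rho_bounds(2)[OF assms(1)])
  next
    \<comment> \<open>The Bochner integral of a nonintegrable function is 0 by convention, so the
      bound persists.\<close>
    case False
    then show ?thesis
      using assms(1) by (simp add: not_integrable_integral_eq)
  qed
qed

lemma wasserstein_rho_le:
  assumes "0 < a" "P \<in> couplings \<mu> \<nu>"
  shows "wasserstein (rho a) \<mu> \<nu> \<le> (\<integral>z. rho a (fst z) (snd z) \<partial>P)"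
  unfolding wasserstein_def
  using assms integral_rho_bounds(1)[OF assms(1) couplings_iff(1)]
  by (intro cINF_lower) (auto intro!: bdd_belowI[of _ 0])

text \<open>The common part \<open>\<mu>' / (1 + \<delta>)\<close> of \<open>\<mu>\<close> and \<open>\<mu>'\<close> stays coupled as before; the rest of \<open>\<mu>\<close> has
  mass \<open>\<delta> / (1 + \<delta>)\<close> and is coupled independently. This avoids the gluing lemma that the triangle
  inequality for the Wasserstein distance would require.\<close>

lemma wasserstein_rho_perturb:
  assumes a: "0 < a" and \<delta>: "0 < \<delta>"
    and \<mu>: "\<mu> \<in> space (prob_algebra borel)" and \<mu>': "\<mu>' \<in> space (prob_algebra borel)"
    and \<nu>: "\<nu> \<in> space (prob_algebra borel)"
    and le: "\<And>A. A \<in> sets borel \<Longrightarrow> measure \<mu>' A \<le> (1 + \<delta>) * measure \<mu> A"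
  shows "wasserstein (rho a) \<mu> \<nu> \<le> wasserstein (rho a) \<mu>' \<nu> + \<delta> / a"
proof -
  have sets: "sets \<mu> = sets borel" "sets \<mu>' = sets borel" "sets \<nu> = sets borel"
    and "prob_space \<mu>" "prob_space \<mu>'" "prob_space \<nu>"
    using \<mu> \<mu>' \<nu> by (simp_all add: space_prob_algebra)
  interpret \<mu>: prob_space \<mu> by fact
  interpret \<mu>': prob_space \<mu>' by fact
  interpret \<nu>: prob_space \<nu> by fact
  interpret \<mu>'\<nu>: pair_prob_space \<mu>' \<nu> ..
  have space: "space \<mu> = UNIV" "space \<mu>' = UNIV" "space \<nu> = UNIV"
    using sets[THEN sets_eq_imp_space_eq] by simp_all
  \<comment> \<open>The normalised remainder is
    \<open>R = ((1 + \<delta>) \<mu> - \<mu>') / \<delta>\<close>: nonnegative by the domination, of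
    mass 1 because both laws have mass 1. The positivity of \<open>\<delta>\<close> is used
    here.\<close>
  define c where "c = 1 / \<delta>"
  define R where "R = diff_measure (scale_measure (ennreal (c * (1 + \<delta>))) \<mu>) (scale_measure (ennreal c) \<mu>')"
  have c: "0 < c" "c * \<delta> = 1"
    using \<delta> by (simp_all add: c_def)
  have sets_R: "sets R = sets borel"
    by (simp add: R_def sets)
  have R_A: "emeasure R A = ennreal (c * (1 + \<delta>) * measure \<mu> A - c * measure \<mu>' A)" if A: "A \<in> sets borel" for A
  proof -
    have "emeasure R A = emeasure (scale_measure (ennreal (c * (1 + \<delta>))) \<mu>) A - emeasure (scale_measure (ennreal c) \<mu>') A"
      unfolding R_def
    proof (rule emeasure_diff_measure)
      show "finite_measure (scale_measure (ennreal (c * (1 + \<delta>))) \<mu>)"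
        by (rule finite_measureI) (simp add: \<mu>.emeasure_eq_measure ennreal_mult[symmetric] space_scale_measure ennreal_mult_eq_top_iff)
      show "finite_measure (scale_measure (ennreal c) \<mu>')"
        by (rule finite_measureI) (simp add: \<mu>'.emeasure_eq_measure ennreal_mult[symmetric] space_scale_measure ennreal_mult_eq_top_iff)
      fix B assume "B \<in> sets (scale_measure (ennreal (c * (1 + \<delta>))) \<mu>)"
      then have "measure \<mu>' B \<le> (1 + \<delta>) * measure \<mu> B"
        by (intro le) (simp add: sets)
      from mult_left_mono[OF this less_imp_le[OF c(1)]]
      show "emeasure (scale_measure (ennreal c) \<mu>') B \<le> emeasure (scale_measure (ennreal (c * (1 + \<delta>))) \<mu>) B"
        using c \<delta> by (simp add: \<mu>.emeasure_eq_measure \<mu>'.emeasure_eq_measure ennreal_mult[symmetric] mult.assoc)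
    qed (use A in \<open>simp_all add: sets\<close>)
    also have "\<dots> = ennreal (c * (1 + \<delta>) * measure \<mu> A) - ennreal (c * measure \<mu>' A)"
      using c \<delta> by (simp add: \<mu>.emeasure_eq_measure \<mu>'.emeasure_eq_measure ennreal_mult[symmetric])
    also have "\<dots> = ennreal (c * (1 + \<delta>) * measure \<mu> A - c * measure \<mu>' A)"
      using c by (intro ennreal_minus) simp
    finally show ?thesis .
  qed
  have space_R: "space R = UNIV"
    using sets_R[THEN sets_eq_imp_space_eq] by simp
  have "emeasure R (space R) = 1"
    using R_A[of UNIV] \<mu>.prob_space \<mu>'.prob_space c by (simp add: space space_R algebra_simps)
  then interpret R: prob_space R
    by (rule prob_spaceI)
  interpret R\<nu>: pair_prob_space R \<nu> ..
  have R_measure: "measure R A = c * (1 + \<delta>) * measure \<mu> A - c * measure \<mu>' A" if A: "A \<in> sets borel" for A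
    using mult_left_mono[OF le[OF A] less_imp_le[OF c(1)]]
    by (simp add: measure_def[of R] R_A[OF A] mult.assoc)
  \<comment> \<open>The weight in the decomposition
    \<open>\<mu> = t \<mu>' + (1 - t) R\<close>.\<close>
  define t where "t = 1 / (1 + \<delta>)"
  have t: "0 \<le> t" "t \<le> 1" "1 - t = \<delta> / (1 + \<delta>)"
    using \<delta> by (simp_all add: t_def field_simps)
  have mix: "t * measure \<mu>' A + (1 - t) * measure R A = measure \<mu> A" if A: "A \<in> sets borel" for A
  proof -
    have tc: "(1 - t) * c = t" and t1: "t * (1 + \<delta>) = 1"
      unfolding t(3) unfolding c_def t_def using \<delta> by simp_all
    have "(1 - t) * measure R A = ((1 - t) * c) * ((1 + \<delta>) * measure \<mu> A - measure \<mu>' A)"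
      unfolding R_measure[OF A] by (simp only: mult.assoc right_diff_distrib)
    also have "\<dots> = (t * (1 + \<delta>)) * measure \<mu> A - t * measure \<mu>' A"
      unfolding tc by (simp only: mult.assoc right_diff_distrib)
    finally show ?thesis
      unfolding t1 by simp
  qed
  have sets_pair: "sets (\<mu>' \<Otimes>\<^sub>M \<nu>) = sets (borel \<Otimes>\<^sub>M borel)" "sets (R \<Otimes>\<^sub>M \<nu>) = sets (borel \<Otimes>\<^sub>M borel)"
    "sets (\<mu> \<Otimes>\<^sub>M \<nu>) = sets (borel \<Otimes>\<^sub>M borel)"
    by (intro sets_pair_measure_cong sets sets_R)+
  have upper: "wasserstein (rho a) \<mu> \<nu> \<le> (\<integral>z. rho a (fst z) (snd z) \<partial>P) + \<delta> / a"
    if P: "P \<in> couplings \<mu>' \<nu>" for P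
  proof -
    interpret P: prob_space P
      using couplings_iff(1)[OF P] .
    have sets_P: "sets P = sets (borel \<Otimes>\<^sub>M borel)"
      using couplings_iff(2)[OF P] sets_pair by simp
    have space_P: "space P = UNIV"
      using sets_P[THEN sets_eq_imp_space_eq] by (simp add: space_pair_measure)
    \<comment> \<open>A coin of bias \<open>t\<close> decides between the given coupling of
      \<open>\<mu>'\<close> and \<open>\<nu>\<close> and the product of \<open>R\<close> and
      \<open>\<nu>\<close>; mixing preserves the second marginal.\<close>
    let ?N = "\<lambda>i. if i then P else R \<Otimes>\<^sub>M \<nu>"
    define Q where "Q = measure_pmf (bernoulli_pmf t) \<bind> ?N"
    have N: "?N \<in> measure_pmf (bernoulli_pmf t) \<rightarrow>\<^sub>M subprob_algebra (borel \<Otimes>\<^sub>M borel)"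
      using P.prob_space_axioms R\<nu>.P.prob_space_axioms sets_P sets_pair
      by (auto simp: measurable_def space_subprob_algebra prob_space_imp_subprob_space)
    have sets_Q: "sets Q = sets (borel \<Otimes>\<^sub>M borel)"
      unfolding Q_def by (rule sets_bind[OF _ ]) (auto simp: sets_P sets_pair)
    have space_Q: "space Q = UNIV"
      using sets_Q[THEN sets_eq_imp_space_eq] by (simp add: space_pair_measure)
    have Q: "measure Q C = t * measure P C + (1 - t) * measure (R \<Otimes>\<^sub>M \<nu>) C" if "C \<in> sets (borel \<Otimes>\<^sub>M borel)" for C
    proof -
      have "measure Q C = (\<integral>i. measure (?N i) C \<partial>measure_pmf (bernoulli_pmf t))"
        unfolding Q_def by (rule subprob_space.measure_bind[OF _ N that]) (rule prob_space_imp_subprob_space, rule prob_space_measure_pmf)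
      also have "\<dots> = t * measure P C + (1 - t) * measure (R \<Otimes>\<^sub>M \<nu>) C"
        using t by (simp add: integral_measure_pmf_real[of UNIV] UNIV_bool)
      finally show ?thesis .
    qed
    have "emeasure Q (space Q) = (\<integral>\<^sup>+i. emeasure (?N i) (space Q) \<partial>measure_pmf (bernoulli_pmf t))"
      unfolding Q_def using sets_Q[unfolded Q_def] by (intro emeasure_bind[OF _ N]) auto
    also have "\<dots> = (\<integral>\<^sup>+i. 1 \<partial>measure_pmf (bernoulli_pmf t))"
      using P.emeasure_space_1 R\<nu>.P.emeasure_space_1 space_P
      by (intro nn_integral_cong) (auto simp: space_Q space_pair_measure space_R space)
    finally have "prob_space Q"
      by (intro prob_spaceI) simp
    then interpret Q: prob_space Q .
    have marg1: "distr Q \<mu> fst = \<mu>"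
    proof (rule measure_eqI)
      fix A assume "A \<in> sets (distr Q \<mu> fst)"
      then have A: "A \<in> sets borel"
        by (simp add: sets)
      have pre: "fst -` A \<in> sets (borel \<Otimes>\<^sub>M borel :: ('a \<times> 'a) measure)"
        using measurable_sets[OF measurable_fst[of borel borel] A] by (simp add: space_pair_measure)
      have fstQ: "fst \<in> Q \<rightarrow>\<^sub>M \<mu>"
        by (simp add: measurable_cong_sets[OF sets_Q sets(1)])
      have "measure P (fst -` A) = measure \<mu>' A"
      proof -
        have "measure (distr P \<mu>' fst) A = measure P (fst -` A \<inter> space P)"
          using A by (intro measure_distr) (simp_all add: measurable_cong_sets[OF sets_P sets(2)] sets)
        then show ?thesis
          by (simp add: couplings_iff(3)[OF P] space_P)
      qed
      moreover have "measure (R \<Otimes>\<^sub>M \<nu>) (fst -` A) = measure R A"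
      proof -
        have "fst -` A = A \<times> space \<nu>"
          by (auto simp: space)
        then show ?thesis
          using A \<nu>.emeasure_space_1 by (simp add: measure_def \<nu>.emeasure_pair_measure_Times sets_R)
      qed
      ultimately have "measure Q (fst -` A) = measure \<mu> A"
        using Q[OF pre] mix[OF A] by simp
      then show "emeasure (distr Q \<mu> fst) A = emeasure \<mu> A"
        using A fstQ by (simp add: emeasure_distr sets space_Q Q.emeasure_eq_measure \<mu>.emeasure_eq_measure)
    qed simp
    have marg2: "distr Q \<nu> snd = \<nu>"
    proof (rule measure_eqI)
      fix A assume "A \<in> sets (distr Q \<nu> snd)"
      then have A: "A \<in> sets borel"
        by (simp add: sets)
      have pre: "snd -` A \<in> sets (borel \<Otimes>\<^sub>M borel :: ('a \<times> 'a) measure)"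
        using measurable_sets[OF measurable_snd[of borel borel] A] by (simp add: space_pair_measure)
      have sndQ: "snd \<in> Q \<rightarrow>\<^sub>M \<nu>"
        by (simp add: measurable_cong_sets[OF sets_Q sets(3)])
      have "measure P (snd -` A) = measure \<nu> A"
      proof -
        have "measure (distr P \<nu> snd) A = measure P (snd -` A \<inter> space P)"
          using A by (intro measure_distr) (simp_all add: measurable_cong_sets[OF sets_P sets(3)] sets)
        then show ?thesis
          by (simp add: couplings_iff(4)[OF P] space_P)
      qed
      moreover have "measure (R \<Otimes>\<^sub>M \<nu>) (snd -` A) = measure \<nu> A"
      proof -
        have "snd -` A = space R \<times> A"
          by (auto simp: space_R)
        then show ?thesis
          using A R.emeasure_space_1 by (simp add: measure_def \<nu>.emeasure_pair_measure_Times sets)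
      qed
      ultimately have "measure Q (snd -` A) = measure \<nu> A"
        using Q[OF pre] by (simp add: algebra_simps)
      then show "emeasure (distr Q \<nu> snd) A = emeasure \<nu> A"
        using A sndQ by (simp add: emeasure_distr sets space_Q Q.emeasure_eq_measure \<nu>.emeasure_eq_measure)
    qed simp
    have "Q \<in> couplings \<mu> \<nu>"
      using marg1 marg2 \<open>prob_space Q\<close> sets_Q sets_pair by (simp add: couplings_def space_prob_algebra)
    then have "wasserstein (rho a) \<mu> \<nu> \<le> (\<integral>z. rho a (fst z) (snd z) \<partial>Q)"
      by (rule wasserstein_rho_le[OF a])
    also have "\<dots> \<le> (\<integral>z. rho a (fst z) (snd z) \<partial>P) + \<delta> / a"
    proof (cases "(\<lambda>z. rho a (fst z) (snd z)) \<in> borel_measurable (borel \<Otimes>\<^sub>M borel :: ('a \<times> 'a) measure)")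
      case True
      have "(\<integral>z. rho a (fst z) (snd z) \<partial>Q) = (\<integral>i. (\<integral>z. rho a (fst z) (snd z) \<partial>?N i) \<partial>measure_pmf (bernoulli_pmf t))"
        unfolding Q_def
      proof (rule integral_bind[OF True _ N, where B = "1 / a" and B' = 1])
        show "\<bar>rho a (fst z) (snd z)\<bar> \<le> 1 / a" for z :: "'a \<times> 'a"
          using rho_bounds[OF a, of "fst z" "snd z"] by simp
        show "finite_measure (measure_pmf (bernoulli_pmf t))"
          by unfold_locales
        show "AE i in measure_pmf (bernoulli_pmf t). emeasure (?N i) (space (?N i)) \<le> ennreal 1"
          using P.emeasure_space_1 R\<nu>.P.emeasure_space_1 by simp
      qed
      also have "\<dots> = t * (\<integral>z. rho a (fst z) (snd z) \<partial>P) + (1 - t) * (\<integral>z. rho a (fst z) (snd z) \<partial>(R \<Otimes>\<^sub>M \<nu>))"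
        using t by (simp add: integral_measure_pmf_real[of UNIV] UNIV_bool)
      \<comment> \<open>The independent part has weight
        \<open>\<delta> / (1 + \<delta>) \<le> \<delta>\<close> and \<open>rho a\<close> never
        exceeds \<open>1 / a\<close>.\<close>
      also have "\<dots> \<le> 1 * (\<integral>z. rho a (fst z) (snd z) \<partial>P) + \<delta> * (1 / a)"
        using t \<delta> integral_rho_bounds[OF a P.prob_space_axioms] integral_rho_bounds[OF a R\<nu>.P.prob_space_axioms]
        by (intro add_mono mult_mono) (auto simp: t(3) field_simps)
      finally show ?thesis
        by simp
    next
      \<comment> \<open>On a general metric space the distance need not be measurable for the
        product sigma-algebra; the integral is then 0 by convention and the bound is
        immediate.\<close>
      case False
      then have "(\<lambda>z. rho a (fst z) (snd z)) \<notin> borel_measurable Q"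
        by (simp cong: measurable_cong_sets add: sets_Q)
      then have "(\<integral>z. rho a (fst z) (snd z) \<partial>Q) = 0"
        by (intro not_integrable_integral_eq) (auto dest: borel_measurable_integrable)
      then show ?thesis
        using integral_rho_bounds(1)[OF a P.prob_space_axioms] a \<delta> by simp
    qed
    finally show ?thesis .
  qed
  \<comment> \<open>The infimum over couplings must range over a nonempty set for a lower bound of
    its elements to bound it.\<close>
  have "\<mu>' \<Otimes>\<^sub>M \<nu> \<in> couplings \<mu>' \<nu>"
  proof -
    have "distr (\<mu>' \<Otimes>\<^sub>M \<nu>) \<nu> snd = \<nu>"
    proof (rule measure_eqI)
      fix A assume "A \<in> sets (distr (\<mu>' \<Otimes>\<^sub>M \<nu>) \<nu> snd)"
      then have A: "A \<in> sets \<nu>"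
        by simp
      have "emeasure (distr (\<mu>' \<Otimes>\<^sub>M \<nu>) \<nu> snd) A = emeasure (\<mu>' \<Otimes>\<^sub>M \<nu>) (space \<mu>' \<times> A)"
        using A by (subst emeasure_distr) (auto simp: space_pair_measure space intro!: arg_cong2[where f = emeasure])
      then show "emeasure (distr (\<mu>' \<Otimes>\<^sub>M \<nu>) \<nu> snd) A = emeasure \<nu> A"
        using A \<mu>'.emeasure_space_1 by (simp add: \<nu>.emeasure_pair_measure_Times)
    qed simp
    then show ?thesis
      using \<nu>.distr_pair_fst[of \<mu>'] \<mu>'\<nu>.P.prob_space_axioms by (simp add: couplings_def space_prob_algebra)
  qed
  then have "wasserstein (rho a) \<mu> \<nu> - \<delta> / a \<le> wasserstein (rho a) \<mu>' \<nu>"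
    unfolding wasserstein_def[of "rho a" \<mu>' \<nu>] using upper
    by (intro cINF_greatest) (auto simp: diff_le_eq)
  then show ?thesis
    by simp
qed

section \<open>Conclusion\<close>

context killed_euler
begin

text \<open>Quasi-stationarity at time one, with the explicit one-step conditional law, is the
  normalised eigenvector equation required by \<open>doeblin_fixed_point\<close>.\<close>

lemma euler_qsd_fixed_point:
  assumes "euler_qsd b lam \<gamma> \<nu>" and A: "A \<in> sets borel"
  shows "measure \<nu> A = (\<integral>x. surv (K x) A \<partial>\<nu>) / (\<integral>x. surv (K x) UNIV \<partial>\<nu>)"
proof -
  have \<nu>: "\<nu> \<in> space (prob_algebra borel)" and "killed_euler_law b lam \<gamma> \<nu> 1 = \<nu>"
    using assms(1) by (auto simp: euler_qsd_def)
  then have "measure \<nu> A = surv (\<nu> \<bind> K) A / surv (\<nu> \<bind> K) UNIV"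
    using measure_killed_euler_law_1[OF \<nu> A] by simp
  then show ?thesis
    using weighted_mass_bind[OF \<nu> kernel_measurable] A by simp
qed

text \<open>Mean-field step and conditional law of the chain are the same normalised map, so the
  Doeblin contraction applies from any \<open>\<eta>\<close>, with \<open>q = 1 - \<epsilon>\<close>
  and \<open>c = (1 / \<epsilon>)^2 - 1\<close>. The one-sided form is what
  \<open>wasserstein_rho_perturb\<close> takes.\<close>

lemma mean_field_law_le_euler_qsd:
  assumes qsd: "euler_qsd b lam \<gamma> \<nu>" and \<eta>: "\<eta> \<in> space (prob_algebra borel)"
  obtains q c where "0 \<le> q" "q < 1" "0 \<le> c"
    "\<And>n A. A \<in> sets borel \<Longrightarrow>
      measure (mean_field_law b lam \<gamma> \<eta> (Suc n)) A \<le> (1 + q ^ n * c) * measure \<nu> A"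
proof -
  have \<nu>: "\<nu> \<in> space (prob_algebra borel)"
    using qsd by (simp add: euler_qsd_def)
  then have sets: "sets \<nu> = sets borel" and prob: "prob_space \<nu>"
    by (simp_all add: space_prob_algebra)
  have space: "space \<nu> = UNIV"
    using sets_eq_imp_space_eq[OF sets] by simp
  obtain \<alpha> \<beta> where \<alpha>\<beta>: "0 < \<alpha>" "\<alpha> \<le> \<beta>"
    "\<And>x A. A \<in> sets borel \<Longrightarrow> \<alpha> * measure cube_measure A \<le> surv (K x) A"
    "\<And>x A. A \<in> sets borel \<Longrightarrow> surv (K x) A \<le> \<beta> * measure cube_measure A"
    using surv_kernel_bounds by blast
  interpret doeblin_fixed_point "\<lambda>x. surv (K x)" cube_measure \<nu> \<alpha> \<beta>
  proof (rule doeblin_fixed_point.intro)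
    show "0 < (\<integral>x. surv (K x) (space \<nu>) \<partial>\<nu>)"
      using weighted_mass_bind[OF \<nu> kernel_measurable, of UNIV] weighted_mass_UNIV_pos[OF bind_kernel_prob[OF \<nu>]]
      by (simp add: space)
    fix A assume "A \<in> sets \<nu>"
    then have A: "A \<in> sets borel"
      by (simp add: sets)
    show "(\<lambda>x. surv (K x) A) \<in> borel_measurable \<nu>"
      using weighted_mass_measurable[OF kernel_measurable A] by (simp cong: measurable_cong_sets add: sets)
    show "measure \<nu> A = (\<integral>x. surv (K x) A \<partial>\<nu>) / (\<integral>x. surv (K x) (space \<nu>) \<partial>\<nu>)"
      unfolding space using qsd A by (rule euler_qsd_fixed_point)
    show "\<alpha> * measure cube_measure A \<le> surv (K x) A" "surv (K x) A \<le> \<beta> * measure cube_measure A" for x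
      using A by (rule \<alpha>\<beta>)+
  qed (rule \<alpha>\<beta> prob)+
  define \<eta>' where "\<eta>' = mean_field_law b lam \<gamma> \<eta>"
  have \<eta>': "\<eta>' n \<in> space (prob_algebra borel)" for n
    unfolding \<eta>'_def by (rule mean_field_law_prob[OF \<eta>])
  have \<eta>'_prob: "prob_space (\<eta>' n)" and \<eta>'_sets: "sets (\<eta>' n) = sets \<nu>" for n
    using \<eta>'[of n] by (simp_all add: space_prob_algebra sets)
  have step: "measure (\<eta>' (Suc n)) A = (\<integral>x. surv (K x) A \<partial>\<eta>' n) / (\<integral>x. surv (K x) (space \<nu>) \<partial>\<eta>' n)"
    if "A \<in> sets \<nu>" for n A
  proof -
    have "\<eta>' (Suc n) = \<eta>' n \<bind> Q_kernel b lam \<gamma> (\<eta>' n)"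
      by (simp add: \<eta>'_def)
    moreover have "A \<in> sets borel" "UNIV \<in> sets (borel :: 'd torus measure)"
      using that sets by simp_all
    ultimately show ?thesis
      unfolding space
      by (simp only: measure_mean_field_step[OF \<eta>'] weighted_mass_bind[OF \<eta>' kernel_measurable])
  qed
  define c where "c = (1 / \<epsilon>)\<^sup>2 - 1"
  have "1 \<le> (1 / \<epsilon>)\<^sup>2"
    using \<epsilon> by (intro one_le_power) simp
  then have c: "0 \<le> c"
    by (simp add: c_def)
  show thesis
  proof (rule that[of "1 - \<epsilon>" c])
    fix n A assume "A \<in> sets (borel :: 'd torus measure)"
    then have A: "A \<in> sets \<nu>"
      by (simp add: sets)
    have "comparable \<nu> (\<eta>' (Suc n)) ((1 - \<epsilon>) ^ n * c)"
      unfolding c_def using \<eta>'_prob \<eta>'_sets step by (rule comparable_iterate)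
    moreover have "0 \<le> (1 - \<epsilon>) ^ n * c"
      using \<epsilon> c by simp
    ultimately have "measure (\<eta>' (Suc n)) A \<le> (1 + (1 - \<epsilon>) ^ n * c) * measure \<nu> A"
      using prob \<eta>'_prob \<eta>'_sets A by (intro comparable_imp_le)
    then show "measure (mean_field_law b lam \<gamma> \<eta> (Suc n)) A \<le> (1 + (1 - \<epsilon>) ^ n * c) * measure \<nu> A"
      by (simp only: \<eta>'_def)
  qed (use \<epsilon> c in auto)
qed

end

text \<open>An even number of terms: then the bound also holds when \<open>x > 2\<close>.\<close>

lemma geometric_partial_sum_le:
  fixes x :: real
  assumes "0 < x"
  shows "(\<Sum>s = 1..2 * n. (1 - x) ^ (s - 1)) \<le> inverse x"
proof -
  have "(\<Sum>s = 1..2 * n. (1 - x) ^ (s - 1)) = (\<Sum>s<2 * n. (1 - x) ^ s)"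
    by (rule sum.reindex_bij_witness[of _ Suc "\<lambda>s. s - 1"]) auto
  also have "\<dots> = (1 - (1 - x) ^ (2 * n)) / x"
    using assms by (simp add: sum_gp_strict)
  also have "\<dots> \<le> 1 / x"
    using assms by (intro divide_right_mono) auto
  finally show ?thesis
    by (simp add: inverse_eq_divide)
qed

theorem corollary19:
  fixes b :: "'d::finite torus \<Rightarrow> real ^ 'd" and lam :: "'d torus \<Rightarrow> real"
    and L c1 c2 a \<gamma>0 C6 :: real and nu_star :: "'d torus measure"
  assumes b: "C1_torus b"
    and lam_nonneg: "\<And>x. 0 \<le> lam x"
    and lam_lipschitz: "L-lipschitz_on UNIV lam"
    and constants_pos: "0 < c1" "0 < a" "0 < \<gamma>0" "0 < c2" "0 < C6"
    and euler_contraction: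
      "\<And>\<gamma> \<mu> \<nu>. \<lbrakk>0 < \<gamma>; \<gamma> \<le> \<gamma>0;
           \<mu> \<in> space (prob_algebra borel); \<nu> \<in> space (prob_algebra borel)\<rbrakk> \<Longrightarrow>
         wasserstein (rho a) (\<mu> \<bind> euler_kernel b \<gamma>) (\<nu> \<bind> euler_kernel b \<gamma>)
           \<le> (1 - c1 * \<gamma>) * wasserstein (rho a) \<mu> \<nu>"
    and particle_contraction:
      "\<And>\<gamma> N \<mu> \<nu>. \<lbrakk>0 < \<gamma>; \<gamma> \<le> \<gamma>0; 1 \<le> N;
           \<mu> \<in> space (prob_algebra (PiM {..<N} (\<lambda>_. borel)));
           \<nu> \<in> space (prob_algebra (PiM {..<N} (\<lambda>_. borel)))\<rbrakk> \<Longrightarrow>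
         wasserstein (rho_N a N)
             (\<mu> \<bind> particle_kernel b lam \<gamma> N) (\<nu> \<bind> particle_kernel b lam \<gamma> N)
           \<le> (1 - \<gamma> * kappa lam L c1 c2 \<gamma>) * wasserstein (rho_N a N) \<mu> \<nu>"
    and one_step_error:
      "\<And>\<gamma> \<eta>0. \<lbrakk>0 < \<gamma>; \<gamma> \<le> \<gamma>0; \<eta>0 \<in> space (prob_algebra borel)\<rbrakk> \<Longrightarrow>
         wasserstein dist (mean_field_law b lam \<gamma> \<eta>0 1) (killed_diffusion_law b lam \<eta>0 \<gamma>)
           \<le> C6 * \<gamma> powr (3 / 2)"
    and discretization_error:
      "\<And>\<gamma> \<eta>0 m. \<lbrakk>0 < \<gamma>; \<gamma> \<le> \<gamma>0; \<eta>0 \<in> space (prob_algebra borel); 1 \<le> m\<rbrakk> \<Longrightarrow>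
         wasserstein (rho a) (mean_field_law b lam \<gamma> \<eta>0 m)
             (killed_diffusion_law b lam \<eta>0 (real m * \<gamma>))
           \<le> sqrt \<gamma> * C6 * \<gamma> * (\<Sum>s=1..m. (1 - \<gamma> * kappa lam L c1 c2 \<gamma>) ^ (s - 1))"
    and nu_star: "diffusion_qsd b lam nu_star"
  shows "\<forall>\<gamma>. 0 < \<gamma> \<and> \<gamma> \<le> \<gamma>0 \<and> kappa lam L c1 c2 \<gamma> > 0 \<longrightarrow>
           (\<forall>nu_gamma. euler_qsd b lam \<gamma> nu_gamma \<longrightarrow>
              wasserstein (rho a) nu_gamma nu_star
                \<le> sqrt \<gamma> * inverse (kappa lam L c1 c2 \<gamma>) * C6)"
proof (intro allI impI, elim conjE)
  fix \<gamma> nu_gamma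
  assume \<gamma>: "0 < \<gamma>" "\<gamma> \<le> \<gamma>0" and \<kappa>: "0 < kappa lam L c1 c2 \<gamma>" and qsd: "euler_qsd b lam \<gamma> nu_gamma"
  define \<kappa> where "\<kappa> = kappa lam L c1 c2 \<gamma>"
  interpret killed_euler b lam \<gamma>
    by unfold_locales
       (use C1_torus_continuous[OF b] lipschitz_on_continuous_on[OF lam_lipschitz] lam_nonneg \<gamma> in auto)
  have nu_star_prob: "nu_star \<in> space (prob_algebra borel)" and
    nu_star_fixed: "\<And>t. 0 \<le> t \<Longrightarrow> killed_diffusion_law b lam nu_star t = nu_star"
    using nu_star by (simp_all add: diffusion_qsd_def)
  have nu_gamma_prob: "nu_gamma \<in> space (prob_algebra borel)"
    using qsd by (simp add: euler_qsd_def)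
  obtain q c where q: "0 \<le> q" "q < 1" and c: "0 \<le> c" and
    le: "\<And>n A. A \<in> sets borel \<Longrightarrow>
      measure (mean_field_law b lam \<gamma> nu_star (Suc n)) A \<le> (1 + q ^ n * c) * measure nu_gamma A"
    using mean_field_law_le_euler_qsd[OF qsd nu_star_prob] by blast
  \<comment> \<open>The mean-field law is taken at time \<open>m = 2 * Suc n\<close>: even for the
    geometric sum, and equal to \<open>Suc (2 * n + 1)\<close> for the domination. The vanishing
    term \<open>inverse (real (Suc n))\<close> keeps the perturbation strictly positive even when
    \<open>q\<close> or \<open>c\<close> is 0.\<close>
  have bound: "wasserstein (rho a) nu_gamma nu_star
      \<le> sqrt \<gamma> * inverse \<kappa> * C6 + (q ^ (2 * n + 1) * c + inverse (real (Suc n))) / a" for n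
  proof -
    define m where "m = 2 * Suc n"
    have m: "1 \<le> m" "m = Suc (2 * n + 1)"
      by (simp_all add: m_def)
    have "(\<Sum>s = 1..m. (1 - \<gamma> * \<kappa>) ^ (s - 1)) \<le> inverse (\<gamma> * \<kappa>)"
      using \<gamma>(1) \<kappa> unfolding \<kappa>_def m_def by (intro geometric_partial_sum_le mult_pos_pos)
    then have "sqrt \<gamma> * C6 * \<gamma> * (\<Sum>s = 1..m. (1 - \<gamma> * \<kappa>) ^ (s - 1)) \<le> sqrt \<gamma> * C6 * \<gamma> * inverse (\<gamma> * \<kappa>)"
      using \<gamma>(1) constants_pos by (intro mult_left_mono) auto
    also have "\<dots> = sqrt \<gamma> * inverse \<kappa> * C6"
      using \<gamma>(1) by simp
    \<comment> \<open>Started at \<open>nu_star\<close>, the diffusion conditioned on survival still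
      has law \<open>nu_star\<close> at time \<open>m * \<gamma>\<close>, so the discretization
      error measures the distance to \<open>nu_star\<close> itself.\<close>
    finally have "wasserstein (rho a) (mean_field_law b lam \<gamma> nu_star m) nu_star \<le> sqrt \<gamma> * inverse \<kappa> * C6"
      using discretization_error[OF \<gamma> nu_star_prob m(1)] nu_star_fixed[of "real m * \<gamma>"] \<gamma>(1)
      unfolding \<kappa>_def by (simp only: mult_nonneg_nonneg of_nat_0_le_iff less_imp_le)
    moreover have "wasserstein (rho a) nu_gamma nu_star \<le> wasserstein (rho a) (mean_field_law b lam \<gamma> nu_star m) nu_star
        + (q ^ (2 * n + 1) * c + inverse (real (Suc n))) / a"
    proof (rule wasserstein_rho_perturb[OF _ _ nu_gamma_prob mean_field_law_prob[OF nu_star_prob] nu_star_prob])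
      show "0 < q ^ (2 * n + 1) * c + inverse (real (Suc n))"
        using q c by (intro add_nonneg_pos) auto
      fix A :: "'d torus set" assume A: "A \<in> sets borel"
      have "measure (mean_field_law b lam \<gamma> nu_star m) A \<le> (1 + q ^ (2 * n + 1) * c) * measure nu_gamma A"
        unfolding m(2) using A by (rule le)
      also have "\<dots> \<le> (1 + (q ^ (2 * n + 1) * c + inverse (real (Suc n)))) * measure nu_gamma A"
        by (intro mult_right_mono) auto
      finally show "measure (mean_field_law b lam \<gamma> nu_star m) A
          \<le> (1 + (q ^ (2 * n + 1) * c + inverse (real (Suc n)))) * measure nu_gamma A" .
    qed (use constants_pos in simp)
    ultimately show ?thesis
      by linarith
  qed
  \<comment> \<open>The left side of \<open>bound\<close> does not depend on \<open>n\<close>, so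
    the perturbation terms disappear in the limit.\<close>
  have "(\<lambda>n. q ^ (2 * n + 1)) \<longlonglongrightarrow> 0"
    using LIMSEQ_subseq_LIMSEQ[OF LIMSEQ_realpow_zero[OF q], of "\<lambda>n. 2 * n + 1"]
    by (simp add: strict_mono_def comp_def)
  then have "(\<lambda>n. sqrt \<gamma> * inverse \<kappa> * C6 + (q ^ (2 * n + 1) * c + inverse (real (Suc n))) / a)
      \<longlonglongrightarrow> sqrt \<gamma> * inverse \<kappa> * C6 + (0 * c + 0) / a"
    using constants_pos by (intro tendsto_intros LIMSEQ_inverse_real_of_nat) auto
  then have "wasserstein (rho a) nu_gamma nu_star \<le> sqrt \<gamma> * inverse \<kappa> * C6 + (0 * c + 0) / a"
    by (rule LIMSEQ_le_const) (use bound in blast)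
  then show "wasserstein (rho a) nu_gamma nu_star \<le> sqrt \<gamma> * inverse (kappa lam L c1 c2 \<gamma>) * C6"
    by (simp add: \<kappa>_def)
qed

end
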